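(* Let $\mathcal{C}$ be a braided finite tensor category. Then the lattice $\mathfrak{L}_{\otimes}(\mathcal{C})$ of tensor subcategories of $\mathcal{C}$ is modular.
   Context: The base field $\Bbbk$ is algebraically closed. A finite tensor category is a rigid monoidal, finite $\Bbbk$-linear abelian category with bilinear tensor product and simple unit object. A tensor subcategory of $\mathcal{C}$ is a full subcategory containing the unit and closed under subobjects, quotients, finite direct sums, tensor products and duals. $\mathfrak{L}_{\otimes}(\mathcal{C})$ is ordered by inclusion, with meet given by intersection and join $\mathcal{D}_1\vee\mathcal{D}_2$ the smallest tensor subcategory containing $\mathcal{D}_1$ and $\mathcal{D}_2$. A lattice is modular if $x\le z$ implies $x\vee(y\wedge z)=(x\vee y)\wedge z$ for all $x,y,z$. *)

theory Defs
  imports "HOL-Algebra.Algebraic_Closure"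
begin

no_notation var ("X\<index>")  (* keeps X usable as a variable *)

section \<open>Categories\<close>

record ('o, 'm) category =
  Obj :: "'o set"
  Hom :: "'o \<Rightarrow> 'o \<Rightarrow> 'm set"
  ident :: "'o \<Rightarrow> 'm"
  cmp :: "'m \<Rightarrow> 'm \<Rightarrow> 'm" (infixl "\<cdot>\<index>" 70)

locale category =
  fixes C (structure)
  assumes Hom_disjoint:
      "\<lbrakk>X \<in> Obj C; Y \<in> Obj C; X' \<in> Obj C; Y' \<in> Obj C; f \<in> Hom C X Y; f \<in> Hom C X' Y'\<rbrakk>
        \<Longrightarrow> X = X' \<and> Y = Y'"
    and ident_closed: "X \<in> Obj C \<Longrightarrow> ident C X \<in> Hom C X X"
    and cmp_closed:
      "\<lbrakk>X \<in> Obj C; Y \<in> Obj C; Z \<in> Obj C; f \<in> Hom C X Y; g \<in> Hom C Y Z\<rbrakk>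
        \<Longrightarrow> g \<cdot> f \<in> Hom C X Z"
    and cmp_ident_right: "\<lbrakk>X \<in> Obj C; Y \<in> Obj C; f \<in> Hom C X Y\<rbrakk> \<Longrightarrow> f \<cdot> ident C X = f"
    and cmp_ident_left: "\<lbrakk>X \<in> Obj C; Y \<in> Obj C; f \<in> Hom C X Y\<rbrakk> \<Longrightarrow> ident C Y \<cdot> f = f"
    and cmp_assoc:
      "\<lbrakk>W \<in> Obj C; X \<in> Obj C; Y \<in> Obj C; Z \<in> Obj C;
        f \<in> Hom C W X; g \<in> Hom C X Y; h \<in> Hom C Y Z\<rbrakk> \<Longrightarrow> (h \<cdot> g) \<cdot> f = h \<cdot> (g \<cdot> f)"

definition inverse_arrows where
  "inverse_arrows C X Y f g \<longleftrightarrow> f \<in> Hom C X Y \<and> g \<in> Hom C Y X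
     \<and> g \<cdot>\<^bsub>C\<^esub> f = ident C X \<and> f \<cdot>\<^bsub>C\<^esub> g = ident C Y"

definition is_iso where
  "is_iso C X Y f \<longleftrightarrow> (\<exists>g. inverse_arrows C X Y f g)"

definition arrow_inverse where
  "arrow_inverse C X Y f = (THE g. inverse_arrows C X Y f g)"

definition isomorphic where
  "isomorphic C X Y \<longleftrightarrow> (\<exists>f. is_iso C X Y f)"

definition is_mono where
  "is_mono C X Y f \<longleftrightarrow> f \<in> Hom C X Y \<and>
     (\<forall>W\<in>Obj C. \<forall>g\<in>Hom C W X. \<forall>h\<in>Hom C W X. f \<cdot>\<^bsub>C\<^esub> g = f \<cdot>\<^bsub>C\<^esub> h \<longrightarrow> g = h)"

definition is_epi where
  "is_epi C X Y f \<longleftrightarrow> f \<in> Hom C X Y \<and>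
     (\<forall>Z\<in>Obj C. \<forall>g\<in>Hom C Y Z. \<forall>h\<in>Hom C Y Z. g \<cdot>\<^bsub>C\<^esub> f = h \<cdot>\<^bsub>C\<^esub> f \<longrightarrow> g = h)"

definition is_zero_object where
  "is_zero_object C Z \<longleftrightarrow> Z \<in> Obj C \<and>
     (\<forall>X\<in>Obj C. (\<exists>!f. f \<in> Hom C X Z) \<and> (\<exists>!f. f \<in> Hom C Z X))"

definition is_simple where
  "is_simple C S \<longleftrightarrow> S \<in> Obj C \<and> \<not> is_zero_object C S \<and>
     (\<forall>X\<in>Obj C. \<forall>i. is_mono C X S i \<longrightarrow> is_zero_object C X \<or> is_iso C X S i)"

definition is_projective where
  "is_projective C P \<longleftrightarrow> P \<in> Obj C \<and>
     (\<forall>X\<in>Obj C. \<forall>Y\<in>Obj C. \<forall>e f. is_epi C X Y e \<and> f \<in> Hom C P Y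
        \<longrightarrow> (\<exists>g\<in>Hom C P X. e \<cdot>\<^bsub>C\<^esub> g = f))"

section \<open>Finite linear abelian categories\<close>

text \<open>Only the additive group and the scalar multiplication of the record
  \<open>hom_space C X Y\<close> are meaningful; its \<open>mult\<close> and \<open>one\<close> fields are unconstrained.\<close>

record ('o, 'm, 'k) linear_category = "('o, 'm) category" +
  hom_space :: "'o \<Rightarrow> 'o \<Rightarrow> ('k, 'm) module"

locale linear_category = category C + field K for K and C (structure) +
  assumes hom_space_carrier:
      "\<lbrakk>X \<in> Obj C; Y \<in> Obj C\<rbrakk> \<Longrightarrow> carrier (hom_space C X Y) = Hom C X Y"
    and hom_space_module: "\<lbrakk>X \<in> Obj C; Y \<in> Obj C\<rbrakk> \<Longrightarrow> module K (hom_space C X Y)"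
    and cmp_add_right:
      "\<lbrakk>X \<in> Obj C; Y \<in> Obj C; Z \<in> Obj C; f \<in> Hom C X Y; f' \<in> Hom C X Y; g \<in> Hom C Y Z\<rbrakk>
        \<Longrightarrow> g \<cdot> (f \<oplus>\<^bsub>hom_space C X Y\<^esub> f') = (g \<cdot> f) \<oplus>\<^bsub>hom_space C X Z\<^esub> (g \<cdot> f')"
    and cmp_add_left:
      "\<lbrakk>X \<in> Obj C; Y \<in> Obj C; Z \<in> Obj C; f \<in> Hom C X Y; g \<in> Hom C Y Z; g' \<in> Hom C Y Z\<rbrakk>
        \<Longrightarrow> (g \<oplus>\<^bsub>hom_space C Y Z\<^esub> g') \<cdot> f = (g \<cdot> f) \<oplus>\<^bsub>hom_space C X Z\<^esub> (g' \<cdot> f)"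
    and cmp_smult_right:
      "\<lbrakk>X \<in> Obj C; Y \<in> Obj C; Z \<in> Obj C; a \<in> carrier K; f \<in> Hom C X Y; g \<in> Hom C Y Z\<rbrakk>
        \<Longrightarrow> g \<cdot> (a \<odot>\<^bsub>hom_space C X Y\<^esub> f) = a \<odot>\<^bsub>hom_space C X Z\<^esub> (g \<cdot> f)"
    and cmp_smult_left:
      "\<lbrakk>X \<in> Obj C; Y \<in> Obj C; Z \<in> Obj C; a \<in> carrier K; f \<in> Hom C X Y; g \<in> Hom C Y Z\<rbrakk>
        \<Longrightarrow> (a \<odot>\<^bsub>hom_space C Y Z\<^esub> g) \<cdot> f = a \<odot>\<^bsub>hom_space C X Z\<^esub> (g \<cdot> f)"

definition is_kernel where
  "is_kernel C X Y f A k \<longleftrightarrow> k \<in> Hom C A X \<and> f \<cdot>\<^bsub>C\<^esub> k = \<zero>\<^bsub>hom_space C A Y\<^esub> \<and>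
     (\<forall>W\<in>Obj C. \<forall>g\<in>Hom C W X. f \<cdot>\<^bsub>C\<^esub> g = \<zero>\<^bsub>hom_space C W Y\<^esub>
        \<longrightarrow> (\<exists>!u. u \<in> Hom C W A \<and> k \<cdot>\<^bsub>C\<^esub> u = g))"

definition is_cokernel where
  "is_cokernel C X Y f Q q \<longleftrightarrow> q \<in> Hom C Y Q \<and> q \<cdot>\<^bsub>C\<^esub> f = \<zero>\<^bsub>hom_space C X Q\<^esub> \<and>
     (\<forall>Z\<in>Obj C. \<forall>g\<in>Hom C Y Z. g \<cdot>\<^bsub>C\<^esub> f = \<zero>\<^bsub>hom_space C X Z\<^esub>
        \<longrightarrow> (\<exists>!u. u \<in> Hom C Q Z \<and> u \<cdot>\<^bsub>C\<^esub> q = g))"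

definition short_exact where
  "short_exact C X Y Z i p \<longleftrightarrow> is_kernel C Y Z p X i \<and> is_cokernel C X Y i Z p"

definition is_direct_sum where
  "is_direct_sum C X Y Z \<longleftrightarrow> Z \<in> Obj C \<and>
     (\<exists>i\<in>Hom C X Z. \<exists>j\<in>Hom C Y Z. \<exists>p\<in>Hom C Z X. \<exists>q\<in>Hom C Z Y.
        p \<cdot>\<^bsub>C\<^esub> i = ident C X \<and> q \<cdot>\<^bsub>C\<^esub> j = ident C Y \<and>
        p \<cdot>\<^bsub>C\<^esub> j = \<zero>\<^bsub>hom_space C Y X\<^esub> \<and> q \<cdot>\<^bsub>C\<^esub> i = \<zero>\<^bsub>hom_space C X Y\<^esub> \<and>
        (i \<cdot>\<^bsub>C\<^esub> p) \<oplus>\<^bsub>hom_space C Z Z\<^esub> (j \<cdot>\<^bsub>C\<^esub> q) = ident C Z)"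

locale linear_abelian_category = linear_category +
  assumes zero_object_exists: "\<exists>Z. is_zero_object C Z"
    and direct_sum_exists:
      "\<lbrakk>X \<in> Obj C; Y \<in> Obj C\<rbrakk> \<Longrightarrow> \<exists>Z. is_direct_sum C X Y Z"
    and kernel_exists:
      "\<lbrakk>X \<in> Obj C; Y \<in> Obj C; f \<in> Hom C X Y\<rbrakk> \<Longrightarrow> \<exists>A\<in>Obj C. \<exists>k. is_kernel C X Y f A k"
    and cokernel_exists:
      "\<lbrakk>X \<in> Obj C; Y \<in> Obj C; f \<in> Hom C X Y\<rbrakk> \<Longrightarrow> \<exists>Q\<in>Obj C. \<exists>q. is_cokernel C X Y f Q q"
    and mono_is_kernel:
      "\<lbrakk>X \<in> Obj C; Y \<in> Obj C; is_mono C X Y f\<rbrakk>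
        \<Longrightarrow> \<exists>Z\<in>Obj C. \<exists>g\<in>Hom C Y Z. is_kernel C Y Z g X f"
    and epi_is_cokernel:
      "\<lbrakk>X \<in> Obj C; Y \<in> Obj C; is_epi C X Y f\<rbrakk>
        \<Longrightarrow> \<exists>W\<in>Obj C. \<exists>g\<in>Hom C W X. is_cokernel C W X g Y f"

definition finite_dimensional where
  "finite_dimensional K M \<longleftrightarrow> (\<exists>B. finite B \<and> B \<subseteq> carrier M \<and>
     (\<forall>x\<in>carrier M. \<exists>a\<in>B \<rightarrow> carrier K. x = (\<Oplus>\<^bsub>M\<^esub>b\<in>B. a b \<odot>\<^bsub>M\<^esub> b)))"

text \<open>A derivation of \<open>finite_length C X\<close> is a finite filtration of \<open>X\<close> with simple
  successive quotients.\<close>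

inductive finite_length for C where
  zero: "is_zero_object C X \<Longrightarrow> finite_length C X"
| extend: "\<lbrakk>finite_length C Y; X \<in> Obj C; is_simple C S; short_exact C Y X S i p\<rbrakk>
    \<Longrightarrow> finite_length C X"

locale finite_linear_abelian_category = linear_abelian_category +
  assumes Hom_finite_dimensional:
      "\<lbrakk>X \<in> Obj C; Y \<in> Obj C\<rbrakk> \<Longrightarrow> finite_dimensional K (hom_space C X Y)"
    and objects_finite_length: "X \<in> Obj C \<Longrightarrow> finite_length C X"
    and enough_projectives: "X \<in> Obj C \<Longrightarrow> \<exists>P e. is_projective C P \<and> is_epi C P X e"
    and finitely_many_simples:
      "\<exists>\<S>. finite \<S> \<and> \<S> \<subseteq> Obj C \<and> (\<forall>S. is_simple C S \<longrightarrow> (\<exists>T\<in>\<S>. isomorphic C S T))"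

section \<open>Tensor categories\<close>

record ('o, 'm, 'k) tensor_category = "('o, 'm, 'k) linear_category" +
  tensor_obj :: "'o \<Rightarrow> 'o \<Rightarrow> 'o" (infixl "\<otimes>\<^sub>o\<index>" 75)
  tensor_arr :: "'m \<Rightarrow> 'm \<Rightarrow> 'm" (infixl "\<otimes>\<^sub>a\<index>" 75)
  unit_obj :: 'o
  associator :: "'o \<Rightarrow> 'o \<Rightarrow> 'o \<Rightarrow> 'm"
  left_unitor :: "'o \<Rightarrow> 'm"
  right_unitor :: "'o \<Rightarrow> 'm"

locale monoidal_category = category C for C (structure) +
  assumes tensor_obj_closed: "\<lbrakk>X \<in> Obj C; Y \<in> Obj C\<rbrakk> \<Longrightarrow> X \<otimes>\<^sub>o Y \<in> Obj C"
    and tensor_arr_closed: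
      "\<lbrakk>X \<in> Obj C; X' \<in> Obj C; Y \<in> Obj C; Y' \<in> Obj C; f \<in> Hom C X X'; g \<in> Hom C Y Y'\<rbrakk>
        \<Longrightarrow> f \<otimes>\<^sub>a g \<in> Hom C (X \<otimes>\<^sub>o Y) (X' \<otimes>\<^sub>o Y')"
    and tensor_ident:
      "\<lbrakk>X \<in> Obj C; Y \<in> Obj C\<rbrakk> \<Longrightarrow> ident C X \<otimes>\<^sub>a ident C Y = ident C (X \<otimes>\<^sub>o Y)"
    and tensor_cmp:
      "\<lbrakk>X \<in> Obj C; X' \<in> Obj C; X'' \<in> Obj C; Y \<in> Obj C; Y' \<in> Obj C; Y'' \<in> Obj C;
        f \<in> Hom C X X'; f' \<in> Hom C X' X''; g \<in> Hom C Y Y'; g' \<in> Hom C Y' Y''\<rbrakk>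
        \<Longrightarrow> (f' \<cdot> f) \<otimes>\<^sub>a (g' \<cdot> g) = (f' \<otimes>\<^sub>a g') \<cdot> (f \<otimes>\<^sub>a g)"
    and unit_obj_closed: "unit_obj C \<in> Obj C"
    and associator_iso:
      "\<lbrakk>X \<in> Obj C; Y \<in> Obj C; Z \<in> Obj C\<rbrakk>
        \<Longrightarrow> is_iso C ((X \<otimes>\<^sub>o Y) \<otimes>\<^sub>o Z) (X \<otimes>\<^sub>o (Y \<otimes>\<^sub>o Z)) (associator C X Y Z)"
    and associator_natural:
      "\<lbrakk>X \<in> Obj C; X' \<in> Obj C; Y \<in> Obj C; Y' \<in> Obj C; Z \<in> Obj C; Z' \<in> Obj C;
        f \<in> Hom C X X'; g \<in> Hom C Y Y'; h \<in> Hom C Z Z'\<rbrakk>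
        \<Longrightarrow> associator C X' Y' Z' \<cdot> ((f \<otimes>\<^sub>a g) \<otimes>\<^sub>a h) = (f \<otimes>\<^sub>a (g \<otimes>\<^sub>a h)) \<cdot> associator C X Y Z"
    and left_unitor_iso:
      "X \<in> Obj C \<Longrightarrow> is_iso C (unit_obj C \<otimes>\<^sub>o X) X (left_unitor C X)"
    and left_unitor_natural:
      "\<lbrakk>X \<in> Obj C; X' \<in> Obj C; f \<in> Hom C X X'\<rbrakk>
        \<Longrightarrow> left_unitor C X' \<cdot> (ident C (unit_obj C) \<otimes>\<^sub>a f) = f \<cdot> left_unitor C X"
    and right_unitor_iso:
      "X \<in> Obj C \<Longrightarrow> is_iso C (X \<otimes>\<^sub>o unit_obj C) X (right_unitor C X)"
    and right_unitor_natural: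
      "\<lbrakk>X \<in> Obj C; X' \<in> Obj C; f \<in> Hom C X X'\<rbrakk>
        \<Longrightarrow> right_unitor C X' \<cdot> (f \<otimes>\<^sub>a ident C (unit_obj C)) = f \<cdot> right_unitor C X"
    and pentagon:
      "\<lbrakk>W \<in> Obj C; X \<in> Obj C; Y \<in> Obj C; Z \<in> Obj C\<rbrakk>
        \<Longrightarrow> (ident C W \<otimes>\<^sub>a associator C X Y Z) \<cdot> associator C W (X \<otimes>\<^sub>o Y) Z
               \<cdot> (associator C W X Y \<otimes>\<^sub>a ident C Z)
            = associator C W X (Y \<otimes>\<^sub>o Z) \<cdot> associator C (W \<otimes>\<^sub>o X) Y Z"
    and triangle:
      "\<lbrakk>X \<in> Obj C; Y \<in> Obj C\<rbrakk>
        \<Longrightarrow> (ident C X \<otimes>\<^sub>a left_unitor C Y) \<cdot> associator C X (unit_obj C) Y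
            = right_unitor C X \<otimes>\<^sub>a ident C Y"

text \<open>\<open>V\<close> is a left dual of \<open>X\<close>: there are an evaluation \<open>V \<otimes> X \<rightarrow> 1\<close> and a coevaluation
  \<open>1 \<rightarrow> X \<otimes> V\<close> satisfying the two zigzag identities; both identities are composed with a
  unitor, so that only the inverse of the associator occurs. The object \<open>V\<close> is a right dual
  of \<open>X\<close> iff \<open>X\<close> is a left dual of \<open>V\<close>.\<close>

definition is_left_dual where
  "is_left_dual C X V \<longleftrightarrow> V \<in> Obj C \<and> X \<in> Obj C \<and>
     (\<exists>ev\<in>Hom C (V \<otimes>\<^sub>o\<^bsub>C\<^esub> X) (unit_obj C). \<exists>coev\<in>Hom C (unit_obj C) (X \<otimes>\<^sub>o\<^bsub>C\<^esub> V).
        right_unitor C X \<cdot>\<^bsub>C\<^esub> (ident C X \<otimes>\<^sub>a\<^bsub>C\<^esub> ev) \<cdot>\<^bsub>C\<^esub> associator C X V X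
            \<cdot>\<^bsub>C\<^esub> (coev \<otimes>\<^sub>a\<^bsub>C\<^esub> ident C X)
          = left_unitor C X \<and>
        left_unitor C V \<cdot>\<^bsub>C\<^esub> (ev \<otimes>\<^sub>a\<^bsub>C\<^esub> ident C V)
            \<cdot>\<^bsub>C\<^esub> arrow_inverse C ((V \<otimes>\<^sub>o\<^bsub>C\<^esub> X) \<otimes>\<^sub>o\<^bsub>C\<^esub> V) (V \<otimes>\<^sub>o\<^bsub>C\<^esub> (X \<otimes>\<^sub>o\<^bsub>C\<^esub> V)) (associator C V X V)
            \<cdot>\<^bsub>C\<^esub> (ident C V \<otimes>\<^sub>a\<^bsub>C\<^esub> coev)
          = right_unitor C V)"

definition is_right_dual where
  "is_right_dual C X V \<longleftrightarrow> is_left_dual C V X"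

locale rigid_monoidal_category = monoidal_category +
  assumes left_dual_exists: "X \<in> Obj C \<Longrightarrow> \<exists>V. is_left_dual C X V"
    and right_dual_exists: "X \<in> Obj C \<Longrightarrow> \<exists>V. is_right_dual C X V"

locale finite_tensor_category =
  rigid_monoidal_category C + finite_linear_abelian_category K C for K and C (structure) +
  assumes tensor_add_left:
      "\<lbrakk>X \<in> Obj C; X' \<in> Obj C; Y \<in> Obj C; Y' \<in> Obj C;
        f \<in> Hom C X X'; f' \<in> Hom C X X'; g \<in> Hom C Y Y'\<rbrakk>
        \<Longrightarrow> (f \<oplus>\<^bsub>hom_space C X X'\<^esub> f') \<otimes>\<^sub>a g
            = (f \<otimes>\<^sub>a g) \<oplus>\<^bsub>hom_space C (X \<otimes>\<^sub>o Y) (X' \<otimes>\<^sub>o Y')\<^esub> (f' \<otimes>\<^sub>a g)"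
    and tensor_add_right:
      "\<lbrakk>X \<in> Obj C; X' \<in> Obj C; Y \<in> Obj C; Y' \<in> Obj C;
        f \<in> Hom C X X'; g \<in> Hom C Y Y'; g' \<in> Hom C Y Y'\<rbrakk>
        \<Longrightarrow> f \<otimes>\<^sub>a (g \<oplus>\<^bsub>hom_space C Y Y'\<^esub> g')
            = (f \<otimes>\<^sub>a g) \<oplus>\<^bsub>hom_space C (X \<otimes>\<^sub>o Y) (X' \<otimes>\<^sub>o Y')\<^esub> (f \<otimes>\<^sub>a g')"
    and tensor_smult_left:
      "\<lbrakk>X \<in> Obj C; X' \<in> Obj C; Y \<in> Obj C; Y' \<in> Obj C;
        a \<in> carrier K; f \<in> Hom C X X'; g \<in> Hom C Y Y'\<rbrakk>
        \<Longrightarrow> (a \<odot>\<^bsub>hom_space C X X'\<^esub> f) \<otimes>\<^sub>a g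
            = a \<odot>\<^bsub>hom_space C (X \<otimes>\<^sub>o Y) (X' \<otimes>\<^sub>o Y')\<^esub> (f \<otimes>\<^sub>a g)"
    and tensor_smult_right:
      "\<lbrakk>X \<in> Obj C; X' \<in> Obj C; Y \<in> Obj C; Y' \<in> Obj C;
        a \<in> carrier K; f \<in> Hom C X X'; g \<in> Hom C Y Y'\<rbrakk>
        \<Longrightarrow> f \<otimes>\<^sub>a (a \<odot>\<^bsub>hom_space C Y Y'\<^esub> g)
            = a \<odot>\<^bsub>hom_space C (X \<otimes>\<^sub>o Y) (X' \<otimes>\<^sub>o Y')\<^esub> (f \<otimes>\<^sub>a g)"
    and unit_simple: "is_simple C (unit_obj C)"

record ('o, 'm, 'k) braided_category = "('o, 'm, 'k) tensor_category" +
  braiding :: "'o \<Rightarrow> 'o \<Rightarrow> 'm"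

locale braided_monoidal_category = monoidal_category C for C (structure) +
  assumes braiding_iso:
      "\<lbrakk>X \<in> Obj C; Y \<in> Obj C\<rbrakk> \<Longrightarrow> is_iso C (X \<otimes>\<^sub>o Y) (Y \<otimes>\<^sub>o X) (braiding C X Y)"
    and braiding_natural:
      "\<lbrakk>X \<in> Obj C; X' \<in> Obj C; Y \<in> Obj C; Y' \<in> Obj C; f \<in> Hom C X X'; g \<in> Hom C Y Y'\<rbrakk>
        \<Longrightarrow> braiding C X' Y' \<cdot> (f \<otimes>\<^sub>a g) = (g \<otimes>\<^sub>a f) \<cdot> braiding C X Y"
    and hexagon_left:
      "\<lbrakk>X \<in> Obj C; Y \<in> Obj C; Z \<in> Obj C\<rbrakk>
        \<Longrightarrow> associator C Y Z X \<cdot> braiding C X (Y \<otimes>\<^sub>o Z) \<cdot> associator C X Y Z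
            = (ident C Y \<otimes>\<^sub>a braiding C X Z) \<cdot> associator C Y X Z
                \<cdot> (braiding C X Y \<otimes>\<^sub>a ident C Z)"
    and hexagon_right:
      "\<lbrakk>X \<in> Obj C; Y \<in> Obj C; Z \<in> Obj C\<rbrakk>
        \<Longrightarrow> arrow_inverse C ((Z \<otimes>\<^sub>o X) \<otimes>\<^sub>o Y) (Z \<otimes>\<^sub>o (X \<otimes>\<^sub>o Y)) (associator C Z X Y)
              \<cdot> braiding C (X \<otimes>\<^sub>o Y) Z
              \<cdot> arrow_inverse C ((X \<otimes>\<^sub>o Y) \<otimes>\<^sub>o Z) (X \<otimes>\<^sub>o (Y \<otimes>\<^sub>o Z)) (associator C X Y Z)
            = (braiding C X Z \<otimes>\<^sub>a ident C Y)
              \<cdot> arrow_inverse C ((X \<otimes>\<^sub>o Z) \<otimes>\<^sub>o Y) (X \<otimes>\<^sub>o (Z \<otimes>\<^sub>o Y)) (associator C X Z Y)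
              \<cdot> (ident C X \<otimes>\<^sub>a braiding C Y Z)"

locale braided_finite_tensor_category =
  finite_tensor_category K C + braided_monoidal_category C for K and C (structure)

section \<open>The lattice of tensor subcategories\<close>

text \<open>A full subcategory is given by its set of objects. Closure under subobjects makes it
  closed under isomorphism, so closure under some choice of direct sums or duals is the same
  as closure under all of them. The zero object is the empty direct sum.\<close>

locale tensor_subcategory =
  fixes C (structure) and D
  assumes subset: "D \<subseteq> Obj C"
    and unit_mem: "unit_obj C \<in> D"
    and subobject_mem: "\<lbrakk>Y \<in> D; X \<in> Obj C; is_mono C X Y i\<rbrakk> \<Longrightarrow> X \<in> D"
    and quotient_mem: "\<lbrakk>X \<in> D; Y \<in> Obj C; is_epi C X Y p\<rbrakk> \<Longrightarrow> Y \<in> D"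
    and zero_mem: "is_zero_object C Z \<Longrightarrow> Z \<in> D"
    and direct_sum_mem: "\<lbrakk>X \<in> D; Y \<in> D; is_direct_sum C X Y Z\<rbrakk> \<Longrightarrow> Z \<in> D"
    and tensor_mem: "\<lbrakk>X \<in> D; Y \<in> D\<rbrakk> \<Longrightarrow> X \<otimes>\<^sub>o Y \<in> D"
    and left_dual_mem: "\<lbrakk>X \<in> D; is_left_dual C X V\<rbrakk> \<Longrightarrow> V \<in> D"
    and right_dual_mem: "\<lbrakk>X \<in> D; is_right_dual C X V\<rbrakk> \<Longrightarrow> V \<in> D"

definition tensor_subcategories where
  "tensor_subcategories C = \<lparr>carrier = {D. tensor_subcategory C D}, eq = (=), le = (\<subseteq>)\<rparr>"

locale modular_lattice = lattice +
  assumes modular: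
    "\<lbrakk>x \<in> carrier L; y \<in> carrier L; z \<in> carrier L; x \<sqsubseteq> z\<rbrakk>
      \<Longrightarrow> x \<squnion> (y \<sqinter> z) = (x \<squnion> y) \<sqinter> z"

text \<open>The order-theoretic meet and join are the intersection and the smallest tensor
  subcategory containing both arguments.\<close>

lemma (in finite_tensor_category) tensor_subcategory_Obj: "tensor_subcategory C (Obj C)"
  by unfold_locales
    (auto simp: unit_obj_closed tensor_obj_closed is_zero_object_def is_direct_sum_def
       is_left_dual_def is_right_dual_def)

lemma tensor_subcategory_Inter:
  assumes "\<D> \<noteq> {}" "\<And>D. D \<in> \<D> \<Longrightarrow> tensor_subcategory C D"
  shows "tensor_subcategory C (\<Inter>\<D>)"
proof (rule tensor_subcategory.intro)
  show "\<Inter>\<D> \<subseteq> Obj C"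
    using assms(1) tensor_subcategory.subset[OF assms(2)] by blast
  show "unit_obj C \<in> \<Inter>\<D>"
    using tensor_subcategory.unit_mem[OF assms(2)] by blast
  show "X \<in> \<Inter>\<D>" if "Y \<in> \<Inter>\<D>" "X \<in> Obj C" "is_mono C X Y i" for X Y i
    using that by (auto intro: tensor_subcategory.subobject_mem[OF assms(2)])
  show "Y \<in> \<Inter>\<D>" if "X \<in> \<Inter>\<D>" "Y \<in> Obj C" "is_epi C X Y p" for X Y p
    using that by (auto intro: tensor_subcategory.quotient_mem[OF assms(2)])
  show "Z \<in> \<Inter>\<D>" if "is_zero_object C Z" for Z
    using that by (auto intro: tensor_subcategory.zero_mem[OF assms(2)])
  show "Z \<in> \<Inter>\<D>" if "X \<in> \<Inter>\<D>" "Y \<in> \<Inter>\<D>" "is_direct_sum C X Y Z" for X Y Z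
    using that by (auto intro: tensor_subcategory.direct_sum_mem[OF assms(2)])
  show "X \<otimes>\<^sub>o\<^bsub>C\<^esub> Y \<in> \<Inter>\<D>" if "X \<in> \<Inter>\<D>" "Y \<in> \<Inter>\<D>" for X Y
    using that by (auto intro: tensor_subcategory.tensor_mem[OF assms(2)])
  show "V \<in> \<Inter>\<D>" if "X \<in> \<Inter>\<D>" "is_left_dual C X V" for X V
    using that by (auto intro: tensor_subcategory.left_dual_mem[OF assms(2)])
  show "V \<in> \<Inter>\<D>" if "X \<in> \<Inter>\<D>" "is_right_dual C X V" for X V
    using that by (auto intro: tensor_subcategory.right_dual_mem[OF assms(2)])
qed

lemma partial_order_tensor_subcategories: "partial_order (tensor_subcategories C)"
  by unfold_locales (auto simp: tensor_subcategories_def)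

lemma greatest_Int_tensor_subcategories:
  assumes "tensor_subcategory C D" "tensor_subcategory C E"
  shows "greatest (tensor_subcategories C) (D \<inter> E) (Lower (tensor_subcategories C) {D, E})"
  using assms tensor_subcategory_Inter[of "{D, E}" C]
  by (auto simp: greatest_def Lower_def tensor_subcategories_def)

lemma (in finite_tensor_category) least_tensor_subcategories:
  assumes "tensor_subcategory C D" "tensor_subcategory C E"
  shows "least (tensor_subcategories C)
           (\<Inter>{F. tensor_subcategory C F \<and> D \<subseteq> F \<and> E \<subseteq> F})
           (Upper (tensor_subcategories C) {D, E})"
proof -
  have "Obj C \<in> {F. tensor_subcategory C F \<and> D \<subseteq> F \<and> E \<subseteq> F}"
    using assms tensor_subcategory_Obj tensor_subcategory.subset by blast
  then have "tensor_subcategory C (\<Inter>{F. tensor_subcategory C F \<and> D \<subseteq> F \<and> E \<subseteq> F})"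
    by (intro tensor_subcategory_Inter) auto
  then show ?thesis
    using assms by (auto simp: least_def Upper_def tensor_subcategories_def)
qed

lemma (in finite_tensor_category) lattice_tensor_subcategories:
  "lattice (tensor_subcategories C)"
proof (intro lattice.intro upper_semilattice.intro lower_semilattice.intro
    upper_semilattice_axioms.intro lower_semilattice_axioms.intro
    partial_order_tensor_subcategories)
  fix D E
  assume "D \<in> carrier (tensor_subcategories C)" "E \<in> carrier (tensor_subcategories C)"
  then have DE: "tensor_subcategory C D" "tensor_subcategory C E"
    by (simp_all add: tensor_subcategories_def)
  show "\<exists>s. least (tensor_subcategories C) s (Upper (tensor_subcategories C) {D, E})"
    by (rule exI, rule least_tensor_subcategories[OF DE])
  show "\<exists>s. greatest (tensor_subcategories C) s (Lower (tensor_subcategories C) {D, E})"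
    by (rule exI, rule greatest_Int_tensor_subcategories[OF DE])
qed

lemma (in finite_tensor_category) meet_tensor_subcategories:
  assumes "tensor_subcategory C D" "tensor_subcategory C E"
  shows "D \<sqinter>\<^bsub>tensor_subcategories C\<^esub> E = D \<inter> E"
  unfolding meet_def inf_def
proof (rule some_equality)
  show g: "greatest (tensor_subcategories C) (D \<inter> E) (Lower (tensor_subcategories C) {D, E})"
    by (rule greatest_Int_tensor_subcategories[OF assms])
  fix x
  assume x: "greatest (tensor_subcategories C) x (Lower (tensor_subcategories C) {D, E})"
  have "le (tensor_subcategories C) x (D \<inter> E)" "le (tensor_subcategories C) (D \<inter> E) x"
    by (rule greatest_le[OF g greatest_mem[OF x]], rule greatest_le[OF x greatest_mem[OF g]])
  then show "x = D \<inter> E"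
    by (auto simp: tensor_subcategories_def)
qed

lemma (in finite_tensor_category) join_tensor_subcategories:
  assumes "tensor_subcategory C D" "tensor_subcategory C E"
  shows "D \<squnion>\<^bsub>tensor_subcategories C\<^esub> E = \<Inter>{F. tensor_subcategory C F \<and> D \<subseteq> F \<and> E \<subseteq> F}"
    (is "_ = ?J")
  unfolding join_def sup_def
proof (rule some_equality)
  show l: "least (tensor_subcategories C) ?J (Upper (tensor_subcategories C) {D, E})"
    by (rule least_tensor_subcategories[OF assms])
  fix x
  assume x: "least (tensor_subcategories C) x (Upper (tensor_subcategories C) {D, E})"
  have "le (tensor_subcategories C) x ?J" "le (tensor_subcategories C) ?J x"
    by (rule least_le[OF x least_mem[OF l]], rule least_le[OF l least_mem[OF x]])
  then show "x = ?J"
    by (auto simp: tensor_subcategories_def)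
qed

end

(* Let D, E, G be tensor subcategories with D contained in G. Because of the braiding, the
   subquotients of the objects X (x) Y with X in D and Y in E form a tensor subcategory, so they are
   the join S of D and E. The key point is that every object of S is already a quotient of some
   X (x) Y: it is a quotient of an object P that is projective relative to S, P is a quotient of a
   subobject of some X (x) Y, hence a subobject, and it splits off, because relatively projective
   objects are relatively injective. Finally an epimorphism X (x) Y -> Z with Z in G corresponds to
   an arrow from Y to V (x) Z, where V is the dual of X; its image I lies in both E and G, and Z is a
   quotient of X (x) I. *)

theory Submission
  imports Defs
begin

section \<open>Arrows with source and target\<close>

text \<open>The adjunction argument needs an epimorphism from a full product X (x) Y: an arrow out
  of a mere subobject of X (x) Y has no transpose over Y. This is the obstacle that the detour over
  relatively projective objects removes. The relative notion is forced, because a projective object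
  of C need not lie in S; its longest quotient in S takes its place, and finite length makes that
  quotient exist.

  Apart from closure under duals, duality enters through one fact: if V is a dual of X, on either
  side, then Hom (X (x) B) A and Hom B (V (x) A) are in natural bijection. Evaluation and
  coevaluation give this on one side, the braiding on the other. Exactness of the tensor product,
  the splitting of relatively projective subobjects and, through Yoneda, the passage of duals to
  subobjects and quotients are read off from these bijections, so the dual of an arrow is never
  constructed.

  The braiding also regroups (X (x) Y) (x) (X' (x) Y') as (X (x) X') (x) (Y (x) Y'), which makes the
  subquotients closed under products.\<close>

context category
begin

text \<open>By \<open>Hom_disjoint\<close> an arrow determines its source and target, so the typing
  premises of the locale axioms can be replaced by equations about \<open>src\<close> and
  \<open>tgt\<close> that the simplifier decides. Hom-sets are constrained only between members of
  \<open>Obj C\<close>, hence the bounds in all three definitions.\<close>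

definition arr where "arr f \<longleftrightarrow> (\<exists>X\<in>Obj C. \<exists>Y\<in>Obj C. f \<in> Hom C X Y)"
definition src where "src f = (THE X. X \<in> Obj C \<and> (\<exists>Y\<in>Obj C. f \<in> Hom C X Y))"
definition tgt where "tgt f = (THE Y. Y \<in> Obj C \<and> (\<exists>X\<in>Obj C. f \<in> Hom C X Y))"

lemma src_eq: "\<lbrakk>X \<in> Obj C; Y \<in> Obj C; f \<in> Hom C X Y\<rbrakk> \<Longrightarrow> src f = X"
  unfolding src_def by (rule the_equality) (use Hom_disjoint in blast)+

lemma tgt_eq: "\<lbrakk>X \<in> Obj C; Y \<in> Obj C; f \<in> Hom C X Y\<rbrakk> \<Longrightarrow> tgt f = Y"
  unfolding tgt_def by (rule the_equality) (use Hom_disjoint in blast)+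

lemma Hom_iff [simp]:
  "\<lbrakk>X \<in> Obj C; Y \<in> Obj C\<rbrakk> \<Longrightarrow> f \<in> Hom C X Y \<longleftrightarrow> arr f \<and> src f = X \<and> tgt f = Y"
  using src_eq tgt_eq unfolding arr_def by blast

lemma arrE: "arr f \<Longrightarrow> src f \<in> Obj C \<and> tgt f \<in> Obj C \<and> f \<in> Hom C (src f) (tgt f)"
  using src_eq tgt_eq unfolding arr_def by metis

lemma src_Obj [simp]: "arr f \<Longrightarrow> src f \<in> Obj C"
  and tgt_Obj [simp]: "arr f \<Longrightarrow> tgt f \<in> Obj C"
  using arrE by blast+

lemma arr_ident [simp]:
  assumes "X \<in> Obj C"
  shows "arr (ident C X)" "src (ident C X) = X" "tgt (ident C X) = X"
  using ident_closed[OF assms] assms by auto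

lemma arr_cmp [simp]:
  assumes "arr g" "arr f" "src g = tgt f"
  shows "arr (g \<cdot> f)" "src (g \<cdot> f) = src f" "tgt (g \<cdot> f) = tgt g"
  using cmp_closed[of "src f" "tgt f" "tgt g" f g] arrE[OF assms(1)] arrE[OF assms(2)] assms
  by auto

lemma cmp_ident [simp]:
  shows "\<lbrakk>arr f; src f = X\<rbrakk> \<Longrightarrow> f \<cdot> ident C X = f"
    and "\<lbrakk>arr f; tgt f = X\<rbrakk> \<Longrightarrow> ident C X \<cdot> f = f"
  using cmp_ident_right cmp_ident_left arrE by blast+

lemma assoc [simp]:
  "\<lbrakk>arr h; arr g; arr f; src h = tgt g; src g = tgt f\<rbrakk> \<Longrightarrow> (h \<cdot> g) \<cdot> f = h \<cdot> (g \<cdot> f)"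
  using cmp_assoc[of "src f" "tgt f" "tgt g" "tgt h" f g h] by simp

text \<open>Composites are normalized to the right by \<open>assoc\<close>, which hides the factor
  \<open>h \<cdot> g\<close> inside a longer composite; this form applies an equation there.\<close>

lemma cmp_reassoc:
  "\<lbrakk>h \<cdot> g = k; arr h; arr g; arr f; src h = tgt g; src g = tgt f\<rbrakk> \<Longrightarrow> h \<cdot> (g \<cdot> f) = k \<cdot> f"
  by (metis assoc)

section \<open>Monomorphisms, epimorphisms and isomorphisms\<close>

definition mono where
  "mono f \<longleftrightarrow> arr f \<and> (\<forall>g h. arr g \<longrightarrow> arr h \<longrightarrow> src g = src h \<longrightarrow> tgt g = src f \<longrightarrow> tgt h = src f
     \<longrightarrow> f \<cdot> g = f \<cdot> h \<longrightarrow> g = h)"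

definition epi where
  "epi f \<longleftrightarrow> arr f \<and> (\<forall>g h. arr g \<longrightarrow> arr h \<longrightarrow> tgt g = tgt h \<longrightarrow> src g = tgt f \<longrightarrow> src h = tgt f
     \<longrightarrow> g \<cdot> f = h \<cdot> f \<longrightarrow> g = h)"

definition iso where
  "iso f \<longleftrightarrow> arr f \<and> (\<exists>g. arr g \<and> src g = tgt f \<and> tgt g = src f
     \<and> g \<cdot> f = ident C (src f) \<and> f \<cdot> g = ident C (tgt f))"

definition inv_arr where
  "inv_arr f = (SOME g. arr g \<and> src g = tgt f \<and> tgt g = src f
     \<and> g \<cdot> f = ident C (src f) \<and> f \<cdot> g = ident C (tgt f))"

lemma is_mono_iff:
  assumes "X \<in> Obj C" "Y \<in> Obj C"
  shows "is_mono C X Y f \<longleftrightarrow> mono f \<and> src f = X \<and> tgt f = Y"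
proof
  assume L: "is_mono C X Y f"
  have f: "arr f" "src f = X" "tgt f = Y"
    using L assms by (simp_all add: is_mono_def)
  have "g = h" if "arr g" "arr h" "src g = src h" "tgt g = X" "tgt h = X" "f \<cdot> g = f \<cdot> h" for g h
  proof -
    have "\<forall>g\<in>Hom C (src h) X. \<forall>h'\<in>Hom C (src h) X. f \<cdot> g = f \<cdot> h' \<longrightarrow> g = h'"
      using L that(2) src_Obj unfolding is_mono_def by blast
    moreover have "g \<in> Hom C (src h) X" "h \<in> Hom C (src h) X"
      using that assms by simp_all
    ultimately show ?thesis
      using that(6) by blast
  qed
  then show "mono f \<and> src f = X \<and> tgt f = Y"
    unfolding mono_def f(2) using f by blast
next
  assume "mono f \<and> src f = X \<and> tgt f = Y"
  then show "is_mono C X Y f"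
    unfolding is_mono_def mono_def using assms by simp
qed

lemma is_epi_iff:
  assumes "X \<in> Obj C" "Y \<in> Obj C"
  shows "is_epi C X Y f \<longleftrightarrow> epi f \<and> src f = X \<and> tgt f = Y"
proof
  assume L: "is_epi C X Y f"
  have f: "arr f" "src f = X" "tgt f = Y"
    using L assms by (simp_all add: is_epi_def)
  have "g = h" if "arr g" "arr h" "tgt g = tgt h" "src g = Y" "src h = Y" "g \<cdot> f = h \<cdot> f" for g h
  proof -
    have "\<forall>g\<in>Hom C Y (tgt h). \<forall>h'\<in>Hom C Y (tgt h). g \<cdot> f = h' \<cdot> f \<longrightarrow> g = h'"
      using L that(2) tgt_Obj unfolding is_epi_def by blast
    moreover have "g \<in> Hom C Y (tgt h)" "h \<in> Hom C Y (tgt h)"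
      using that assms by simp_all
    ultimately show ?thesis
      using that(6) by blast
  qed
  then show "epi f \<and> src f = X \<and> tgt f = Y"
    unfolding epi_def f(3) using f by blast
next
  assume "epi f \<and> src f = X \<and> tgt f = Y"
  then show "is_epi C X Y f"
    unfolding is_epi_def epi_def using assms by simp
qed

lemma is_iso_iff:
  "\<lbrakk>X \<in> Obj C; Y \<in> Obj C\<rbrakk> \<Longrightarrow> is_iso C X Y f \<longleftrightarrow> iso f \<and> src f = X \<and> tgt f = Y"
  unfolding is_iso_def inverse_arrows_def iso_def by (simp, safe) (rule exI, intro conjI, assumption+)+

lemma mono_arr: "mono f \<Longrightarrow> arr f"
  and epi_arr: "epi f \<Longrightarrow> arr f"
  and iso_arr: "iso f \<Longrightarrow> arr f"
  unfolding mono_def epi_def iso_def by blast+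

lemma mono_cancel:
  "\<lbrakk>mono f; f \<cdot> g = f \<cdot> h; arr g; arr h; src g = src h; tgt g = src f; tgt h = src f\<rbrakk> \<Longrightarrow> g = h"
  unfolding mono_def by metis

lemma epi_cancel:
  "\<lbrakk>epi f; g \<cdot> f = h \<cdot> f; arr g; arr h; tgt g = tgt h; src g = tgt f; src h = tgt f\<rbrakk> \<Longrightarrow> g = h"
  unfolding epi_def by metis

lemma inv_arr [simp]:
  assumes "iso f"
  shows "arr (inv_arr f)" "src (inv_arr f) = tgt f" "tgt (inv_arr f) = src f"
    "inv_arr f \<cdot> f = ident C (src f)" "f \<cdot> inv_arr f = ident C (tgt f)"
proof -
  have "\<exists>g. arr g \<and> src g = tgt f \<and> tgt g = src f
     \<and> g \<cdot> f = ident C (src f) \<and> f \<cdot> g = ident C (tgt f)"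
    using assms unfolding iso_def by blast
  note someI_ex[OF this, folded inv_arr_def]
  then show "arr (inv_arr f)" "src (inv_arr f) = tgt f" "tgt (inv_arr f) = src f"
    "inv_arr f \<cdot> f = ident C (src f)" "f \<cdot> inv_arr f = ident C (tgt f)"
    by blast+
qed

lemma inv_arr_cancel [simp]:
  assumes "iso f" "arr g"
  shows "tgt g = src f \<Longrightarrow> inv_arr f \<cdot> (f \<cdot> g) = g"
    and "tgt g = tgt f \<Longrightarrow> f \<cdot> (inv_arr f \<cdot> g) = g"
proof -
  note f = inv_arr[OF assms(1)] iso_arr[OF assms(1)]
  show "inv_arr f \<cdot> (f \<cdot> g) = g" if "tgt g = src f"
    using cmp_reassoc[OF f(4), of g] f assms(2) that by simp
  show "f \<cdot> (inv_arr f \<cdot> g) = g" if "tgt g = tgt f"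
    using cmp_reassoc[OF f(5), of g] f assms(2) that by simp
qed

lemma monoI_left_inverse:
  assumes "arr f" "arr g" "src g = tgt f" "g \<cdot> f = ident C (src f)"
  shows "mono f" "epi g"
proof -
  \<comment> \<open>The target of \<open>g\<close> is not assumed; it is read off from
    \<open>g \<cdot> f\<close> being an identity.\<close>
  have [simp]: "tgt g = src f"
    using assms by (metis arr_cmp(3) arr_ident(3) src_Obj)
  have a: "h = k" if "arr h" "arr k" "src h = src k" "tgt h = src f" "tgt k = src f"
      "f \<cdot> h = f \<cdot> k" for h k
    using that assms by (metis assoc cmp_ident(2))
  have b: "h = k" if "arr h" "arr k" "tgt h = tgt k" "src h = tgt g" "src k = tgt g"
      "h \<cdot> g = k \<cdot> g" for h k
  proof -
    have "h \<cdot> (g \<cdot> f) = k \<cdot> (g \<cdot> f)"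
      using that assms by (metis assoc)
    then show ?thesis
      using that assms by simp
  qed
  show "mono f" "epi g"
    unfolding mono_def epi_def using assms a b by blast+
qed

lemma iso_mono: "iso f \<Longrightarrow> mono f"
  and iso_epi: "iso f \<Longrightarrow> epi f"
  by (rule monoI_left_inverse(1)[of f "inv_arr f"]; simp add: iso_arr)
     (rule monoI_left_inverse(2)[of "inv_arr f" f]; simp add: iso_arr)

lemma isoI:
  "\<lbrakk>arr f; arr g; src g = tgt f; tgt g = src f; g \<cdot> f = ident C (src f); f \<cdot> g = ident C (tgt f)\<rbrakk>
    \<Longrightarrow> iso f"
  unfolding iso_def by (intro conjI exI[of _ g])

lemma iso_ident [simp]: "X \<in> Obj C \<Longrightarrow> iso (ident C X)"
  by (rule isoI[of _ "ident C X"]) simp_all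

lemma iso_inv_arr [simp]: "iso f \<Longrightarrow> iso (inv_arr f)"
  by (rule isoI[of _ f]) (simp_all add: iso_arr)

lemma iso_cmp [simp]: "\<lbrakk>iso g; iso f; src g = tgt f\<rbrakk> \<Longrightarrow> iso (g \<cdot> f)"
  by (rule isoI[of _ "inv_arr f \<cdot> inv_arr g"]) (simp_all add: iso_arr)

lemma mono_cmp:
  assumes "mono g" "mono f" "src g = tgt f"
  shows "mono (g \<cdot> f)"
  unfolding mono_def
proof (intro conjI allI impI)
  show "arr (g \<cdot> f)"
    using assms by (simp add: mono_arr epi_arr)
  fix h k
  assume hk: "arr h" "arr k" "src h = src k" "tgt h = src (g \<cdot> f)" "tgt k = src (g \<cdot> f)"
    "(g \<cdot> f) \<cdot> h = (g \<cdot> f) \<cdot> k"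
  then have "f \<cdot> h = f \<cdot> k"
    using assms(3) mono_arr[OF assms(1)] mono_arr[OF assms(2)]
    by - (rule mono_cancel[OF assms(1)], simp_all)
  then show "h = k"
    using assms(3) mono_arr[OF assms(1)] mono_arr[OF assms(2)] hk
    by - (rule mono_cancel[OF assms(2)], simp_all)
qed

lemma epi_cmp:
  assumes "epi g" "epi f" "src g = tgt f"
  shows "epi (g \<cdot> f)"
  unfolding epi_def
proof (intro conjI allI impI)
  show "arr (g \<cdot> f)"
    using assms by (simp add: mono_arr epi_arr)
  fix h k
  assume hk: "arr h" "arr k" "tgt h = tgt k" "src h = tgt (g \<cdot> f)" "src k = tgt (g \<cdot> f)"
    "h \<cdot> (g \<cdot> f) = k \<cdot> (g \<cdot> f)"
  have "h \<cdot> g = k \<cdot> g"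
    using assms(3) epi_arr[OF assms(1)] epi_arr[OF assms(2)] hk
    by - (rule epi_cancel[OF assms(2)], simp_all)
  then show "h = k"
    using assms(3) epi_arr[OF assms(1)] epi_arr[OF assms(2)] hk
    by - (rule epi_cancel[OF assms(1)], simp_all)
qed

lemma epi_of_epi_cmp:
  assumes "epi (g \<cdot> f)" "arr g" "arr f" "src g = tgt f"
  shows "epi g"
  unfolding epi_def
proof (intro conjI allI impI)
  fix h k
  assume hk: "arr h" "arr k" "tgt h = tgt k" "src h = tgt g" "src k = tgt g" "h \<cdot> g = k \<cdot> g"
  have "h \<cdot> (g \<cdot> f) = k \<cdot> (g \<cdot> f)"
    using assms(2-) hk by (simp del: assoc add: assoc[symmetric])
  then show "h = k"
    using assms(2-) hk by - (rule epi_cancel[OF assms(1)], simp_all)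
qed (use assms in simp)

text \<open>Since \<open>f\<close> is an epimorphism, a left inverse is already the inverse.
  Inverses of composites of associators are found this way.\<close>

lemma inv_arr_eq:
  "\<lbrakk>iso f; arr g; src g = tgt f; tgt g = src f; g \<cdot> f = ident C (src f)\<rbrakk> \<Longrightarrow> inv_arr f = g"
  by (rule epi_cancel[of f]) (simp_all add: iso_epi iso_arr)

lemma arrow_inverse_eq:
  assumes "iso f" "src f = X" "tgt f = Y"
  shows "arrow_inverse C X Y f = inv_arr f"
  unfolding arrow_inverse_def inverse_arrows_def
proof (rule the_equality)
  have [simp]: "X \<in> Obj C" "Y \<in> Obj C"
    using assms iso_arr[OF assms(1)] by auto
  show "f \<in> Hom C X Y \<and> inv_arr f \<in> Hom C Y X
    \<and> inv_arr f \<cdot> f = ident C X \<and> f \<cdot> inv_arr f = ident C Y"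
    using assms iso_arr[OF assms(1)] by simp
  show "g = inv_arr f"
    if "f \<in> Hom C X Y \<and> g \<in> Hom C Y X \<and> g \<cdot> f = ident C X \<and> f \<cdot> g = ident C Y" for g
    using inv_arr_eq[of f g] assms that by simp
qed

definition iso_obj where
  "iso_obj X Y \<longleftrightarrow> (\<exists>f. iso f \<and> src f = X \<and> tgt f = Y)"

lemma iso_obj_refl: "X \<in> Obj C \<Longrightarrow> iso_obj X X"
  unfolding iso_obj_def using arr_ident iso_ident by blast

lemma iso_obj_sym: "iso_obj X Y \<Longrightarrow> iso_obj Y X"
  unfolding iso_obj_def using iso_inv_arr inv_arr(2,3) by blast

lemma iso_obj_trans [trans]: "\<lbrakk>iso_obj X Y; iso_obj Y Z\<rbrakk> \<Longrightarrow> iso_obj X Z"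
  unfolding iso_obj_def by (metis iso_cmp arr_cmp(2,3) iso_arr)

text \<open>Yoneda: the family \<open>\<theta>\<close> is composition with the image of an identity.\<close>

lemma epi_of_natural_injection:
  assumes "Z \<in> Obj C" "U \<in> Obj C"
    and arrow: "\<And>f. \<lbrakk>arr f; src f = Z\<rbrakk> \<Longrightarrow> arr (\<theta> f) \<and> src (\<theta> f) = U \<and> tgt (\<theta> f) = tgt f"
    and nat: "\<And>f a. \<lbrakk>arr f; src f = Z; arr a; src a = tgt f\<rbrakk> \<Longrightarrow> \<theta> (a \<cdot> f) = a \<cdot> \<theta> f"
    and inj: "\<And>f g. \<lbrakk>arr f; arr g; src f = Z; src g = Z; tgt f = tgt g; \<theta> f = \<theta> g\<rbrakk> \<Longrightarrow> f = g"
  shows "\<exists>u. epi u \<and> src u = U \<and> tgt u = Z"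
proof -
  let ?u = "\<theta> (ident C Z)"
  have [simp]: "arr ?u" "src ?u = U" "tgt ?u = Z"
    using arrow[of "ident C Z"] assms(1) by auto
  have eq: "a \<cdot> ?u = \<theta> a" if "arr a" "src a = Z" for a
    using nat[of "ident C Z" a] that assms(1) by simp
  have "epi ?u"
    unfolding epi_def using eq inj by auto
  then show ?thesis
    by auto
qed

lemma mono_of_natural_injection:
  assumes "Z \<in> Obj C" "U \<in> Obj C"
    and arrow: "\<And>f. \<lbrakk>arr f; tgt f = Z\<rbrakk> \<Longrightarrow> arr (\<theta> f) \<and> src (\<theta> f) = src f \<and> tgt (\<theta> f) = U"
    and nat: "\<And>f b. \<lbrakk>arr f; tgt f = Z; arr b; tgt b = src f\<rbrakk> \<Longrightarrow> \<theta> (f \<cdot> b) = \<theta> f \<cdot> b"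
    and inj: "\<And>f g. \<lbrakk>arr f; arr g; tgt f = Z; tgt g = Z; src f = src g; \<theta> f = \<theta> g\<rbrakk> \<Longrightarrow> f = g"
  shows "\<exists>u. mono u \<and> src u = Z \<and> tgt u = U"
proof -
  let ?u = "\<theta> (ident C Z)"
  have [simp]: "arr ?u" "src ?u = Z" "tgt ?u = U"
    using arrow[of "ident C Z"] assms(1) by auto
  have eq: "?u \<cdot> a = \<theta> a" if "arr a" "tgt a = Z" for a
    using nat[of "ident C Z" a] that assms(1) by simp
  have "mono ?u"
    unfolding mono_def using eq inj by auto
  then show ?thesis
    by auto
qed

end

section \<open>Duals and adjoint tensor functors\<close>

context monoidal_category
begin

section \<open>Monoidal structure: interchange, naturality and coherence\<close>

lemmas tensor_obj [simp] = tensor_obj_closed unit_obj_closed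

lemma arr_tensor [simp]:
  assumes "arr f" "arr g"
  shows "arr (f \<otimes>\<^sub>a g)" "src (f \<otimes>\<^sub>a g) = src f \<otimes>\<^sub>o src g" "tgt (f \<otimes>\<^sub>a g) = tgt f \<otimes>\<^sub>o tgt g"
  using tensor_arr_closed[of "src f" "tgt f" "src g" "tgt g" f g] arrE[OF assms(1)] arrE[OF assms(2)]
  by auto

lemma tensor_ident' [simp]:
  "\<lbrakk>X \<in> Obj C; Y \<in> Obj C\<rbrakk> \<Longrightarrow> ident C X \<otimes>\<^sub>a ident C Y = ident C (X \<otimes>\<^sub>o Y)"
  by (rule tensor_ident)

lemma interchange:
  "\<lbrakk>arr f; arr f'; arr g; arr g'; src f' = tgt f; src g' = tgt g\<rbrakk>
    \<Longrightarrow> (f' \<otimes>\<^sub>a g') \<cdot> (f \<otimes>\<^sub>a g) = (f' \<cdot> f) \<otimes>\<^sub>a (g' \<cdot> g)"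
  by (rule tensor_cmp[symmetric, of "src f" "tgt f" "tgt f'" "src g" "tgt g" "tgt g'"]) simp_all

lemma interchange_reassoc:
  "\<lbrakk>arr f; arr f'; arr g; arr g'; src f' = tgt f; src g' = tgt g; arr h; tgt h = src f \<otimes>\<^sub>o src g\<rbrakk>
    \<Longrightarrow> (f' \<otimes>\<^sub>a g') \<cdot> ((f \<otimes>\<^sub>a g) \<cdot> h) = ((f' \<cdot> f) \<otimes>\<^sub>a (g' \<cdot> g)) \<cdot> h"
  by (rule cmp_reassoc[OF interchange]) simp_all

lemma iso_tensor [simp]: "\<lbrakk>iso f; iso g\<rbrakk> \<Longrightarrow> iso (f \<otimes>\<^sub>a g)"
  by (rule isoI[of _ "inv_arr f \<otimes>\<^sub>a inv_arr g"]) (simp_all add: iso_arr interchange)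

lemma iso_obj_tensor: "\<lbrakk>iso_obj X X'; iso_obj Y Y'\<rbrakk> \<Longrightarrow> iso_obj (X \<otimes>\<^sub>o Y) (X' \<otimes>\<^sub>o Y')"
  unfolding iso_obj_def by (metis iso_tensor arr_tensor(2,3) iso_arr)

abbreviation unit_object ("\<one>\<^sub>o") where "\<one>\<^sub>o \<equiv> unit_obj C"

lemma associator_arr [simp]:
  assumes "X \<in> Obj C" "Y \<in> Obj C" "Z \<in> Obj C"
  shows "iso (associator C X Y Z)" "arr (associator C X Y Z)"
    "src (associator C X Y Z) = (X \<otimes>\<^sub>o Y) \<otimes>\<^sub>o Z" "tgt (associator C X Y Z) = X \<otimes>\<^sub>o (Y \<otimes>\<^sub>o Z)"
  using associator_iso[OF assms] assms by (simp_all add: is_iso_iff iso_arr)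

lemma unitor_arr [simp]:
  assumes "X \<in> Obj C"
  shows "iso (left_unitor C X)" "arr (left_unitor C X)"
    "src (left_unitor C X) = \<one>\<^sub>o \<otimes>\<^sub>o X" "tgt (left_unitor C X) = X"
    "iso (right_unitor C X)" "arr (right_unitor C X)"
    "src (right_unitor C X) = X \<otimes>\<^sub>o \<one>\<^sub>o" "tgt (right_unitor C X) = X"
  using left_unitor_iso[OF assms] right_unitor_iso[OF assms] assms
  by (simp_all add: is_iso_iff iso_arr)

lemma associator_nat:
  "\<lbrakk>arr f; arr g; arr h\<rbrakk> \<Longrightarrow>
    associator C (tgt f) (tgt g) (tgt h) \<cdot> ((f \<otimes>\<^sub>a g) \<otimes>\<^sub>a h)
      = (f \<otimes>\<^sub>a (g \<otimes>\<^sub>a h)) \<cdot> associator C (src f) (src g) (src h)"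
  by (rule associator_natural) simp_all

lemma left_unitor_nat:
  "arr f \<Longrightarrow> left_unitor C (tgt f) \<cdot> (ident C \<one>\<^sub>o \<otimes>\<^sub>a f) = f \<cdot> left_unitor C (src f)"
  by (rule left_unitor_natural) simp_all

text \<open>Reads a commutative square along the inverses of two opposite sides. It serves both for
  the naturality of inverse constraints and for turning the pentagon around.\<close>

lemma iso_conjugate:
  assumes "iso a" "iso b" "arr f" "arr g" "src f = src a" "tgt f = src b" "src g = tgt a"
    "tgt g = tgt b" "b \<cdot> f = g \<cdot> a"
  shows "f \<cdot> inv_arr a = inv_arr b \<cdot> g"
proof -
  note [simp] = assms(1-8) iso_arr
  have "inv_arr b \<cdot> g = inv_arr b \<cdot> ((g \<cdot> a) \<cdot> inv_arr a)"
    by simp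
  also have "\<dots> = f \<cdot> inv_arr a"
    unfolding assms(9)[symmetric] by simp
  finally show ?thesis
    by simp
qed

lemma inv_associator_nat:
  "\<lbrakk>arr f; arr g; arr h\<rbrakk> \<Longrightarrow>
    inv_arr (associator C (tgt f) (tgt g) (tgt h)) \<cdot> (f \<otimes>\<^sub>a (g \<otimes>\<^sub>a h))
      = ((f \<otimes>\<^sub>a g) \<otimes>\<^sub>a h) \<cdot> inv_arr (associator C (src f) (src g) (src h))"
  by (rule iso_conjugate[symmetric]) (simp_all add: associator_nat)

lemma inv_left_unitor_nat:
  "arr f \<Longrightarrow> inv_arr (left_unitor C (tgt f)) \<cdot> f
     = (ident C \<one>\<^sub>o \<otimes>\<^sub>a f) \<cdot> inv_arr (left_unitor C (src f))"
  by (rule iso_conjugate[symmetric]) (simp_all add: left_unitor_nat)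

lemma unit_tensor_faithful:
  assumes "arr f" "arr g" "src f = src g" "tgt f = tgt g"
    and eq: "ident C \<one>\<^sub>o \<otimes>\<^sub>a f = ident C \<one>\<^sub>o \<otimes>\<^sub>a g"
  shows "f = g"
proof -
  have "f \<cdot> left_unitor C (src f) = g \<cdot> left_unitor C (src f)"
    using left_unitor_nat[of f] left_unitor_nat[of g] assms by simp
  then show ?thesis
    by (rule epi_cancel[rotated]) (simp_all add: assms iso_epi)
qed

text \<open>Kelly's lemma: as tensoring with the unit is faithful, the pentagon can be used for
  \<open>1, 1, X, Y\<close>.\<close>

lemma left_unitor_tensor:
  assumes [simp]: "X \<in> Obj C" "Y \<in> Obj C"
  shows "left_unitor C (X \<otimes>\<^sub>o Y) \<cdot> associator C \<one>\<^sub>o X Y = left_unitor C X \<otimes>\<^sub>a ident C Y"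
proof (rule unit_tensor_faithful)
  let ?I = "ident C \<one>\<^sub>o" and ?a = "associator C"
  \<comment> \<open>What remains of the longer side of the pentagon once
    \<open>?I \<otimes>\<^sub>a ?a \<one>\<^sub>o X Y\<close> is split off. The two arrows are
    compared after composition with it; being invertible, it is cancelled at the end.\<close>
  let ?e = "?a \<one>\<^sub>o (\<one>\<^sub>o \<otimes>\<^sub>o X) Y \<cdot> (?a \<one>\<^sub>o \<one>\<^sub>o X \<otimes>\<^sub>a ident C Y)"
  have "(?I \<otimes>\<^sub>a (left_unitor C (X \<otimes>\<^sub>o Y) \<cdot> ?a \<one>\<^sub>o X Y)) \<cdot> ?e
    = (?I \<otimes>\<^sub>a left_unitor C (X \<otimes>\<^sub>o Y)) \<cdot> ((?I \<otimes>\<^sub>a ?a \<one>\<^sub>o X Y) \<cdot> ?e)"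
    by (subst interchange_reassoc) simp_all
  also have "(?I \<otimes>\<^sub>a ?a \<one>\<^sub>o X Y) \<cdot> ?e = ?a \<one>\<^sub>o \<one>\<^sub>o (X \<otimes>\<^sub>o Y) \<cdot> ?a (\<one>\<^sub>o \<otimes>\<^sub>o \<one>\<^sub>o) X Y"
    using pentagon[of "\<one>\<^sub>o" "\<one>\<^sub>o" X Y] by simp
  also have "(?I \<otimes>\<^sub>a left_unitor C (X \<otimes>\<^sub>o Y)) \<cdot> (?a \<one>\<^sub>o \<one>\<^sub>o (X \<otimes>\<^sub>o Y) \<cdot> ?a (\<one>\<^sub>o \<otimes>\<^sub>o \<one>\<^sub>o) X Y)
    = (right_unitor C \<one>\<^sub>o \<otimes>\<^sub>a (ident C X \<otimes>\<^sub>a ident C Y)) \<cdot> ?a (\<one>\<^sub>o \<otimes>\<^sub>o \<one>\<^sub>o) X Y"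
    using cmp_reassoc[OF triangle[of "\<one>\<^sub>o" "X \<otimes>\<^sub>o Y"], of "?a (\<one>\<^sub>o \<otimes>\<^sub>o \<one>\<^sub>o) X Y"] by simp
  also have "\<dots> = ?a \<one>\<^sub>o X Y \<cdot> ((right_unitor C \<one>\<^sub>o \<otimes>\<^sub>a ident C X) \<otimes>\<^sub>a ident C Y)"
    using associator_nat[of "right_unitor C \<one>\<^sub>o" "ident C X" "ident C Y"] by simp
  also have "(right_unitor C \<one>\<^sub>o \<otimes>\<^sub>a ident C X) \<otimes>\<^sub>a ident C Y
    = ((?I \<otimes>\<^sub>a left_unitor C X) \<otimes>\<^sub>a ident C Y) \<cdot> (?a \<one>\<^sub>o \<one>\<^sub>o X \<otimes>\<^sub>a ident C Y)"
    by (subst interchange) (simp_all add: triangle)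
  also have "?a \<one>\<^sub>o X Y \<cdot> \<dots> = (?I \<otimes>\<^sub>a (left_unitor C X \<otimes>\<^sub>a ident C Y)) \<cdot> ?e"
    using cmp_reassoc[OF associator_nat[of ?I "left_unitor C X" "ident C Y"],
        of "?a \<one>\<^sub>o \<one>\<^sub>o X \<otimes>\<^sub>a ident C Y"] by simp
  finally show "?I \<otimes>\<^sub>a (left_unitor C (X \<otimes>\<^sub>o Y) \<cdot> ?a \<one>\<^sub>o X Y)
    = ?I \<otimes>\<^sub>a (left_unitor C X \<otimes>\<^sub>a ident C Y)"
    by (rule epi_cancel[rotated]) (simp_all add: iso_epi)
qed simp_all

text \<open>\<open>adjunction X V \<phi>\<close>: the bijections \<open>\<phi> B : Hom (X \<otimes> B) A \<rightarrow> Hom B (V \<otimes> A)\<close> are natural, so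
  that \<open>X \<otimes> _\<close> is left adjoint to \<open>V \<otimes> _\<close>.\<close>

definition adjunction where
  "adjunction X V \<phi> \<longleftrightarrow> X \<in> Obj C \<and> V \<in> Obj C \<and>
    (\<forall>B\<in>Obj C. \<forall>f. arr f \<longrightarrow> src f = X \<otimes>\<^sub>o B \<longrightarrow>
       arr (\<phi> B f) \<and> src (\<phi> B f) = B \<and> tgt (\<phi> B f) = V \<otimes>\<^sub>o tgt f) \<and>
    (\<forall>B\<in>Obj C. \<forall>f g. arr f \<longrightarrow> arr g \<longrightarrow> src f = X \<otimes>\<^sub>o B \<longrightarrow> src g = X \<otimes>\<^sub>o B \<longrightarrow>
       tgt f = tgt g \<longrightarrow> \<phi> B f = \<phi> B g \<longrightarrow> f = g) \<and>
    (\<forall>A\<in>Obj C. \<forall>h. arr h \<longrightarrow> tgt h = V \<otimes>\<^sub>o A \<longrightarrow>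
       (\<exists>f. arr f \<and> src f = X \<otimes>\<^sub>o src h \<and> tgt f = A \<and> \<phi> (src h) f = h)) \<and>
    (\<forall>B\<in>Obj C. \<forall>f a. arr f \<longrightarrow> arr a \<longrightarrow> src f = X \<otimes>\<^sub>o B \<longrightarrow> src a = tgt f \<longrightarrow>
       \<phi> B (a \<cdot> f) = (ident C V \<otimes>\<^sub>a a) \<cdot> \<phi> B f) \<and>
    (\<forall>f b. arr f \<longrightarrow> arr b \<longrightarrow> src f = X \<otimes>\<^sub>o tgt b \<longrightarrow>
       \<phi> (src b) (f \<cdot> (ident C X \<otimes>\<^sub>a b)) = \<phi> (tgt b) f \<cdot> b)"

lemma adjunctionD:
  assumes "adjunction X V \<phi>"
  shows "X \<in> Obj C" "V \<in> Obj C"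
    and "\<lbrakk>arr f; src f = X \<otimes>\<^sub>o B; B \<in> Obj C\<rbrakk>
      \<Longrightarrow> arr (\<phi> B f) \<and> src (\<phi> B f) = B \<and> tgt (\<phi> B f) = V \<otimes>\<^sub>o tgt f"
    and "\<lbrakk>\<phi> B f = \<phi> B g; arr f; arr g; src f = X \<otimes>\<^sub>o B; src g = X \<otimes>\<^sub>o B; tgt f = tgt g; B \<in> Obj C\<rbrakk>
      \<Longrightarrow> f = g"
    and "\<lbrakk>arr h; tgt h = V \<otimes>\<^sub>o A; A \<in> Obj C\<rbrakk>
      \<Longrightarrow> \<exists>f. arr f \<and> src f = X \<otimes>\<^sub>o src h \<and> tgt f = A \<and> \<phi> (src h) f = h"
    and "\<lbrakk>arr f; arr a; src f = X \<otimes>\<^sub>o B; src a = tgt f; B \<in> Obj C\<rbrakk>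
      \<Longrightarrow> \<phi> B (a \<cdot> f) = (ident C V \<otimes>\<^sub>a a) \<cdot> \<phi> B f"
    and "\<lbrakk>arr f; arr b; src f = X \<otimes>\<^sub>o tgt b\<rbrakk>
      \<Longrightarrow> \<phi> (src b) (f \<cdot> (ident C X \<otimes>\<^sub>a b)) = \<phi> (tgt b) f \<cdot> b"
  using assms unfolding adjunction_def by metis+

end

text \<open>The data of \<open>is_left_dual C X V\<close>, with the zigzag identities in
  right-nested normal form and \<open>inv_arr\<close> for the inverse of the associator.\<close>

locale dual_pair = monoidal_category +
  fixes X V ev coev
  assumes X [simp]: "X \<in> Obj C" and V [simp]: "V \<in> Obj C"
    and ev [simp]: "arr ev" "src ev = V \<otimes>\<^sub>o X" "tgt ev = unit_obj C"
    and coev [simp]: "arr coev" "src coev = unit_obj C" "tgt coev = X \<otimes>\<^sub>o V"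
    and zigzag_X: "right_unitor C X \<cdot> ((ident C X \<otimes>\<^sub>a ev) \<cdot> (associator C X V X
      \<cdot> (coev \<otimes>\<^sub>a ident C X))) = left_unitor C X"
    and zigzag_V: "left_unitor C V \<cdot> ((ev \<otimes>\<^sub>a ident C V) \<cdot> (inv_arr (associator C V X V)
      \<cdot> (ident C V \<otimes>\<^sub>a coev))) = right_unitor C V"
begin

text \<open>Transposition along the unit \<open>B \<rightarrow> X \<otimes> (V \<otimes> B)\<close>,
  the coevaluation tensored with \<open>B\<close>. In the same way \<open>untranspose\<close> uses
  the counit \<open>V \<otimes> (X \<otimes> A) \<rightarrow> A\<close>, which comes from the
  evaluation.\<close>

definition transpose where
  "transpose B f = (ident C X \<otimes>\<^sub>a f) \<cdot> (associator C X V B \<cdot> ((coev \<otimes>\<^sub>a ident C B)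
     \<cdot> inv_arr (left_unitor C B)))"

definition untranspose where
  "untranspose A g = left_unitor C A \<cdot> ((ev \<otimes>\<^sub>a ident C A) \<cdot> (inv_arr (associator C V X A)
     \<cdot> (ident C V \<otimes>\<^sub>a g)))"

lemma transpose_arr [simp]:
  assumes "arr f" "src f = V \<otimes>\<^sub>o B" "B \<in> Obj C"
  shows "arr (transpose B f)" "src (transpose B f) = B" "tgt (transpose B f) = X \<otimes>\<^sub>o tgt f"
  using assms by (simp_all add: transpose_def)

lemma untranspose_arr [simp]:
  assumes "arr g" "tgt g = X \<otimes>\<^sub>o A" "A \<in> Obj C"
  shows "arr (untranspose A g)" "src (untranspose A g) = V \<otimes>\<^sub>o src g" "tgt (untranspose A g) = A"
  using assms by (simp_all add: untranspose_def)

lemma transpose_cmp: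
  assumes [simp]: "arr f" "src f = V \<otimes>\<^sub>o B" "B \<in> Obj C" "arr a" "src a = tgt f"
  shows "transpose B (a \<cdot> f) = (ident C X \<otimes>\<^sub>a a) \<cdot> transpose B f"
  unfolding transpose_def by (subst interchange_reassoc) simp_all

lemma transpose_cmp_tensor:
  assumes [simp]: "arr f" "arr b" "src f = V \<otimes>\<^sub>o tgt b"
  shows "transpose (src b) (f \<cdot> (ident C V \<otimes>\<^sub>a b)) = transpose (tgt b) f \<cdot> b"
proof -
  have "transpose (tgt b) f \<cdot> b = (ident C X \<otimes>\<^sub>a f) \<cdot> (associator C X V (tgt b)
     \<cdot> ((coev \<otimes>\<^sub>a ident C (tgt b)) \<cdot> (inv_arr (left_unitor C (tgt b)) \<cdot> b)))"
    by (simp add: transpose_def)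
  also have "inv_arr (left_unitor C (tgt b)) \<cdot> b
      = (ident C \<one>\<^sub>o \<otimes>\<^sub>a b) \<cdot> inv_arr (left_unitor C (src b))"
    by (rule inv_left_unitor_nat) simp
  also have "(coev \<otimes>\<^sub>a ident C (tgt b)) \<cdot> \<dots>
      = ((ident C X \<otimes>\<^sub>a ident C V) \<otimes>\<^sub>a b) \<cdot> ((coev \<otimes>\<^sub>a ident C (src b)) \<cdot> inv_arr (left_unitor C (src b)))"
    by (simp add: interchange_reassoc)
  also have "associator C X V (tgt b) \<cdot> \<dots> = (ident C X \<otimes>\<^sub>a (ident C V \<otimes>\<^sub>a b)) \<cdot>
      (associator C X V (src b) \<cdot> ((coev \<otimes>\<^sub>a ident C (src b)) \<cdot> inv_arr (left_unitor C (src b))))"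
    using cmp_reassoc[OF associator_nat[of "ident C X" "ident C V" b],
        of "(coev \<otimes>\<^sub>a ident C (src b)) \<cdot> inv_arr (left_unitor C (src b))"] by simp
  also have "(ident C X \<otimes>\<^sub>a f) \<cdot> \<dots> = transpose (src b) (f \<cdot> (ident C V \<otimes>\<^sub>a b))"
    unfolding transpose_def by (simp add: interchange_reassoc)
  finally show ?thesis
    by simp
qed

lemma untranspose_cmp:
  assumes [simp]: "arr g" "tgt g = X \<otimes>\<^sub>o A" "A \<in> Obj C" "arr b" "tgt b = src g"
  shows "untranspose A (g \<cdot> b) = untranspose A g \<cdot> (ident C V \<otimes>\<^sub>a b)"
  unfolding untranspose_def by (simp add: interchange)

lemma untranspose_cmp_tensor:
  assumes [simp]: "arr g" "arr a" "tgt g = X \<otimes>\<^sub>o src a"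
  shows "untranspose (tgt a) ((ident C X \<otimes>\<^sub>a a) \<cdot> g) = a \<cdot> untranspose (src a) g"
proof -
  have "untranspose (tgt a) ((ident C X \<otimes>\<^sub>a a) \<cdot> g) = left_unitor C (tgt a) \<cdot> ((ev \<otimes>\<^sub>a ident C (tgt a))
      \<cdot> ((inv_arr (associator C V X (tgt a)) \<cdot> (ident C V \<otimes>\<^sub>a (ident C X \<otimes>\<^sub>a a))) \<cdot> (ident C V \<otimes>\<^sub>a g)))"
    by (simp add: untranspose_def interchange)
  also have "inv_arr (associator C V X (tgt a)) \<cdot> (ident C V \<otimes>\<^sub>a (ident C X \<otimes>\<^sub>a a))
      = ((ident C V \<otimes>\<^sub>a ident C X) \<otimes>\<^sub>a a) \<cdot> inv_arr (associator C V X (src a))"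
    using inv_associator_nat[of "ident C V" "ident C X" a] by simp
  also have "(ev \<otimes>\<^sub>a ident C (tgt a)) \<cdot> (\<dots> \<cdot> (ident C V \<otimes>\<^sub>a g))
      = (ident C \<one>\<^sub>o \<otimes>\<^sub>a a) \<cdot> ((ev \<otimes>\<^sub>a ident C (src a)) \<cdot> (inv_arr (associator C V X (src a))
          \<cdot> (ident C V \<otimes>\<^sub>a g)))"
    by (simp add: interchange_reassoc)
  also have "left_unitor C (tgt a) \<cdot> \<dots> = a \<cdot> untranspose (src a) g"
    using cmp_reassoc[OF left_unitor_nat[of a], of "(ev \<otimes>\<^sub>a ident C (src a))
       \<cdot> (inv_arr (associator C V X (src a)) \<cdot> (ident C V \<otimes>\<^sub>a g))"]
    by (simp add: untranspose_def)
  finally show ?thesis .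
qed

text \<open>This is \<open>zigzag_V\<close> tensored with \<open>B\<close>. The pentagon brings
  evaluation and coevaluation into a common factor \<open>(...) \<otimes> B\<close>, and
  \<open>left_unitor_tensor\<close> moves the left unitor there as well; after the zigzag, the
  triangle axiom lets the remaining constraints cancel.\<close>

lemma untranspose_transpose_ident:
  assumes [simp]: "B \<in> Obj C"
  shows "untranspose (V \<otimes>\<^sub>o B) (transpose B (ident C (V \<otimes>\<^sub>o B))) = ident C (V \<otimes>\<^sub>o B)"
proof -
  let ?a = "associator C" and ?ai = "\<lambda>X Y Z. inv_arr (associator C X Y Z)" and ?iB = "ident C B"
    and ?iV = "ident C V"
  \<comment> \<open>The pentagon for \<open>V, X, V, B\<close> with three of its five associators
    inverted.\<close>
  have pent: "?ai V X (V \<otimes>\<^sub>o B) \<cdot> (?iV \<otimes>\<^sub>a ?a X V B)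
      = ?a (V \<otimes>\<^sub>o X) V B \<cdot> ((?ai V X V \<otimes>\<^sub>a ?iB) \<cdot> ?ai V (X \<otimes>\<^sub>o V) B)"
  proof -
    let ?p = "?a V (X \<otimes>\<^sub>o V) B \<cdot> (?a V X V \<otimes>\<^sub>a ?iB)"
    have i: "iso ?p"
      by simp
    have ip: "inv_arr ?p = (?ai V X V \<otimes>\<^sub>a ?iB) \<cdot> ?ai V (X \<otimes>\<^sub>o V) B"
      by (rule inv_arr_eq) (simp_all add: interchange)
    show ?thesis
      unfolding ip[symmetric]
      by (rule iso_conjugate[symmetric, OF i]) (simp_all add: pentagon[symmetric])
  qed
  have "untranspose (V \<otimes>\<^sub>o B) (transpose B (ident C (V \<otimes>\<^sub>o B)))
    = left_unitor C (V \<otimes>\<^sub>o B) \<cdot> ((ev \<otimes>\<^sub>a ident C (V \<otimes>\<^sub>o B)) \<cdot> ((?ai V X (V \<otimes>\<^sub>o B)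
        \<cdot> (?iV \<otimes>\<^sub>a ?a X V B)) \<cdot> ((?iV \<otimes>\<^sub>a (coev \<otimes>\<^sub>a ?iB)) \<cdot> (?iV \<otimes>\<^sub>a inv_arr (left_unitor C B)))))"
    by (simp add: untranspose_def transpose_def interchange interchange_reassoc)
  also have "\<dots> = left_unitor C (V \<otimes>\<^sub>o B) \<cdot> (((ev \<otimes>\<^sub>a (?iV \<otimes>\<^sub>a ?iB)) \<cdot> ?a (V \<otimes>\<^sub>o X) V B)
      \<cdot> ((?ai V X V \<otimes>\<^sub>a ?iB) \<cdot> ((?ai V (X \<otimes>\<^sub>o V) B \<cdot> (?iV \<otimes>\<^sub>a (coev \<otimes>\<^sub>a ?iB)))
        \<cdot> (?iV \<otimes>\<^sub>a inv_arr (left_unitor C B)))))"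
    unfolding pent by simp
  also have "(ev \<otimes>\<^sub>a (?iV \<otimes>\<^sub>a ?iB)) \<cdot> ?a (V \<otimes>\<^sub>o X) V B = ?a \<one>\<^sub>o V B \<cdot> ((ev \<otimes>\<^sub>a ?iV) \<otimes>\<^sub>a ?iB)"
    using associator_nat[of ev ?iV ?iB] by simp
  also have "?ai V (X \<otimes>\<^sub>o V) B \<cdot> (?iV \<otimes>\<^sub>a (coev \<otimes>\<^sub>a ?iB)) = ((?iV \<otimes>\<^sub>a coev) \<otimes>\<^sub>a ?iB) \<cdot> ?ai V \<one>\<^sub>o B"
    using inv_associator_nat[of ?iV coev ?iB] by simp
  also have "left_unitor C (V \<otimes>\<^sub>o B) \<cdot> ((?a \<one>\<^sub>o V B \<cdot> ((ev \<otimes>\<^sub>a ?iV) \<otimes>\<^sub>a ?iB))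
      \<cdot> ((?ai V X V \<otimes>\<^sub>a ?iB) \<cdot> ((((?iV \<otimes>\<^sub>a coev) \<otimes>\<^sub>a ?iB) \<cdot> ?ai V \<one>\<^sub>o B)
        \<cdot> (?iV \<otimes>\<^sub>a inv_arr (left_unitor C B)))))
    = (left_unitor C (V \<otimes>\<^sub>o B) \<cdot> ?a \<one>\<^sub>o V B) \<cdot> (((ev \<otimes>\<^sub>a ?iV) \<otimes>\<^sub>a ?iB)
      \<cdot> ((?ai V X V \<otimes>\<^sub>a ?iB) \<cdot> (((?iV \<otimes>\<^sub>a coev) \<otimes>\<^sub>a ?iB) \<cdot> (?ai V \<one>\<^sub>o B
        \<cdot> (?iV \<otimes>\<^sub>a inv_arr (left_unitor C B))))))"
    by simp
  also have "\<dots> = ((left_unitor C V \<cdot> ((ev \<otimes>\<^sub>a ?iV) \<cdot> (?ai V X V \<cdot> (?iV \<otimes>\<^sub>a coev)))) \<otimes>\<^sub>a ?iB)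
      \<cdot> (?ai V \<one>\<^sub>o B \<cdot> (?iV \<otimes>\<^sub>a inv_arr (left_unitor C B)))"
    unfolding left_unitor_tensor[OF V assms] by (simp add: interchange_reassoc)
  also have "\<dots> = ((?iV \<otimes>\<^sub>a left_unitor C B) \<cdot> ?a V \<one>\<^sub>o B)
      \<cdot> (?ai V \<one>\<^sub>o B \<cdot> (?iV \<otimes>\<^sub>a inv_arr (left_unitor C B)))"
    unfolding zigzag_V by (simp add: triangle)
  also have "\<dots> = ident C (V \<otimes>\<^sub>o B)"
    by (simp add: interchange)
  finally show ?thesis .
qed

text \<open>The same computation with \<open>zigzag_X\<close> tensored with \<open>A\<close>; here
  the triangle axiom comes before the zigzag and \<open>left_unitor_tensor\<close> after it.\<close>

lemma transpose_untranspose_ident: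
  assumes [simp]: "A \<in> Obj C"
  shows "transpose (X \<otimes>\<^sub>o A) (untranspose A (ident C (X \<otimes>\<^sub>o A))) = ident C (X \<otimes>\<^sub>o A)"
proof -
  let ?a = "associator C" and ?ai = "\<lambda>X Y Z. inv_arr (associator C X Y Z)" and ?iA = "ident C A"
    and ?iX = "ident C X"
  have pent: "(?iX \<otimes>\<^sub>a ?ai V X A) \<cdot> ?a X V (X \<otimes>\<^sub>o A)
      = ?a X (V \<otimes>\<^sub>o X) A \<cdot> ((?a X V X \<otimes>\<^sub>a ?iA) \<cdot> ?ai (X \<otimes>\<^sub>o V) X A)"
  proof -
    have eq: "inv_arr (?iX \<otimes>\<^sub>a ?a V X A) = ?iX \<otimes>\<^sub>a ?ai V X A"
      by (rule inv_arr_eq) (simp_all add: interchange)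
    have "(?a X (V \<otimes>\<^sub>o X) A \<cdot> (?a X V X \<otimes>\<^sub>a ?iA)) \<cdot> ?ai (X \<otimes>\<^sub>o V) X A
        = inv_arr (?iX \<otimes>\<^sub>a ?a V X A) \<cdot> ?a X V (X \<otimes>\<^sub>o A)"
      using pentagon[of X V X A] by (intro iso_conjugate) simp_all
    then show ?thesis
      unfolding eq by simp
  qed
  let ?r = "(coev \<otimes>\<^sub>a (?iX \<otimes>\<^sub>a ?iA)) \<cdot> inv_arr (left_unitor C (X \<otimes>\<^sub>o A))"
  have "transpose (X \<otimes>\<^sub>o A) (untranspose A (ident C (X \<otimes>\<^sub>o A)))
    = (?iX \<otimes>\<^sub>a left_unitor C A) \<cdot> ((?iX \<otimes>\<^sub>a (ev \<otimes>\<^sub>a ?iA)) \<cdot> (((?iX \<otimes>\<^sub>a ?ai V X A)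
        \<cdot> ?a X V (X \<otimes>\<^sub>o A)) \<cdot> ?r))"
    by (simp add: untranspose_def transpose_def interchange interchange_reassoc)
  also have "\<dots> = (?iX \<otimes>\<^sub>a left_unitor C A) \<cdot> (((?iX \<otimes>\<^sub>a (ev \<otimes>\<^sub>a ?iA)) \<cdot> ?a X (V \<otimes>\<^sub>o X) A)
      \<cdot> ((?a X V X \<otimes>\<^sub>a ?iA) \<cdot> ((?ai (X \<otimes>\<^sub>o V) X A \<cdot> (coev \<otimes>\<^sub>a (?iX \<otimes>\<^sub>a ?iA)))
        \<cdot> inv_arr (left_unitor C (X \<otimes>\<^sub>o A)))))"
    unfolding pent by simp
  also have "(?iX \<otimes>\<^sub>a (ev \<otimes>\<^sub>a ?iA)) \<cdot> ?a X (V \<otimes>\<^sub>o X) A = ?a X \<one>\<^sub>o A \<cdot> ((?iX \<otimes>\<^sub>a ev) \<otimes>\<^sub>a ?iA)"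
    using associator_nat[of ?iX ev ?iA] by simp
  also have "?ai (X \<otimes>\<^sub>o V) X A \<cdot> (coev \<otimes>\<^sub>a (?iX \<otimes>\<^sub>a ?iA)) = ((coev \<otimes>\<^sub>a ?iX) \<otimes>\<^sub>a ?iA) \<cdot> ?ai \<one>\<^sub>o X A"
    using inv_associator_nat[of coev ?iX ?iA] by simp
  also have "(?iX \<otimes>\<^sub>a left_unitor C A) \<cdot> ((?a X \<one>\<^sub>o A \<cdot> ((?iX \<otimes>\<^sub>a ev) \<otimes>\<^sub>a ?iA))
      \<cdot> ((?a X V X \<otimes>\<^sub>a ?iA) \<cdot> ((((coev \<otimes>\<^sub>a ?iX) \<otimes>\<^sub>a ?iA) \<cdot> ?ai \<one>\<^sub>o X A)
        \<cdot> inv_arr (left_unitor C (X \<otimes>\<^sub>o A)))))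
    = ((?iX \<otimes>\<^sub>a left_unitor C A) \<cdot> ?a X \<one>\<^sub>o A) \<cdot> (((?iX \<otimes>\<^sub>a ev) \<otimes>\<^sub>a ?iA)
      \<cdot> ((?a X V X \<otimes>\<^sub>a ?iA) \<cdot> (((coev \<otimes>\<^sub>a ?iX) \<otimes>\<^sub>a ?iA) \<cdot> (?ai \<one>\<^sub>o X A
        \<cdot> inv_arr (left_unitor C (X \<otimes>\<^sub>o A))))))"
    by simp
  also have "\<dots> = ((right_unitor C X \<cdot> ((?iX \<otimes>\<^sub>a ev) \<cdot> (?a X V X \<cdot> (coev \<otimes>\<^sub>a ?iX)))) \<otimes>\<^sub>a ?iA)
      \<cdot> (?ai \<one>\<^sub>o X A \<cdot> inv_arr (left_unitor C (X \<otimes>\<^sub>o A)))"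
    unfolding triangle[OF X assms] by (simp add: interchange_reassoc)
  also have "\<dots> = (left_unitor C (X \<otimes>\<^sub>o A) \<cdot> ?a \<one>\<^sub>o X A)
      \<cdot> (?ai \<one>\<^sub>o X A \<cdot> inv_arr (left_unitor C (X \<otimes>\<^sub>o A)))"
    unfolding zigzag_X left_unitor_tensor[OF X assms] by simp
  also have "\<dots> = ident C (X \<otimes>\<^sub>o A)"
    by simp
  finally show ?thesis .
qed

text \<open>Yoneda: both transpositions are natural, so it is enough to know their composite on the
  identity of \<open>V \<otimes>\<^sub>o B\<close>.\<close>

lemma untranspose_transpose:
  assumes [simp]: "arr f" "src f = V \<otimes>\<^sub>o B" "B \<in> Obj C"
  shows "untranspose (tgt f) (transpose B f) = f"
proof -
  have "transpose B f = (ident C X \<otimes>\<^sub>a f) \<cdot> transpose B (ident C (V \<otimes>\<^sub>o B))"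
    using transpose_cmp[of "ident C (V \<otimes>\<^sub>o B)" B f] by simp
  then show ?thesis
    using untranspose_cmp_tensor[of "transpose B (ident C (V \<otimes>\<^sub>o B))" f]
    by (simp add: untranspose_transpose_ident)
qed

lemma transpose_untranspose:
  assumes [simp]: "arr g" "tgt g = X \<otimes>\<^sub>o A" "A \<in> Obj C"
  shows "transpose (src g) (untranspose A g) = g"
proof -
  have "untranspose A g = untranspose A (ident C (X \<otimes>\<^sub>o A)) \<cdot> (ident C V \<otimes>\<^sub>a g)"
    using untranspose_cmp[of "ident C (X \<otimes>\<^sub>o A)" A g] by simp
  then show ?thesis
    using transpose_cmp_tensor[of "untranspose A (ident C (X \<otimes>\<^sub>o A))" g]
    by (simp add: transpose_untranspose_ident)
qed

lemma adjunction_transpose: "adjunction V X transpose"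
  unfolding adjunction_def
proof (intro conjI ballI allI impI)
  show "f = g" if "B \<in> Obj C" "arr f" "arr g" "src f = V \<otimes>\<^sub>o B" "src g = V \<otimes>\<^sub>o B" "tgt f = tgt g"
    "transpose B f = transpose B g" for B f g
    using that untranspose_transpose by metis
  show "\<exists>f. arr f \<and> src f = V \<otimes>\<^sub>o src h \<and> tgt f = A \<and> transpose (src h) f = h"
    if "A \<in> Obj C" "arr h" "tgt h = X \<otimes>\<^sub>o A" for A h
    using that transpose_untranspose untranspose_arr by blast
  show "transpose (src b) (f \<cdot> (ident C V \<otimes>\<^sub>a b)) = transpose (tgt b) f \<cdot> b"
    if "arr f" "arr b" "src f = V \<otimes>\<^sub>o tgt b" for f b
    using that by (rule transpose_cmp_tensor)
qed (simp_all add: transpose_cmp)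

end

section \<open>The adjunction of a left dual, and the opposite tensor product\<close>

context monoidal_category
begin

text \<open>The evaluation of a left dual \<open>V\<close> of \<open>X\<close> has \<open>V\<close>
  on the left, so it is \<open>V \<otimes> _\<close> that becomes the left adjoint. Exchanging the
  roles of the two functors takes a braiding.\<close>

lemma adjunction_of_left_dual:
  assumes "is_left_dual C X V"
  shows "\<exists>\<phi>. adjunction V X \<phi>"
proof -
  have [simp]: "V \<in> Obj C" "X \<in> Obj C"
    using assms by (simp_all add: is_left_dual_def)
  obtain ev coev where ec: "ev \<in> Hom C (V \<otimes>\<^sub>o X) \<one>\<^sub>o" "coev \<in> Hom C \<one>\<^sub>o (X \<otimes>\<^sub>o V)"
    and z: "right_unitor C X \<cdot> (ident C X \<otimes>\<^sub>a ev) \<cdot> associator C X V X \<cdot> (coev \<otimes>\<^sub>a ident C X)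
        = left_unitor C X"
      "left_unitor C V \<cdot> (ev \<otimes>\<^sub>a ident C V)
        \<cdot> arrow_inverse C ((V \<otimes>\<^sub>o X) \<otimes>\<^sub>o V) (V \<otimes>\<^sub>o (X \<otimes>\<^sub>o V)) (associator C V X V)
        \<cdot> (ident C V \<otimes>\<^sub>a coev) = right_unitor C V"
    using assms unfolding is_left_dual_def by blast
  have [simp]: "arr ev" "src ev = V \<otimes>\<^sub>o X" "tgt ev = \<one>\<^sub>o" "arr coev" "src coev = \<one>\<^sub>o"
    "tgt coev = X \<otimes>\<^sub>o V"
    using ec by simp_all
  have "dual_pair C X V ev coev"
    by unfold_locales (use z in \<open>simp_all add: arrow_inverse_eq\<close>)
  then show ?thesis
    by (intro exI) (rule dual_pair.adjunction_transpose)
qed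

text \<open>The same category with the opposite tensor product. Reversing the factors mirrors the
  bracketing, hence the inverse associators and the exchanged unitors. Results about the functors
  \<open>X \<otimes> _\<close> become results about \<open>_ \<otimes> X\<close>.\<close>

definition reversed where
  "reversed = C\<lparr>tensor_obj := \<lambda>X Y. Y \<otimes>\<^sub>o X, tensor_arr := \<lambda>f g. g \<otimes>\<^sub>a f,
     associator := \<lambda>X Y Z. inv_arr (associator C Z Y X),
     left_unitor := right_unitor C, right_unitor := left_unitor C\<rparr>"

lemma reversed_simps [simp]:
  "Obj reversed = Obj C" "Hom reversed = Hom C" "ident reversed = ident C" "cmp reversed = cmp C"
  "tensor_obj reversed X Y = Y \<otimes>\<^sub>o X" "tensor_arr reversed f g = g \<otimes>\<^sub>a f"
  "unit_obj reversed = \<one>\<^sub>o" "associator reversed X Y Z = inv_arr (associator C Z Y X)"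
  "left_unitor reversed = right_unitor C" "right_unitor reversed = left_unitor C"
  by (simp_all add: reversed_def)

lemma category_reversed: "category reversed"
  by unfold_locales
    (simp_all add: Hom_disjoint ident_closed cmp_closed cmp_ident_right cmp_ident_left cmp_assoc
       del: Hom_iff)

lemma is_iso_reversed [simp]: "is_iso reversed = is_iso C"
  by (intro ext) (simp add: is_iso_def inverse_arrows_def)

text \<open>Both sides are the inverse of the pentagon for \<open>Z, Y, X, W\<close>.\<close>

lemma reversed_pentagon:
  assumes [simp]: "W \<in> Obj C" "X \<in> Obj C" "Y \<in> Obj C" "Z \<in> Obj C"
  shows "(inv_arr (associator C Z Y X) \<otimes>\<^sub>a ident C W) \<cdot> inv_arr (associator C Z (Y \<otimes>\<^sub>o X) W)
      \<cdot> (ident C Z \<otimes>\<^sub>a inv_arr (associator C Y X W))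
    = inv_arr (associator C (Z \<otimes>\<^sub>o Y) X W) \<cdot> inv_arr (associator C Z Y (X \<otimes>\<^sub>o W))"
proof -
  let ?a = "associator C" and ?ai = "\<lambda>X Y Z. inv_arr (associator C X Y Z)"
  let ?p = "(ident C Z \<otimes>\<^sub>a ?a Y X W) \<cdot> (?a Z (Y \<otimes>\<^sub>o X) W \<cdot> (?a Z Y X \<otimes>\<^sub>a ident C W))"
  have "inv_arr ?p = (?ai Z Y X \<otimes>\<^sub>a ident C W) \<cdot> (?ai Z (Y \<otimes>\<^sub>o X) W \<cdot> (ident C Z \<otimes>\<^sub>a ?ai Y X W))"
    by (rule inv_arr_eq) (simp_all add: interchange interchange_reassoc)
  moreover have eq: "?p = ?a Z Y (X \<otimes>\<^sub>o W) \<cdot> ?a (Z \<otimes>\<^sub>o Y) X W"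
    using pentagon[of Z Y X W] by simp
  have "inv_arr ?p = ?ai (Z \<otimes>\<^sub>o Y) X W \<cdot> ?ai Z Y (X \<otimes>\<^sub>o W)"
    unfolding eq by (rule inv_arr_eq) simp_all
  ultimately show ?thesis
    by simp
qed

lemma monoidal_category_reversed: "monoidal_category reversed"
proof (intro monoidal_category.intro monoidal_category_axioms.intro category_reversed,
    unfold reversed_simps is_iso_reversed)
  show "is_iso C (Z \<otimes>\<^sub>o (Y \<otimes>\<^sub>o X)) ((Z \<otimes>\<^sub>o Y) \<otimes>\<^sub>o X) (inv_arr (associator C Z Y X))"
    if "X \<in> Obj C" "Y \<in> Obj C" "Z \<in> Obj C" for X Y Z
    using that by (simp add: is_iso_iff)
  show "inv_arr (associator C Z' Y' X') \<cdot> (h \<otimes>\<^sub>a (g \<otimes>\<^sub>a f))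
      = ((h \<otimes>\<^sub>a g) \<otimes>\<^sub>a f) \<cdot> inv_arr (associator C Z Y X)"
    if "X \<in> Obj C" "X' \<in> Obj C" "Y \<in> Obj C" "Y' \<in> Obj C" "Z \<in> Obj C" "Z' \<in> Obj C"
      "f \<in> Hom C X X'" "g \<in> Hom C Y Y'" "h \<in> Hom C Z Z'" for X X' Y Y' Z Z' f g h
    using inv_associator_nat[of h g f] that by simp
  show "(right_unitor C Y \<otimes>\<^sub>a ident C X) \<cdot> inv_arr (associator C Y \<one>\<^sub>o X)
      = ident C Y \<otimes>\<^sub>a left_unitor C X" if "X \<in> Obj C" "Y \<in> Obj C" for X Y
    unfolding triangle[OF that(2,1), symmetric] using that by simp
qed (rule tensor_obj_closed tensor_arr_closed tensor_ident tensor_cmp unit_obj_closed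
       right_unitor_iso right_unitor_natural left_unitor_iso left_unitor_natural reversed_pentagon;
     assumption)+

lemma reversed_arr:
  "category.arr reversed = arr" "category.src reversed = src" "category.tgt reversed = tgt"
  by (simp_all add: fun_eq_iff arr_def src_def tgt_def category.arr_def[OF category_reversed]
        category.src_def[OF category_reversed] category.tgt_def[OF category_reversed] del: Hom_iff)

text \<open>Evaluation and coevaluation stay the same; reversing the factors exchanges the two
  zigzag identities. One of them then contains the associator as an inverse of an inverse.\<close>

lemma left_dual_reversed:
  assumes "is_left_dual C X V"
  shows "is_left_dual reversed V X"
proof -
  interpret r: monoidal_category reversed
    by (rule monoidal_category_reversed)
  have [simp]: "V \<in> Obj C" "X \<in> Obj C"
    using assms by (simp_all add: is_left_dual_def)
  have inv: "r.inv_arr (inv_arr (associator C X V X)) = associator C X V X"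
    by (rule r.inv_arr_eq) (use r.associator_arr[of X V X] in \<open>simp_all add: reversed_arr\<close>)
  obtain ev coev where ec: "ev \<in> Hom C (V \<otimes>\<^sub>o X) \<one>\<^sub>o" "coev \<in> Hom C \<one>\<^sub>o (X \<otimes>\<^sub>o V)"
    and z: "right_unitor C X \<cdot> (ident C X \<otimes>\<^sub>a ev) \<cdot> associator C X V X \<cdot> (coev \<otimes>\<^sub>a ident C X)
        = left_unitor C X"
      "left_unitor C V \<cdot> (ev \<otimes>\<^sub>a ident C V)
        \<cdot> arrow_inverse C ((V \<otimes>\<^sub>o X) \<otimes>\<^sub>o V) (V \<otimes>\<^sub>o (X \<otimes>\<^sub>o V)) (associator C V X V)
        \<cdot> (ident C V \<otimes>\<^sub>a coev) = right_unitor C V"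
    using assms unfolding is_left_dual_def by blast
  have "arrow_inverse C ((V \<otimes>\<^sub>o X) \<otimes>\<^sub>o V) (V \<otimes>\<^sub>o (X \<otimes>\<^sub>o V)) (associator C V X V)
      = inv_arr (associator C V X V)"
    by (simp add: arrow_inverse_eq)
  moreover have "arrow_inverse reversed (X \<otimes>\<^sub>o (V \<otimes>\<^sub>o X)) ((X \<otimes>\<^sub>o V) \<otimes>\<^sub>o X)
      (inv_arr (associator C X V X)) = associator C X V X"
    by (subst r.arrow_inverse_eq) (use r.associator_arr[of X V X] inv in \<open>simp_all add: reversed_arr\<close>)
  ultimately show ?thesis
    unfolding is_left_dual_def
    by (intro conjI bexI[of _ ev] bexI[of _ coev]) (use ec z in \<open>simp_all del: Hom_iff assoc\<close>)
qed

end

section \<open>Naturality of the braiding and the second adjunction of a dual\<close>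

context braided_monoidal_category
begin

lemma braiding_arr [simp]:
  assumes "X \<in> Obj C" "Y \<in> Obj C"
  shows "iso (braiding C X Y)" "arr (braiding C X Y)"
    "src (braiding C X Y) = X \<otimes>\<^sub>o Y" "tgt (braiding C X Y) = Y \<otimes>\<^sub>o X"
  using braiding_iso[OF assms] assms by (simp_all add: is_iso_iff iso_arr)

lemma braiding_nat:
  "\<lbrakk>arr f; arr g\<rbrakk> \<Longrightarrow>
    braiding C (tgt f) (tgt g) \<cdot> (f \<otimes>\<^sub>a g) = (g \<otimes>\<^sub>a f) \<cdot> braiding C (src f) (src g)"
  by (rule braiding_natural) simp_all

text \<open>The reversed category turns \<open>X\<close> into a left dual of its left dual \<open>V\<close>; the braiding
  moves the resulting adjunction between the functors \<open>_ \<otimes> X\<close> and \<open>_ \<otimes> V\<close> to the other side.\<close>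

lemma adjunction_of_right_dual:
  assumes "is_left_dual C X V"
  shows "\<exists>\<phi>. adjunction X V \<phi>"
proof -
  interpret r: monoidal_category reversed
    by (rule monoidal_category_reversed)
  obtain \<psi> where \<psi>: "r.adjunction X V \<psi>"
    using r.adjunction_of_left_dual[OF left_dual_reversed[OF assms]] by blast
  note \<psi> = r.adjunctionD[OF \<psi>, unfolded reversed_arr reversed_simps]
  have [simp]: "X \<in> Obj C" "V \<in> Obj C"
    using \<psi>(1,2) by simp_all
  have \<psi>_arr [simp]: "arr (\<psi> B f)" "src (\<psi> B f) = B" "tgt (\<psi> B f) = tgt f \<otimes>\<^sub>o V"
    if "arr f" "src f = B \<otimes>\<^sub>o X" "B \<in> Obj C" for B f
    using \<psi>(3)[OF that] by simp_all
  define \<phi> where "\<phi> B f = braiding C (tgt f) V \<cdot> \<psi> B (f \<cdot> braiding C B X)" for B f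
  have "adjunction X V \<phi>"
    unfolding adjunction_def
  proof (intro conjI ballI allI impI)
    fix B f g
    assume [simp]: "B \<in> Obj C" "arr f" "arr g" "src f = X \<otimes>\<^sub>o B" "src g = X \<otimes>\<^sub>o B" "tgt f = tgt g"
    assume "\<phi> B f = \<phi> B g"
    then have "\<psi> B (f \<cdot> braiding C B X) = \<psi> B (g \<cdot> braiding C B X)"
      unfolding \<phi>_def by - (rule mono_cancel[of "braiding C (tgt f) V"], simp_all add: iso_mono)
    then have "f \<cdot> braiding C B X = g \<cdot> braiding C B X"
      by (rule \<psi>(4)) simp_all
    then show "f = g"
      by (rule epi_cancel[rotated]) (simp_all add: iso_epi)
  next
    fix A h
    assume [simp]: "A \<in> Obj C" "arr h" "tgt h = V \<otimes>\<^sub>o A"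
    obtain f where f [simp]: "arr f" "src f = src h \<otimes>\<^sub>o X" "tgt f = A"
      and eq: "\<psi> (src h) f = inv_arr (braiding C A V) \<cdot> h"
      using \<psi>(5)[of "inv_arr (braiding C A V) \<cdot> h" A] by auto
    show "\<exists>f. arr f \<and> src f = X \<otimes>\<^sub>o src h \<and> tgt f = A \<and> \<phi> (src h) f = h"
      by (rule exI[of _ "f \<cdot> inv_arr (braiding C (src h) X)"]) (simp add: \<phi>_def eq)
  next
    fix B f a
    assume [simp]: "B \<in> Obj C" "arr f" "arr a" "src f = X \<otimes>\<^sub>o B" "src a = tgt f"
    have "\<psi> B (a \<cdot> (f \<cdot> braiding C B X)) = (a \<otimes>\<^sub>a ident C V) \<cdot> \<psi> B (f \<cdot> braiding C B X)"
      by (rule \<psi>(6)) simp_all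
    then show "\<phi> B (a \<cdot> f) = (ident C V \<otimes>\<^sub>a a) \<cdot> \<phi> B f"
      using cmp_reassoc[OF braiding_nat[of a "ident C V"], of "\<psi> B (f \<cdot> braiding C B X)"]
      by (simp add: \<phi>_def)
  next
    fix f b
    assume [simp]: "arr f" "arr b" "src f = X \<otimes>\<^sub>o tgt b"
    have "\<psi> (src b) ((f \<cdot> braiding C (tgt b) X) \<cdot> (b \<otimes>\<^sub>a ident C X))
      = \<psi> (tgt b) (f \<cdot> braiding C (tgt b) X) \<cdot> b"
      by (rule \<psi>(7)) simp_all
    then show "\<phi> (src b) (f \<cdot> (ident C X \<otimes>\<^sub>a b)) = \<phi> (tgt b) f \<cdot> b"
      using braiding_nat[of b "ident C X"] by (simp add: \<phi>_def)
  qed (simp_all add: \<phi>_def)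
  then show ?thesis
    by blast
qed

end

section \<open>Linear abelian categories\<close>

context linear_category
begin

definition zr where "zr X Y = \<zero>\<^bsub>hom_space C X Y\<^esub>"
definition add where "add f g = f \<oplus>\<^bsub>hom_space C (src f) (tgt f)\<^esub> g"

lemma hom_space_abelian:
  "\<lbrakk>X \<in> Obj C; Y \<in> Obj C\<rbrakk> \<Longrightarrow> abelian_group (hom_space C X Y)"
  using hom_space_module module.axioms(2) by blast

lemma hom_space_carrier' [simp]:
  "\<lbrakk>X \<in> Obj C; Y \<in> Obj C\<rbrakk>
    \<Longrightarrow> f \<in> carrier (hom_space C X Y) \<longleftrightarrow> arr f \<and> src f = X \<and> tgt f = Y"
  by (simp add: hom_space_carrier)

lemma zr_arr [simp]:
  assumes "X \<in> Obj C" "Y \<in> Obj C"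
  shows "arr (zr X Y)" "src (zr X Y) = X" "tgt (zr X Y) = Y"
proof -
  interpret H: abelian_group "hom_space C X Y"
    using assms by (rule hom_space_abelian)
  show "arr (zr X Y)" "src (zr X Y) = X" "tgt (zr X Y) = Y"
    using H.zero_closed[unfolded hom_space_carrier'[OF assms]] by (simp_all only: zr_def)
qed

lemma add_arr [simp]:
  assumes "arr f" "arr g" "src f = src g" "tgt f = tgt g"
  shows "arr (add f g)" "src (add f g) = src g" "tgt (add f g) = tgt g"
proof -
  interpret H: abelian_group "hom_space C (src g) (tgt g)"
    using assms by (intro hom_space_abelian) simp_all
  show "arr (add f g)" "src (add f g) = src g" "tgt (add f g) = tgt g"
    using H.a_closed[of f g] assms by (simp_all add: add_def)
qed

lemma add_zr [simp]:
  assumes "arr f" "src f = X" "tgt f = Y"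
  shows "add (zr X Y) f = f" "add f (zr X Y) = f"
proof -
  have [simp]: "X \<in> Obj C" "Y \<in> Obj C"
    using assms by auto
  interpret H: abelian_group "hom_space C X Y"
    by (rule hom_space_abelian) simp_all
  show "add (zr X Y) f = f" "add f (zr X Y) = f"
    using H.l_zero[of f] H.r_zero[of f] assms by (simp_all add: add_def) (simp_all add: zr_def)
qed

lemma add_eq_right:
  assumes "add d f = f" "arr d" "arr f" "src d = src f" "tgt d = tgt f"
  shows "d = zr (src f) (tgt f)"
proof -
  interpret H: abelian_group "hom_space C (src f) (tgt f)"
    using assms by (intro hom_space_abelian) simp_all
  show ?thesis
    using H.add.r_cancel_one[of f d] assms by (simp add: add_def zr_def)
qed

text \<open>Subtraction enters only in this form, without an operation for negatives: it reduces the
  equality of two arrows to the vanishing of \<open>d\<close>, and later removes a split summand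
  from an identity.\<close>

lemma difference_exists:
  assumes "arr f" "arr g" "src f = src g" "tgt f = tgt g"
  shows "\<exists>d. arr d \<and> src d = src g \<and> tgt d = tgt g \<and> add d g = f"
proof -
  interpret H: abelian_group "hom_space C (src g) (tgt g)"
    using assms by (intro hom_space_abelian) simp_all
  let ?d = "f \<ominus>\<^bsub>hom_space C (src g) (tgt g)\<^esub> g"
  have fg: "f \<in> carrier (hom_space C (src g) (tgt g))" "g \<in> carrier (hom_space C (src g) (tgt g))"
    using assms by simp_all
  have "?d \<in> carrier (hom_space C (src g) (tgt g))"
    using fg by (rule H.minus_closed)
  moreover have "?d \<oplus>\<^bsub>hom_space C (src g) (tgt g)\<^esub> g = f"
    using fg by (simp add: H.minus_eq H.a_assoc H.l_neg)
  ultimately show ?thesis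
    using assms by (auto simp: add_def)
qed

lemma cmp_add [simp]:
  assumes "arr f" "arr f'" "arr g" "src f = src f'" "tgt f = tgt f'" "src g = tgt f'"
  shows "g \<cdot> add f f' = add (g \<cdot> f) (g \<cdot> f')"
  using cmp_add_right[of "src f" "tgt f" "tgt g" f f' g] assms by (simp add: add_def)

lemma add_cmp [simp]:
  assumes "arr f" "arr g" "arr g'" "src g = src g'" "tgt g = tgt g'" "src g' = tgt f"
  shows "add g g' \<cdot> f = add (g \<cdot> f) (g' \<cdot> f)"
  using cmp_add_left[of "src f" "tgt f" "tgt g" f g g'] assms by (simp add: add_def)

lemma cmp_zr [simp]:
  assumes "arr g" "src g = Y" "X \<in> Obj C"
  shows "g \<cdot> zr X Y = zr X (tgt g)"
proof -
  have [simp]: "Y \<in> Obj C"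
    using assms by auto
  have "add (g \<cdot> zr X Y) (g \<cdot> zr X Y) = g \<cdot> zr X Y"
    using cmp_add[of "zr X Y" "zr X Y" g] assms by (simp del: cmp_add)
  from add_eq_right[OF this] show ?thesis
    using assms by simp
qed

lemma zr_cmp [simp]:
  assumes "arr f" "tgt f = X" "Y \<in> Obj C"
  shows "zr X Y \<cdot> f = zr (src f) Y"
proof -
  have [simp]: "X \<in> Obj C"
    using assms by auto
  have "add (zr X Y \<cdot> f) (zr X Y \<cdot> f) = zr X Y \<cdot> f"
    using add_cmp[of f "zr X Y" "zr X Y"] assms by (simp del: add_cmp)
  from add_eq_right[OF this] show ?thesis
    using assms by simp
qed

lemma monoI_zr:
  assumes [simp]: "arr f"
    and zr: "\<And>g. \<lbrakk>arr g; tgt g = src f; f \<cdot> g = zr (src g) (tgt f)\<rbrakk> \<Longrightarrow> g = zr (src g) (src f)"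
  shows "mono f"
  unfolding mono_def
proof (intro conjI allI impI)
  fix g h
  assume h [simp]: "arr g" "arr h" "src g = src h" "tgt g = src f" "tgt h = src f"
    and eq: "f \<cdot> g = f \<cdot> h"
  obtain d where d [simp]: "arr d" "src d = src h" "tgt d = tgt h" and dg: "add d h = g"
    using difference_exists[of g h] by auto
  have "add (f \<cdot> d) (f \<cdot> h) = f \<cdot> h"
    using eq unfolding dg[symmetric] by simp
  from add_eq_right[OF this] have "f \<cdot> d = zr (src d) (tgt f)"
    by simp
  then have "d = zr (src d) (src f)"
    by (intro zr) simp_all
  then have "d = zr (src h) (src f)"
    unfolding d(2) .
  moreover have "add (zr (src h) (src f)) h = h"
    by simp
  ultimately show "g = h"
    using dg by metis
qed simp

lemma epiI_zr:
  assumes [simp]: "arr f"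
    and zr: "\<And>g. \<lbrakk>arr g; src g = tgt f; g \<cdot> f = zr (src f) (tgt g)\<rbrakk> \<Longrightarrow> g = zr (tgt f) (tgt g)"
  shows "epi f"
  unfolding epi_def
proof (intro conjI allI impI)
  fix g h
  assume h [simp]: "arr g" "arr h" "tgt g = tgt h" "src g = tgt f" "src h = tgt f"
    and eq: "g \<cdot> f = h \<cdot> f"
  obtain d where d [simp]: "arr d" "src d = src h" "tgt d = tgt h" and dg: "add d h = g"
    using difference_exists[of g h] by auto
  have "add (d \<cdot> f) (h \<cdot> f) = h \<cdot> f"
    using eq unfolding dg[symmetric] by simp
  from add_eq_right[OF this] have "d \<cdot> f = zr (src f) (tgt d)"
    by simp
  then have "d = zr (tgt f) (tgt d)"
    by (intro zr) simp_all
  then have "d = zr (tgt f) (tgt h)"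
    unfolding d(3) .
  moreover have "add (zr (tgt f) (tgt h)) h = h"
    by simp
  ultimately show "g = h"
    using dg by metis
qed simp

lemma mono_zrD:
  "\<lbrakk>mono f; f \<cdot> g = zr (src g) (tgt f); arr g; tgt g = src f\<rbrakk> \<Longrightarrow> g = zr (src g) (src f)"
  by (rule mono_cancel[of f]) (simp_all add: mono_arr)

lemma epi_zrD:
  "\<lbrakk>epi f; g \<cdot> f = zr (src f) (tgt g); arr g; src g = tgt f\<rbrakk> \<Longrightarrow> g = zr (tgt f) (tgt g)"
  by (rule epi_cancel[of f]) (simp_all add: epi_arr)

section \<open>Kernels and cokernels\<close>

definition kernel where
  "kernel f k \<longleftrightarrow> mono k \<and> arr f \<and> tgt k = src f \<and> f \<cdot> k = zr (src k) (tgt f) \<and>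
     (\<forall>g. arr g \<longrightarrow> tgt g = src f \<longrightarrow> f \<cdot> g = zr (src g) (tgt f)
        \<longrightarrow> (\<exists>u. arr u \<and> src u = src g \<and> tgt u = src k \<and> k \<cdot> u = g))"

definition cokernel where
  "cokernel f q \<longleftrightarrow> epi q \<and> arr f \<and> src q = tgt f \<and> q \<cdot> f = zr (src f) (tgt q) \<and>
     (\<forall>g. arr g \<longrightarrow> src g = tgt f \<longrightarrow> g \<cdot> f = zr (src f) (tgt g)
        \<longrightarrow> (\<exists>u. arr u \<and> src u = tgt q \<and> tgt u = tgt g \<and> u \<cdot> q = g))"

lemma kernelD:
  assumes "kernel f k"
  shows "mono k" "arr k" "arr f" "tgt k = src f" "f \<cdot> k = zr (src k) (tgt f)"
    and "\<lbrakk>arr g; tgt g = src f; f \<cdot> g = zr (src g) (tgt f)\<rbrakk>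
      \<Longrightarrow> \<exists>u. arr u \<and> src u = src g \<and> tgt u = src k \<and> k \<cdot> u = g"
  using assms mono_arr unfolding kernel_def by blast+

lemma cokernelD:
  assumes "cokernel f q"
  shows "epi q" "arr q" "arr f" "src q = tgt f" "q \<cdot> f = zr (src f) (tgt q)"
    and "\<lbrakk>arr g; src g = tgt f; g \<cdot> f = zr (src f) (tgt g)\<rbrakk>
      \<Longrightarrow> \<exists>u. arr u \<and> src u = tgt q \<and> tgt u = tgt g \<and> u \<cdot> q = g"
  using assms epi_arr unfolding cokernel_def by blast+

text \<open>In \<open>kernel\<close> the uniqueness of factorizations has become
  \<open>mono k\<close>: two factorizations \<open>g\<close> and \<open>h\<close> of one arrow
  satisfy \<open>k \<cdot> g = k \<cdot> h\<close>, and every composite \<open>k \<cdot> h\<close>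
  is killed by \<open>f\<close>.\<close>

lemma is_kernel_iff:
  assumes [simp]: "arr f" "A \<in> Obj C"
  shows "is_kernel C (src f) (tgt f) f A k \<longleftrightarrow> kernel f k \<and> src k = A"
proof
  assume L: "is_kernel C (src f) (tgt f) f A k"
  have k [simp]: "arr k" "src k = A" "tgt k = src f" and fk: "f \<cdot> k = zr A (tgt f)"
    using L by (simp_all add: is_kernel_def zr_def)
  have uni: "\<exists>!u. u \<in> Hom C (src g) A \<and> k \<cdot> u = g"
    if "arr g" "tgt g = src f" "f \<cdot> g = zr (src g) (tgt f)" for g
    using L that unfolding is_kernel_def zr_def by simp
  have "mono k"
    unfolding mono_def
  proof (intro conjI allI impI)
    fix g h
    assume h [simp]: "arr g" "arr h" "src g = src h" "tgt g = src k" "tgt h = src k"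
      and eq: "k \<cdot> g = k \<cdot> h"
    have "f \<cdot> (k \<cdot> h) = zr (src h) (tgt f)"
      using cmp_reassoc[OF fk, of h] by simp
    then have "\<exists>!u. u \<in> Hom C (src h) A \<and> k \<cdot> u = k \<cdot> h"
      using uni[of "k \<cdot> h"] by simp
    moreover have "g \<in> Hom C (src h) A \<and> k \<cdot> g = k \<cdot> h" "h \<in> Hom C (src h) A \<and> k \<cdot> h = k \<cdot> h"
      using eq by simp_all
    ultimately show "g = h"
      by blast
  qed simp
  moreover have "\<exists>u. arr u \<and> src u = src g \<and> tgt u = src k \<and> k \<cdot> u = g"
    if "arr g" "tgt g = src f" "f \<cdot> g = zr (src g) (tgt f)" for g
    using ex1_implies_ex[OF uni[OF that]] that by simp
  ultimately show "kernel f k \<and> src k = A"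
    unfolding kernel_def using fk by simp
next
  assume "kernel f k \<and> src k = A"
  then have K: "kernel f k" and A: "src k = A"
    by simp_all
  note k = kernelD[OF K]
  show "is_kernel C (src f) (tgt f) f A k"
    unfolding is_kernel_def zr_def[symmetric]
  proof (intro conjI ballI impI)
    fix W g
    assume W: "W \<in> Obj C" "g \<in> Hom C W (src f)" "f \<cdot> g = zr W (tgt f)"
    then have g: "arr g" "src g = W" "tgt g = src f"
      by simp_all
    obtain u where u: "arr u" "src u = src g" "tgt u = src k" "k \<cdot> u = g"
      using k(6)[of g] g W(3) by auto
    show "\<exists>!u. u \<in> Hom C W A \<and> k \<cdot> u = g"
    proof (rule ex1I[of _ u])
      show "u \<in> Hom C W A \<and> k \<cdot> u = g"
        using u W(1) g A by simp
      show "v = u" if "v \<in> Hom C W A \<and> k \<cdot> v = g" for v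
        using that u W(1) g A by - (rule mono_cancel[OF k(1)], simp_all)
    qed
  qed (use k A in simp_all)
qed

lemma is_cokernel_iff:
  assumes [simp]: "arr f" "Q \<in> Obj C"
  shows "is_cokernel C (src f) (tgt f) f Q q \<longleftrightarrow> cokernel f q \<and> tgt q = Q"
proof
  assume L: "is_cokernel C (src f) (tgt f) f Q q"
  have k [simp]: "arr q" "src q = tgt f" "tgt q = Q" and fk: "q \<cdot> f = zr (src f) Q"
    using L by (simp_all add: is_cokernel_def zr_def)
  have uni: "\<exists>!u. u \<in> Hom C Q (tgt g) \<and> u \<cdot> q = g"
    if "arr g" "src g = tgt f" "g \<cdot> f = zr (src f) (tgt g)" for g
    using L that unfolding is_cokernel_def zr_def by simp
  have "epi q"
    unfolding epi_def
  proof (intro conjI allI impI)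
    fix g h
    assume h [simp]: "arr g" "arr h" "tgt g = tgt h" "src g = tgt q" "src h = tgt q"
      and eq: "g \<cdot> q = h \<cdot> q"
    have "(h \<cdot> q) \<cdot> f = zr (src f) (tgt h)"
      by (simp add: fk)
    then have "\<exists>!u. u \<in> Hom C Q (tgt h) \<and> u \<cdot> q = h \<cdot> q"
      using uni[of "h \<cdot> q"] by simp
    moreover have "g \<in> Hom C Q (tgt h) \<and> g \<cdot> q = h \<cdot> q" "h \<in> Hom C Q (tgt h) \<and> h \<cdot> q = h \<cdot> q"
      using eq by simp_all
    ultimately show "g = h"
      by blast
  qed simp
  moreover have "\<exists>u. arr u \<and> src u = tgt q \<and> tgt u = tgt g \<and> u \<cdot> q = g"
    if "arr g" "src g = tgt f" "g \<cdot> f = zr (src f) (tgt g)" for g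
    using ex1_implies_ex[OF uni[OF that]] that by simp
  ultimately show "cokernel f q \<and> tgt q = Q"
    unfolding cokernel_def using fk by simp
next
  assume "cokernel f q \<and> tgt q = Q"
  then have K: "cokernel f q" and A: "tgt q = Q"
    by simp_all
  note k = cokernelD[OF K]
  show "is_cokernel C (src f) (tgt f) f Q q"
    unfolding is_cokernel_def zr_def[symmetric]
  proof (intro conjI ballI impI)
    fix Z g
    assume Z: "Z \<in> Obj C" "g \<in> Hom C (tgt f) Z" "g \<cdot> f = zr (src f) Z"
    then have g: "arr g" "src g = tgt f" "tgt g = Z"
      by simp_all
    obtain u where u: "arr u" "src u = tgt q" "tgt u = tgt g" "u \<cdot> q = g"
      using k(6)[of g] g Z(3) by auto
    show "\<exists>!u. u \<in> Hom C Q Z \<and> u \<cdot> q = g"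
    proof (rule ex1I[of _ u])
      show "u \<in> Hom C Q Z \<and> u \<cdot> q = g"
        using u Z(1) g A by simp
      show "v = u" if "v \<in> Hom C Q Z \<and> v \<cdot> q = g" for v
        using that u Z(1) g A by - (rule epi_cancel[OF k(1)], simp_all)
    qed
  qed (use k A in simp_all)
qed

section \<open>Zero objects\<close>

lemma zero_object_iff:
  "is_zero_object C Z \<longleftrightarrow> Z \<in> Obj C \<and> ident C Z = zr Z Z"
proof (intro iffI conjI)
  assume Z: "is_zero_object C Z"
  then show [simp]: "Z \<in> Obj C"
    by (simp add: is_zero_object_def)
  have "\<exists>!f. f \<in> Hom C Z Z"
    using Z by (simp add: is_zero_object_def)
  moreover have "ident C Z \<in> Hom C Z Z" "zr Z Z \<in> Hom C Z Z"
    by simp_all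
  ultimately show "ident C Z = zr Z Z"
    by blast
next
  assume Z: "Z \<in> Obj C \<and> ident C Z = zr Z Z"
  then have [simp]: "Z \<in> Obj C"
    by simp
  show "is_zero_object C Z"
    unfolding is_zero_object_def
  proof (intro conjI ballI)
    fix X assume [simp]: "X \<in> Obj C"
    have "f = zr X Z" if "arr f" "src f = X" "tgt f = Z" for f
      using that cmp_ident(2)[of f Z] Z by (metis zr_cmp)
    then show "\<exists>!f. f \<in> Hom C X Z"
      by (intro ex1I[of _ "zr X Z"]) auto
    have "f = zr Z X" if "arr f" "src f = Z" "tgt f = X" for f
      using that cmp_ident(1)[of f Z] Z by (metis cmp_zr)
    then show "\<exists>!f. f \<in> Hom C Z X"
      by (intro ex1I[of _ "zr Z X"]) auto
  qed simp
qed

lemma zero_object_arr: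
  assumes "is_zero_object C Z" "arr f"
  shows "src f = Z \<Longrightarrow> f = zr Z (tgt f)" "tgt f = Z \<Longrightarrow> f = zr (src f) Z"
proof -
  have Z: "Z \<in> Obj C" "ident C Z = zr Z Z"
    using assms by (simp_all add: zero_object_iff)
  show "f = zr Z (tgt f)" if "src f = Z"
    using cmp_ident(1)[OF assms(2) that] assms(2) that Z by (simp add: Z)
  show "f = zr (src f) Z" if "tgt f = Z"
    using cmp_ident(2)[OF assms(2) that] assms(2) that Z by (simp add: Z)
qed

lemma epi_to_zero_object:
  assumes "epi e" "e = zr (src e) (tgt e)"
  shows "is_zero_object C (tgt e)"
proof -
  have [simp]: "arr e"
    using assms epi_arr by blast
  have "ident C (tgt e) \<cdot> e = zr (src e) (tgt e)"
    using assms(2) by simp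
  from epi_zrD[OF assms(1), of "ident C (tgt e)"] this show ?thesis
    by (simp add: zero_object_iff)
qed

lemma iso_zero_objects:
  assumes "is_zero_object C (src f)" "is_zero_object C (tgt f)" "arr f"
  shows "iso f"
proof (rule isoI)
  show "zr (tgt f) (src f) \<cdot> f = ident C (src f)"
    "f \<cdot> zr (tgt f) (src f) = ident C (tgt f)"
    using assms zero_object_arr[OF assms(1), of f] by (simp_all add: zero_object_iff)
qed (use assms in \<open>simp_all add: zero_object_iff\<close>)

end

section \<open>Images and preimages in abelian categories\<close>

context linear_abelian_category
begin

lemma ex_kernel: "arr f \<Longrightarrow> \<exists>k. kernel f k"
  using kernel_exists[of "src f" "tgt f" f] by (auto simp: is_kernel_iff)

lemma ex_cokernel: "arr f \<Longrightarrow> \<exists>q. cokernel f q"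
  using cokernel_exists[of "src f" "tgt f" f] by (auto simp: is_cokernel_iff)

text \<open>By axiom \<open>m\<close> is the kernel of some \<open>g\<close>. As \<open>g\<close>
  kills \<open>m\<close>, it factors through the cokernel \<open>c\<close>, so whatever
  \<open>c\<close> kills is killed by \<open>g\<close> and hence factors through
  \<open>m\<close>.\<close>

lemma mono_kernel_of_cokernel:
  assumes "mono m" "cokernel m c"
  shows "kernel c m"
proof -
  note c = cokernelD[OF assms(2)]
  have [simp]: "arr m" "arr c" "src c = tgt m"
    using c by simp_all
  obtain Z g where Z: "Z \<in> Obj C" "g \<in> Hom C (tgt m) Z" "is_kernel C (tgt m) Z g (src m) m"
    using mono_is_kernel[of "src m" "tgt m" m] assms(1) by (auto simp: is_mono_iff)
  then have [simp]: "arr g" "src g = tgt m" "tgt g = Z"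
    by simp_all
  have K: "kernel g m"
    using Z is_kernel_iff[of g "src m" m] by simp
  obtain u where u [simp]: "arr u" "src u = tgt c" "tgt u = Z" and uc: "u \<cdot> c = g"
    using c(6)[of g] kernelD(5)[OF K] by auto
  show ?thesis
    unfolding kernel_def
  proof (intro conjI allI impI)
    fix h
    assume h: "arr h" "tgt h = src c" "c \<cdot> h = zr (src h) (tgt c)"
    have "g \<cdot> h = zr (src h) (tgt g)"
      unfolding uc[symmetric] using h by simp
    then show "\<exists>u. arr u \<and> src u = src h \<and> tgt u = src m \<and> m \<cdot> u = h"
      using kernelD(6)[OF K, of h] h by simp
  qed (use assms c in simp_all)
qed

lemma epi_cokernel_of_kernel:
  assumes "epi e" "kernel e k"
  shows "cokernel k e"
proof -
  note k = kernelD[OF assms(2)]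
  have [simp]: "arr e" "arr k" "tgt k = src e"
    using k by simp_all
  obtain W g where W: "W \<in> Obj C" "g \<in> Hom C W (src e)" "is_cokernel C W (src e) g (tgt e) e"
    using epi_is_cokernel[of "src e" "tgt e" e] assms(1) by (auto simp: is_epi_iff)
  then have [simp]: "arr g" "tgt g = src e" "src g = W"
    by simp_all
  have K: "cokernel g e"
    using W is_cokernel_iff[of g "tgt e" e] by simp
  obtain u where u [simp]: "arr u" "src u = W" "tgt u = src k" and ku: "k \<cdot> u = g"
    using k(6)[of g] cokernelD(5)[OF K] by auto
  show ?thesis
    unfolding cokernel_def
  proof (intro conjI allI impI)
    fix h
    assume h: "arr h" "src h = tgt k" "h \<cdot> k = zr (src k) (tgt h)"
    have "h \<cdot> g = zr (src g) (tgt h)"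
      unfolding ku[symmetric] using h cmp_reassoc[OF h(3), of u] by simp
    then show "\<exists>u. arr u \<and> src u = tgt e \<and> tgt u = tgt h \<and> u \<cdot> e = h"
      using cokernelD(6)[OF K, of h] h by simp
  qed (use assms k in simp_all)
qed

text \<open>The cokernel of an epimorphism is zero, so it kills the identity; the identity therefore
  factors through \<open>m\<close>, the kernel of this cokernel.\<close>

lemma mono_epi_iso:
  assumes "mono m" "epi m"
  shows "iso m"
proof -
  have [simp]: "arr m"
    using assms mono_arr by blast
  obtain c where c: "cokernel m c"
    using ex_cokernel[of m] by auto
  note K = kernelD[OF mono_kernel_of_cokernel[OF assms(1) c]]
  have "c = zr (tgt m) (tgt c)"
    using K(3-5) by (intro epi_zrD[OF assms(2)]) simp_all
  then have "c \<cdot> ident C (tgt m) = zr (tgt m) (tgt c)"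
    using K(3,4) by simp
  then obtain t where t: "arr t" "src t = tgt m" "tgt t = src m" "m \<cdot> t = ident C (tgt m)"
    using K(3,4) K(6)[of "ident C (tgt m)"] by auto
  have "m \<cdot> (t \<cdot> m) = m \<cdot> ident C (src m)"
    using t cmp_reassoc[OF t(4), of m] by simp
  then have "t \<cdot> m = ident C (src m)"
    by (rule mono_cancel[OF assms(1)]) (use t in simp_all)
  then show ?thesis
    using t by (intro isoI[of m t]) simp_all
qed

text \<open>The kernel \<open>m\<close> of the cokernel of \<open>f\<close> is the smallest
  subobject through which \<open>f\<close> factors. If \<open>u\<close> kills \<open>e\<close> and
  \<open>k\<close> is the kernel of \<open>u\<close>, then \<open>f\<close> factors already through
  \<open>m \<cdot> k\<close>; minimality gives \<open>k\<close> a right inverse, and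
  \<open>u\<close> vanishes.\<close>

lemma image_factorization:
  assumes [simp]: "arr f"
  obtains m e where "mono m" "epi e" "src m = tgt e" "tgt m = tgt f" "src e = src f" "m \<cdot> e = f"
proof -
  obtain c where c: "cokernel f c"
    using ex_cokernel[OF assms] by auto
  note c = cokernelD[OF c]
  obtain m where m: "kernel c m"
    using ex_kernel[OF c(2)] by auto
  note m = kernelD[OF m]
  obtain e where e: "arr e" "src e = src f" "tgt e = src m" "m \<cdot> e = f"
    using m(6)[of f] c by auto
  note [simp] = m(2,4) c(2,4) e(1-3)
  have "epi e"
  proof (rule epiI_zr)
    fix u
    assume u [simp]: "arr u" "src u = tgt e" and ue: "u \<cdot> e = zr (src e) (tgt u)"
    obtain k where k: "kernel u k"
      using ex_kernel[OF u(1)] by auto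
    note k = kernelD[OF k]
    note [simp] = k(2,4)
    obtain e' where e': "arr e'" "src e' = src e" "tgt e' = src k" "k \<cdot> e' = e"
      using k(6)[of e] ue by auto
    \<comment> \<open>Minimality of \<open>m\<close>: the cokernel \<open>d\<close> of
      \<open>m \<cdot> k\<close> kills \<open>f\<close>, so it factors through \<open>c\<close> and
      kills \<open>m\<close>; thus \<open>m\<close> factors through \<open>m \<cdot> k\<close>, the
      kernel of \<open>d\<close>.\<close>
    have mk: "mono (m \<cdot> k)"
      using m k by (intro mono_cmp) simp_all
    obtain d where d: "cokernel (m \<cdot> k) d"
      using ex_cokernel[of "m \<cdot> k"] by auto
    note D = kernelD[OF mono_kernel_of_cokernel[OF mk d]]
    have [simp]: "arr d" "src d = tgt f"
      using D(3,4) by simp_all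
    have "d \<cdot> f = ((d \<cdot> (m \<cdot> k)) \<cdot> e')"
      using e' e(4) by simp
    also have "\<dots> = zr (src f) (tgt d)"
      unfolding D(5) using e' by simp
    finally obtain d' where d': "arr d'" "src d' = tgt c" "tgt d' = tgt d" "d' \<cdot> c = d"
      using c(6)[of d] by auto
    have "d \<cdot> m = d' \<cdot> (c \<cdot> m)"
      unfolding d'(4)[symmetric] using d'(1,2) by simp
    also have "\<dots> = zr (src m) (tgt d)"
      unfolding m(5) using d'(1-3) by simp
    finally obtain t where t: "arr t" "src t = src m" "tgt t = src (m \<cdot> k)" "(m \<cdot> k) \<cdot> t = m"
      using D(6)[of m] by auto
    have "m \<cdot> (k \<cdot> t) = m \<cdot> ident C (src m)"
      using t by simp
    then have kt: "k \<cdot> t = ident C (src m)"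
      by (rule mono_cancel[OF m(1)]) (use t in simp_all)
    have "u = u \<cdot> (k \<cdot> t)"
      unfolding kt by simp
    also have "\<dots> = (u \<cdot> k) \<cdot> t"
      using t by simp
    also have "\<dots> = zr (tgt e) (tgt u)"
      unfolding k(5) using t by simp
    finally show "u = zr (tgt e) (tgt u)" .
  qed simp
  then show thesis
    using that[of m e] m(1) e by simp
qed

text \<open>The preimage \<open>w\<close> of \<open>i\<close> is the kernel of
  \<open>c \<cdot> e\<close>, where \<open>c\<close> is the cokernel of \<open>i\<close>. Passing to
  the epimorphism \<open>q\<close> of the image factorization of \<open>c \<cdot> e\<close> keeps
  this kernel and makes \<open>q\<close> the cokernel of \<open>w\<close>, so that every arrow
  killing \<open>w\<close> factors through \<open>q\<close>.\<close>

lemma epi_pullback_mono: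
  assumes e: "epi e" and i: "mono i" and tgt: "tgt i = tgt e"
  obtains w e' where "mono w" "epi e'" "tgt w = src e" "src w = src e'" "tgt e' = src i"
    "e \<cdot> w = i \<cdot> e'"
proof -
  have [simp]: "arr e" "arr i" "tgt i = tgt e"
    using assms mono_arr epi_arr by blast+
  obtain c where c: "cokernel i c"
    using ex_cokernel[of i] by auto
  note C = kernelD[OF mono_kernel_of_cokernel[OF i c]]
  have [simp]: "arr c" "src c = tgt e"
    using C(3,4) by simp_all
  obtain n q where q: "mono n" "epi q" "src n = tgt q" "tgt n = tgt c" "src q = src e" "n \<cdot> q = c \<cdot> e"
    using image_factorization[of "c \<cdot> e"] by auto
  have [simp]: "arr n" "arr q"
    using q mono_arr epi_arr by blast+
  note [simp] = q(3-5)
  obtain w where w: "kernel q w"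
    using ex_kernel[of q] by auto
  note W = kernelD[OF w]
  note [simp] = W(2,4)
  have ew: "c \<cdot> (e \<cdot> w) = zr (src w) (tgt c)"
  proof -
    have "c \<cdot> (e \<cdot> w) = (n \<cdot> q) \<cdot> w"
      unfolding q(6) by simp
    then show ?thesis
      by (simp add: W(5))
  qed
  obtain e' where e': "arr e'" "src e' = src w" "tgt e' = src i" "i \<cdot> e' = e \<cdot> w"
    using C(6)[of "e \<cdot> w"] ew by auto
  note [simp] = e'(1-3)
  note Q = cokernelD[OF epi_cokernel_of_kernel[OF q(2) w]]
  obtain k where k: "kernel e k"
    using ex_kernel[of e] by auto
  note E = cokernelD[OF epi_cokernel_of_kernel[OF e k]]
  have [simp]: "arr k" "tgt k = src e"
    using E by simp_all
  \<comment> \<open>Since \<open>q\<close> kills the kernel of \<open>e\<close>, it descends along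
    \<open>e\<close> to an arrow \<open>q'\<close> on the target, and this kills
    \<open>i\<close>.\<close>
  have qk: "q \<cdot> k = zr (src k) (tgt q)"
  proof -
    have "n \<cdot> (q \<cdot> k) = (n \<cdot> q) \<cdot> k"
      by simp
    also have "\<dots> = zr (src k) (tgt n)"
      unfolding q(6) by (simp add: E(5))
    finally show ?thesis
      using mono_zrD[OF q(1), of "q \<cdot> k"] by simp
  qed
  obtain q' where q': "arr q'" "src q' = tgt e" "tgt q' = tgt q" "q' \<cdot> e = q"
    using E(6)[of q] qk by auto
  note [simp] = q'(1-3)
  have q'i: "q' \<cdot> i = zr (src i) (tgt q)"
  proof -
    have "(n \<cdot> q') \<cdot> e = c \<cdot> e"
      using q(6) q'(4) by simp
    then have "n \<cdot> q' = c"
      by (rule epi_cancel[OF e]) simp_all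
    then have "n \<cdot> (q' \<cdot> i) = zr (src i) (tgt n)"
      using C(5) cmp_reassoc[of n q' c i] by simp
    then show ?thesis
      using mono_zrD[OF q(1), of "q' \<cdot> i"] by simp
  qed
  have "epi e'"
  proof -
    \<comment> \<open>Let \<open>d\<close> be the cokernel of \<open>i \<cdot> m\<close>, with
      \<open>m\<close> the image of \<open>e'\<close>. Then \<open>d \<cdot> e\<close> kills
      \<open>w\<close>, so it factors through \<open>q\<close> and \<open>d\<close> factors through
      \<open>q'\<close>. Hence \<open>d\<close> kills \<open>i\<close>, so \<open>i\<close> factors
      through \<open>i \<cdot> m\<close>, and \<open>m\<close> has a right inverse.\<close>
    obtain m e'' where m: "mono m" "epi e''" "src m = tgt e''" "tgt m = src i" "src e'' = src w"
      "m \<cdot> e'' = e'"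
      using image_factorization[of e'] by auto
    have [simp]: "arr m" "arr e''"
      using m mono_arr epi_arr by blast+
    note [simp] = m(3-5)
    have im: "mono (i \<cdot> m)"
      using i m by (intro mono_cmp) simp_all
    obtain d where d: "cokernel (i \<cdot> m) d"
      using ex_cokernel[of "i \<cdot> m"] by auto
    note D = kernelD[OF mono_kernel_of_cokernel[OF im d]]
    have [simp]: "arr d" "src d = tgt e"
      using D(3,4) by simp_all
    have "(d \<cdot> e) \<cdot> w = (d \<cdot> (i \<cdot> m)) \<cdot> e''"
      using e'(4) m(6) by simp
    also have "\<dots> = zr (src w) (tgt d)"
      unfolding D(5) by simp
    finally obtain t where t: "arr t" "src t = tgt q" "tgt t = tgt d" "t \<cdot> q = d \<cdot> e"
      using Q(6)[of "d \<cdot> e"] by auto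
    note [simp] = t(1-3)
    have "(t \<cdot> q') \<cdot> e = d \<cdot> e"
      using t(4) q'(4) by simp
    then have tq': "t \<cdot> q' = d"
      by (rule epi_cancel[OF e]) simp_all
    have "d \<cdot> i = zr (src i) (tgt d)"
      unfolding tq'[symmetric] by (simp add: q'i)
    then obtain s where s: "arr s" "src s = src i" "tgt s = tgt e''" "(i \<cdot> m) \<cdot> s = i"
      using D(6)[of i] by auto
    note [simp] = s(1-3)
    have "i \<cdot> (m \<cdot> s) = i \<cdot> ident C (src i)"
      using s(4) by simp
    then have "m \<cdot> s = ident C (src i)"
      by (rule mono_cancel[OF i]) simp_all
    then have "epi m"
      using monoI_left_inverse(2)[of s m] by simp
    then have "epi (m \<cdot> e'')"
      using m(2) by (intro epi_cmp) simp_all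
    then show ?thesis
      unfolding m(6) .
  qed
  then show thesis
    using that[of w e'] W(1) e'(4) by simp
qed

end

section \<open>Direct sums, and filtrations by simple quotients\<close>

context linear_category
begin

lemma direct_sumE:
  assumes "is_direct_sum C X Y Z" "X \<in> Obj C" "Y \<in> Obj C"
  obtains i j p q where
    "arr i" "src i = X" "tgt i = Z" "arr j" "src j = Y" "tgt j = Z"
    "arr p" "src p = Z" "tgt p = X" "arr q" "src q = Z" "tgt q = Y"
    "p \<cdot> i = ident C X" "q \<cdot> j = ident C Y" "p \<cdot> j = zr Y X" "q \<cdot> i = zr X Y"
    "add (i \<cdot> p) (j \<cdot> q) = ident C Z"
proof -
  have Z: "Z \<in> Obj C"
    using assms by (simp add: is_direct_sum_def)
  obtain i j p q where ij: "i \<in> Hom C X Z" "j \<in> Hom C Y Z" "p \<in> Hom C Z X" "q \<in> Hom C Z Y"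
    "p \<cdot> i = ident C X" "q \<cdot> j = ident C Y" "p \<cdot> j = zr Y X" "q \<cdot> i = zr X Y"
    "(i \<cdot> p) \<oplus>\<^bsub>hom_space C Z Z\<^esub> (j \<cdot> q) = ident C Z"
    using assms(1) unfolding is_direct_sum_def zr_def by blast
  then show thesis
    using that[of i j p q] assms(2,3) Z by (simp add: add_def)
qed

text \<open>Filtrations with \<open>n\<close> simple quotients; unlike \<open>finite_length\<close> this records the length.\<close>

inductive flen where
  flen_zero: "is_zero_object C X \<Longrightarrow> flen 0 X"
| flen_Suc: "\<lbrakk>flen n Y; kernel p i; epi p; src i = Y; src p = X; is_simple C (tgt p)\<rbrakk>
    \<Longrightarrow> flen (Suc n) X"

lemma flen_Obj: "flen n X \<Longrightarrow> X \<in> Obj C"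
  by (induction rule: flen.induct) (auto simp: zero_object_iff dest: epi_arr)

lemma flen_of_finite_length: "finite_length C X \<Longrightarrow> \<exists>n. flen n X"
proof (induction rule: finite_length.induct)
  case (extend Y X S i p)
  then obtain n where n: "flen n Y"
    by blast
  have [simp]: "Y \<in> Obj C" "X \<in> Obj C" "S \<in> Obj C"
    using flen_Obj[OF n] extend by (simp_all add: is_simple_def)
  have se: "is_kernel C X S p Y i" "is_cokernel C Y X i S p"
    using extend(4) by (simp_all add: short_exact_def)
  then have [simp]: "arr p" "src p = X" "tgt p = S" "arr i" "src i = Y" "tgt i = X"
    by (simp_all add: is_kernel_def is_cokernel_def)
  have "kernel p i" "cokernel i p"
    using se is_kernel_iff[of p Y i] is_cokernel_iff[of i S p] by simp_all
  then have "flen (Suc n) X"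
    using extend(3) n cokernelD(1) by (intro flen_Suc[of n Y p i]) simp_all
  then show ?case
    by blast
qed (blast intro: flen_zero)

lemma kernel_mono_cmp:
  assumes "kernel f k" "mono g" "src g = tgt f"
  shows "kernel (g \<cdot> f) k"
proof -
  note k = kernelD[OF assms(1)]
  have [simp]: "arr k" "arr f" "arr g" "tgt k = src f" "src g = tgt f"
    using k assms mono_arr by simp_all
  show ?thesis
    unfolding kernel_def
  proof (intro conjI allI impI)
    fix h
    assume h: "arr h" "tgt h = src (g \<cdot> f)" "(g \<cdot> f) \<cdot> h = zr (src h) (tgt (g \<cdot> f))"
    then have "f \<cdot> h = zr (src h) (tgt f)"
      using mono_zrD[OF assms(2), of "f \<cdot> h"] by simp
    then show "\<exists>u. arr u \<and> src u = src h \<and> tgt u = src k \<and> k \<cdot> u = h"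
      using k(6)[of h] h by simp
  qed (use k in simp_all)
qed

end

context linear_abelian_category
begin

text \<open>The filtration is pushed forward along \<open>e\<close>. If \<open>m\<close> is the
  image of \<open>Y\<close> in the quotient, the cokernel \<open>c\<close> of \<open>m\<close> is
  itself a quotient \<open>r\<close> of the simple object \<open>tgt p\<close>; so the top step
  either disappears or survives unchanged, according to the kernel of \<open>r\<close>.\<close>

lemma flen_epi:
  "\<lbrakk>flen n X; epi e; src e = X\<rbrakk> \<Longrightarrow> \<exists>m\<le>n. flen m (tgt e) \<and> (m = n \<longrightarrow> iso e)"
proof (induction arbitrary: e rule: flen.induct)
  case (flen_zero X)
  have e: "arr e"
    using flen_zero(2) by (rule epi_arr)
  have "e = zr (src e) (tgt e)"
    using zero_object_arr(1)[OF flen_zero(1) e] flen_zero(3) by simp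
  then have "is_zero_object C (tgt e)"
    by (rule epi_to_zero_object[OF flen_zero(2)])
  then show ?case
    using flen_zero e iso_zero_objects[of e] flen.flen_zero by auto
next
  case (flen_Suc n Y p i X)
  note i = kernelD[OF flen_Suc(2)]
  have [simp]: "arr e" "src e = X" "arr p" "src p = X" "arr i" "tgt i = X" "src i = Y"
    using i flen_Suc epi_arr by simp_all
  obtain m e0 where m: "mono m" "epi e0" "src m = tgt e0" "tgt m = tgt e" "src e0 = Y"
    "m \<cdot> e0 = e \<cdot> i"
    using image_factorization[of "e \<cdot> i"] by auto
  have [simp]: "arr m" "arr e0"
    using m mono_arr epi_arr by blast+
  note [simp] = m(3-5)
  obtain c where c: "cokernel m c"
    using ex_cokernel[of m] by auto
  have mc: "kernel c m"
    using m(1) c by (rule mono_kernel_of_cokernel)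
  note M = kernelD[OF mc]
  note c = cokernelD[OF c]
  have [simp]: "arr c" "src c = tgt e"
    using c by simp_all
  have "(c \<cdot> e) \<cdot> i = (c \<cdot> m) \<cdot> e0"
    using m(6) by simp
  also have "\<dots> = zr Y (tgt c)"
    unfolding c(5) by simp
  finally obtain r where r: "arr r" "src r = tgt p" "tgt r = tgt c" "r \<cdot> p = c \<cdot> e"
    using cokernelD(6)[OF epi_cokernel_of_kernel[OF flen_Suc(3,2)], of "c \<cdot> e"] by auto
  note [simp] = r(1-3)
  have "epi (r \<cdot> p)"
    unfolding r(4) using c(1) flen_Suc by (intro epi_cmp) simp_all
  then have er: "epi r"
    by (rule epi_of_epi_cmp) simp_all
  obtain \<kappa> where \<kappa>: "kernel r \<kappa>"
    using ex_kernel[of r] by auto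
  note \<kappa> = kernelD[OF \<kappa>]
  have "is_mono C (src \<kappa>) (tgt p) \<kappa>"
    using \<kappa> by (simp add: is_mono_iff)
  then have "is_zero_object C (src \<kappa>) \<or> is_iso C (src \<kappa>) (tgt p) \<kappa>"
    using flen_Suc(6) \<kappa>(2) by (simp add: is_simple_def)
  then show ?case
  proof
    \<comment> \<open>Here \<open>r\<close> vanishes and \<open>m\<close> is an epimorphism, so
      \<open>Y\<close> alone maps onto the target of \<open>e\<close>. The length is at most
      \<open>n\<close>, hence not \<open>Suc n\<close>.\<close>
    assume "is_iso C (src \<kappa>) (tgt p) \<kappa>"
    then have "iso \<kappa>"
      using \<kappa> by (simp add: is_iso_iff)
    then have "r = zr (src r) (tgt r)"
      using epi_zrD[OF iso_epi, of \<kappa> r] \<kappa> by simp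
    then have R: "is_zero_object C (tgt c)"
      using epi_to_zero_object[OF er] by simp
    have "c \<cdot> ident C (tgt e) = zr (tgt e) (tgt c)"
      using zero_object_arr(2)[OF R, of c] by simp
    then obtain t where t: "arr t" "src t = tgt e" "tgt t = tgt e0" "m \<cdot> t = ident C (tgt e)"
      using M(6)[of "ident C (tgt e)"] by auto
    then have "epi m"
      using monoI_left_inverse(2)[of t m] by simp
    then have "epi (m \<cdot> e0)"
      using m(2) by (intro epi_cmp) simp_all
    then obtain k where "k \<le> n" "flen k (tgt e)"
      using flen_Suc.IH[of "m \<cdot> e0"] by auto
    then show ?thesis
      by (intro exI[of _ k]) simp
  next
    assume K: "is_zero_object C (src \<kappa>)"
    have mr: "mono r"
    proof (rule monoI_zr)
      fix g assume g: "arr g" "tgt g = src r" "r \<cdot> g = zr (src g) (tgt r)"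
      then obtain u where u: "arr u" "src u = src g" "tgt u = src \<kappa>" "\<kappa> \<cdot> u = g"
        using \<kappa>(6) by blast
      have "\<kappa> = zr (src \<kappa>) (src r)"
        using zero_object_arr(1)[OF K \<kappa>(2)] \<kappa>(4) by simp
      then have "g = zr (src \<kappa>) (src r) \<cdot> u"
        using u(4) by simp
      then show "g = zr (src g) (src r)"
        using u(1-3) by simp
    qed simp
    have ir: "iso r"
      using mr er by (rule mono_epi_iso)
    have "kernel (inv_arr r \<cdot> c) m"
      using ir by (intro kernel_mono_cmp[OF mc] iso_mono) simp_all
    moreover have "epi (inv_arr r \<cdot> c)"
      using ir by (intro epi_cmp[OF iso_epi c(1)]) simp_all
    moreover obtain k where k: "k \<le> n" "flen k (tgt e0)" "k = n \<longrightarrow> iso e0"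
      using flen_Suc.IH[of e0] m by auto
    ultimately have "flen (Suc k) (tgt e)"
      using flen_Suc(6) ir by (intro flen.flen_Suc[of k "tgt e0" "inv_arr r \<cdot> c" m]) simp_all
    moreover have "iso e" if "Suc k = Suc n"
    proof (rule mono_epi_iso)
      have me: "mono (m \<cdot> e0)"
        using k that by (intro mono_cmp[OF m(1) iso_mono]) simp_all
      \<comment> \<open>An arrow \<open>x\<close> killed by \<open>e\<close> is killed by
        \<open>p\<close>, since \<open>r\<close> is a monomorphism; so it comes from an arrow
        \<open>y\<close> into \<open>Y\<close>, which is killed by the monomorphism
        \<open>m \<cdot> e0\<close>.\<close>
      show "mono e"
      proof (rule monoI_zr)
        fix x assume x: "arr x" "tgt x = src e" "e \<cdot> x = zr (src x) (tgt e)"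
        have "(r \<cdot> p) \<cdot> x = zr (src x) (tgt r)"
          unfolding r(4) using x by simp
        then have "p \<cdot> x = zr (src x) (tgt p)"
          using mono_zrD[OF mr, of "p \<cdot> x"] x by simp
        then obtain y where y: "arr y" "src y = src x" "tgt y = Y" "i \<cdot> y = x"
          using i(6)[of x] x by auto
        have "(m \<cdot> e0) \<cdot> y = e \<cdot> x"
          unfolding m(6) y(4)[symmetric] using y(1-3) by simp
        then have "y = zr (src y) Y"
          using mono_zrD[OF me, of y] x(3) y(1-3) by simp
        then have "x = i \<cdot> zr (src y) Y"
          using y(4) by simp
        then show "x = zr (src x) (src e)"
          using x y(1-3) by simp
      qed simp
    qed (rule flen_Suc)
    ultimately show ?thesis
      using k(1) by (intro exI[of _ "Suc k"]) simp
  qed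
qed

text \<open>Projectivity inside the full subcategory \<open>D\<close>: lifts are required only along
  epimorphisms of \<open>C\<close> whose two ends lie in \<open>D\<close>.\<close>

definition rel_projective where
  "rel_projective D P \<longleftrightarrow> P \<in> D \<and> (\<forall>a f. epi a \<longrightarrow> src a \<in> D \<longrightarrow> tgt a \<in> D \<longrightarrow> arr f \<longrightarrow>
     src f = P \<longrightarrow> tgt f = tgt a \<longrightarrow> (\<exists>g. arr g \<and> src g = P \<and> tgt g = src a \<and> a \<cdot> g = f))"

lemma rel_projectiveD:
  "\<lbrakk>rel_projective D P; epi a; src a \<in> D; tgt a \<in> D; arr f; src f = P; tgt f = tgt a\<rbrakk>
    \<Longrightarrow> \<exists>g. arr g \<and> src g = P \<and> tgt g = src a \<and> a \<cdot> g = f"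
  unfolding rel_projective_def by blast

end

section \<open>Length, and covers by relatively projective objects\<close>

context finite_linear_abelian_category
begin

text \<open>The minimum over all filtrations is monotone along epimorphisms, because
  \<open>flen_epi\<close> pushes a shortest filtration forward.\<close>

definition len where "len X = (LEAST n. flen n X)"

lemma flen_len: "X \<in> Obj C \<Longrightarrow> flen (len X) X"
  unfolding len_def using flen_of_finite_length[OF objects_finite_length] by (rule LeastI_ex)

lemma len_epi:
  assumes "epi e"
  shows "len (tgt e) \<le> len (src e)" "len (tgt e) = len (src e) \<Longrightarrow> iso e"
proof -
  obtain m where m: "m \<le> len (src e)" "flen m (tgt e)" "m = len (src e) \<longrightarrow> iso e"
    using flen_epi[OF flen_len assms refl] epi_arr[OF assms] by auto
  have "len (tgt e) \<le> m"
    unfolding len_def using m(2) by (rule Least_le)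
  then show "len (tgt e) \<le> len (src e)" "len (tgt e) = len (src e) \<Longrightarrow> iso e"
    using m by simp_all
qed

text \<open>The cover is the longest quotient in \<open>D\<close> of a projective object \<open>P\<close> over \<open>Z\<close>: every arrow
  from \<open>P\<close> to an object of \<open>D\<close> factors through it, as otherwise the image of the pair of arrows
  would be a longer quotient.\<close>

lemma enough_rel_projectives:
  assumes D: "D \<subseteq> Obj C"
    and sub: "\<And>m. \<lbrakk>mono m; tgt m \<in> D\<rbrakk> \<Longrightarrow> src m \<in> D"
    and sum: "\<And>X Y Z. \<lbrakk>X \<in> D; Y \<in> D; is_direct_sum C X Y Z\<rbrakk> \<Longrightarrow> Z \<in> D"
    and Z: "Z \<in> D"
  obtains e where "epi e" "tgt e = Z" "rel_projective D (src e)"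
proof -
  obtain P \<epsilon> where P: "is_projective C P" and "is_epi C P Z \<epsilon>"
    using enough_projectives[of Z] D Z by blast
  moreover have [simp]: "P \<in> Obj C" "Z \<in> Obj C"
    using P D Z by (auto simp: is_projective_def)
  ultimately have \<epsilon>: "epi \<epsilon>" "src \<epsilon> = P" "tgt \<epsilon> = Z"
    by (simp_all add: is_epi_iff)
  let ?Q = "\<lambda>\<pi>. epi \<pi> \<and> src \<pi> = P \<and> tgt \<pi> \<in> D"
  have bound: "len (tgt \<pi>) < Suc (len P)" if "epi \<pi>" "src \<pi> = P" for \<pi>
    using len_epi(1)[OF that(1)] that(2) by simp
  have "\<exists>\<pi>. ?Q \<pi> \<and> (\<forall>\<pi>'. ?Q \<pi>' \<longrightarrow> len (tgt \<pi>') \<le> len (tgt \<pi>))"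
    \<comment> \<open>Quotients of \<open>P\<close> are not longer than \<open>P\<close>, which
      gives the bound; \<open>\<epsilon>\<close> is a candidate because \<open>Z\<close> lies in
      \<open>D\<close>.\<close>
    by (rule ex_has_greatest_nat[of _ \<epsilon> _ "Suc (len P)"]) (use \<epsilon> Z bound in simp_all)
  then obtain \<pi> where \<pi>: "epi \<pi>" "src \<pi> = P" "tgt \<pi> \<in> D"
    and max: "\<And>\<pi>'. \<lbrakk>epi \<pi>'; src \<pi>' = P; tgt \<pi>' \<in> D\<rbrakk> \<Longrightarrow> len (tgt \<pi>') \<le> len (tgt \<pi>)"
    by blast
  have [simp]: "arr \<pi>" "src \<pi> = P"
    using \<pi> epi_arr by blast+
  have factor: "\<exists>t. arr t \<and> src t = tgt \<pi> \<and> tgt t = tgt g \<and> t \<cdot> \<pi> = g"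
    if [simp]: "arr g" "src g = P" and gD: "tgt g \<in> D" for g
  proof -
    obtain S where S: "is_direct_sum C (tgt \<pi>) (tgt g) S"
      using direct_sum_exists[of "tgt \<pi>" "tgt g"] by auto
    obtain i j p q where ds [simp]:
      "arr i" "src i = tgt \<pi>" "tgt i = S" "arr j" "src j = tgt g" "tgt j = S"
      "arr p" "src p = S" "tgt p = tgt \<pi>" "arr q" "src q = S" "tgt q = tgt g"
      "p \<cdot> i = ident C (tgt \<pi>)" "q \<cdot> j = ident C (tgt g)" "p \<cdot> j = zr (tgt g) (tgt \<pi>)"
      "q \<cdot> i = zr (tgt \<pi>) (tgt g)"
      using direct_sumE[OF S] by (metis tgt_Obj \<open>arr \<pi>\<close> \<open>arr g\<close>)
    let ?f = "add (i \<cdot> \<pi>) (j \<cdot> g)"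
    have pf: "p \<cdot> ?f = \<pi>" and qf: "q \<cdot> ?f = g"
      using cmp_reassoc[OF ds(13), of \<pi>] cmp_reassoc[OF ds(14), of g]
        cmp_reassoc[OF ds(15), of g] cmp_reassoc[OF ds(16), of \<pi>] by simp_all
    obtain m e where m: "mono m" "epi e" "src m = tgt e" "tgt m = S" "src e = P" "m \<cdot> e = ?f"
      using image_factorization[of ?f] by auto
    have [simp]: "arr m" "arr e"
      using m mono_arr epi_arr by blast+
    note [simp] = m(3-5)
    have pme: "(p \<cdot> m) \<cdot> e = \<pi>"
      using m(6) pf by simp
    have ep: "epi (p \<cdot> m)"
      by (rule epi_of_epi_cmp[of _ e]) (simp_all only: pme \<pi>, simp_all)
    have "tgt e \<in> D"
      using sub[OF m(1)] sum[OF \<pi>(3) gD S] by simp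
    then have "len (tgt e) \<le> len (tgt \<pi>)"
      using max[of e] m by simp
    moreover have "len (tgt \<pi>) \<le> len (tgt e)"
      using len_epi(1)[OF ep] by simp
    ultimately have ip: "iso (p \<cdot> m)"
      using len_epi(2)[OF ep] by simp
    have "inv_arr (p \<cdot> m) \<cdot> \<pi> = e"
      using inv_arr_cancel(1)[OF ip, of e] unfolding pme by simp
    then have "((q \<cdot> m) \<cdot> inv_arr (p \<cdot> m)) \<cdot> \<pi> = g"
      using ip m(6) qf by simp
    then show ?thesis
      using ip by (intro exI[of _ "(q \<cdot> m) \<cdot> inv_arr (p \<cdot> m)"]) simp
  qed
  have "rel_projective D (tgt \<pi>)"
    unfolding rel_projective_def
  proof (intro conjI allI impI)
    fix a f
    assume a: "epi a" "src a \<in> D" "tgt a \<in> D" and f [simp]: "arr f" "src f = tgt \<pi>" "tgt f = tgt a"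
    have [simp]: "arr a"
      using a epi_arr by blast
    have "is_epi C (src a) (tgt a) a" "f \<cdot> \<pi> \<in> Hom C P (tgt a)"
      using a by (simp_all add: is_epi_iff)
    then have "\<exists>g\<in>Hom C P (src a). a \<cdot> g = f \<cdot> \<pi>"
      using P src_Obj[OF \<open>arr a\<close>] tgt_Obj[OF \<open>arr a\<close>] unfolding is_projective_def by blast
    then obtain g where g: "arr g" "src g = P" "tgt g = src a" "a \<cdot> g = f \<cdot> \<pi>"
      by auto
    obtain t where t: "arr t" "src t = tgt \<pi>" "tgt t = src a" "t \<cdot> \<pi> = g"
      using factor[of g] g a by auto
    have "(a \<cdot> t) \<cdot> \<pi> = f \<cdot> \<pi>"
      using g t by simp
    then have "a \<cdot> t = f"
      by (rule epi_cancel[OF \<pi>(1)]) (use t in simp_all)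
    then show "\<exists>g. arr g \<and> src g = tgt \<pi> \<and> tgt g = src a \<and> a \<cdot> g = f"
      using t by blast
  qed (rule \<pi>)
  moreover obtain t where t: "arr t" "src t = tgt \<pi>" "tgt t = Z" "t \<cdot> \<pi> = \<epsilon>"
    using factor[of \<epsilon>] \<epsilon> Z epi_arr by auto
  moreover have "epi t"
    by (rule epi_of_epi_cmp[of _ \<pi>]) (use t \<epsilon> in simp_all)
  ultimately show thesis
    using that[of t] by simp
qed

end

section \<open>Exactness of the tensor product\<close>

context monoidal_category
begin

text \<open>Naturality passes from \<open>\<phi>\<close> to the inverse bijections
  \<open>\<chi>\<close> by the injectivity of \<open>\<phi>\<close>.\<close>

lemma adjunction_inverse:
  assumes "adjunction X V \<phi>"
  obtains \<chi> where
    "\<And>A h. \<lbrakk>arr h; tgt h = V \<otimes>\<^sub>o A; A \<in> Obj C\<rbrakk>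
       \<Longrightarrow> arr (\<chi> A h) \<and> src (\<chi> A h) = X \<otimes>\<^sub>o src h \<and> tgt (\<chi> A h) = A \<and> \<phi> (src h) (\<chi> A h) = h"
    "\<And>a h. \<lbrakk>arr h; arr a; tgt h = V \<otimes>\<^sub>o src a\<rbrakk>
       \<Longrightarrow> \<chi> (tgt a) ((ident C V \<otimes>\<^sub>a a) \<cdot> h) = a \<cdot> \<chi> (src a) h"
    "\<And>A b h. \<lbrakk>arr h; arr b; tgt h = V \<otimes>\<^sub>o A; A \<in> Obj C; tgt b = src h\<rbrakk>
       \<Longrightarrow> \<chi> A (h \<cdot> b) = \<chi> A h \<cdot> (ident C X \<otimes>\<^sub>a b)"
proof -
  note \<phi> = adjunctionD[OF assms]
  note [simp] = \<phi>(1,2)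
  define \<chi> where "\<chi> A h = (SOME f. arr f \<and> src f = X \<otimes>\<^sub>o src h \<and> tgt f = A \<and> \<phi> (src h) f = h)"
    for A h
  have \<chi>: "arr (\<chi> A h) \<and> src (\<chi> A h) = X \<otimes>\<^sub>o src h \<and> tgt (\<chi> A h) = A \<and> \<phi> (src h) (\<chi> A h) = h"
    if "arr h" "tgt h = V \<otimes>\<^sub>o A" "A \<in> Obj C" for A h
    unfolding \<chi>_def by (rule someI_ex, rule \<phi>(5)[OF that])
  show thesis
  proof (rule that[of \<chi>])
    show "\<chi> (tgt a) ((ident C V \<otimes>\<^sub>a a) \<cdot> h) = a \<cdot> \<chi> (src a) h"
      if "arr h" "arr a" "tgt h = V \<otimes>\<^sub>o src a" for a h
    proof (rule \<phi>(4))
      show "\<phi> (src h) (\<chi> (tgt a) ((ident C V \<otimes>\<^sub>a a) \<cdot> h)) = \<phi> (src h) (a \<cdot> \<chi> (src a) h)"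
        using \<chi>[of "(ident C V \<otimes>\<^sub>a a) \<cdot> h" "tgt a"] \<chi>[of h "src a"] that
        by (simp add: \<phi>(6)[of "\<chi> (src a) h" a "src h"])
    qed (use \<chi>[of "(ident C V \<otimes>\<^sub>a a) \<cdot> h" "tgt a"] \<chi>[of h "src a"] that in simp_all)
    show "\<chi> A (h \<cdot> b) = \<chi> A h \<cdot> (ident C X \<otimes>\<^sub>a b)"
      if "arr h" "arr b" "tgt h = V \<otimes>\<^sub>o A" "A \<in> Obj C" "tgt b = src h" for A b h
    proof (rule \<phi>(4))
      show "\<phi> (src b) (\<chi> A (h \<cdot> b)) = \<phi> (src b) (\<chi> A h \<cdot> (ident C X \<otimes>\<^sub>a b))"
        using \<chi>[of "h \<cdot> b" A] \<chi>[of h A] that by (simp add: \<phi>(7)[of "\<chi> A h" b])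
    qed (use \<chi>[of "h \<cdot> b" A] \<chi>[of h A] that in simp_all)
  qed (rule \<chi>)
qed

text \<open>Right adjoints preserve monomorphisms: competing arrows are transposed, \<open>m\<close>
  is cancelled, and the results are transposed back. Dually, the next lemma uses that
  \<open>X \<otimes> _\<close> is a left adjoint.\<close>

lemma adjunction_mono:
  assumes adj: "adjunction X V \<phi>" and m: "mono m"
  shows "mono (ident C V \<otimes>\<^sub>a m)"
  unfolding mono_def
proof (intro conjI allI impI)
  note \<phi> = adjunctionD[OF adj]
  note [simp] = \<phi>(1,2) mono_arr[OF m]
  show "arr (ident C V \<otimes>\<^sub>a m)"
    by simp
  fix g h
  assume gh: "arr g" "arr h" "src g = src h" "tgt g = src (ident C V \<otimes>\<^sub>a m)"
    "tgt h = src (ident C V \<otimes>\<^sub>a m)" "(ident C V \<otimes>\<^sub>a m) \<cdot> g = (ident C V \<otimes>\<^sub>a m) \<cdot> h"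
  obtain g' where g': "arr g'" "src g' = X \<otimes>\<^sub>o src h" "tgt g' = src m" "\<phi> (src h) g' = g"
    using \<phi>(5)[of g "src m"] gh by auto
  obtain h' where h': "arr h'" "src h' = X \<otimes>\<^sub>o src h" "tgt h' = src m" "\<phi> (src h) h' = h"
    using \<phi>(5)[of h "src m"] gh by auto
  have "\<phi> (src h) (m \<cdot> g') = \<phi> (src h) (m \<cdot> h')"
    using \<phi>(6)[of g' m "src h"] \<phi>(6)[of h' m "src h"] g' h' gh(2,6) by simp
  then have "m \<cdot> g' = m \<cdot> h'"
    by (rule \<phi>(4)) (use g' h' gh(2) in simp_all)
  then have "g' = h'"
    by (rule mono_cancel[OF m]) (use g' h' in simp_all)
  then show "g = h"
    using g'(4) h'(4) by simp
qed

lemma adjunction_epi: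
  assumes adj: "adjunction X V \<phi>" and e: "epi e"
  shows "epi (ident C X \<otimes>\<^sub>a e)"
  unfolding epi_def
proof (intro conjI allI impI)
  note \<phi> = adjunctionD[OF adj]
  note [simp] = \<phi>(1,2) epi_arr[OF e]
  show "arr (ident C X \<otimes>\<^sub>a e)"
    by simp
  fix g h
  assume gh: "arr g" "arr h" "tgt g = tgt h" "src g = tgt (ident C X \<otimes>\<^sub>a e)"
    "src h = tgt (ident C X \<otimes>\<^sub>a e)" "g \<cdot> (ident C X \<otimes>\<^sub>a e) = h \<cdot> (ident C X \<otimes>\<^sub>a e)"
  have "\<phi> (tgt e) g \<cdot> e = \<phi> (tgt e) h \<cdot> e"
    using \<phi>(7)[of g e] \<phi>(7)[of h e] gh by simp
  then have "\<phi> (tgt e) g = \<phi> (tgt e) h"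
    by (rule epi_cancel[OF e]) (use \<phi>(3)[of g "tgt e"] \<phi>(3)[of h "tgt e"] gh in simp_all)
  then show "g = h"
    by (rule \<phi>(4)) (use gh in simp_all)
qed

end

section \<open>Regrouping factors with the braiding\<close>

context braided_monoidal_category
begin

text \<open>The adjunctions control only arrows with an identity as left factor; the braiding turns
  \<open>f \<otimes> ident\<close> into such an arrow.\<close>

lemma tensor_factor:
  "\<lbrakk>arr f; arr g\<rbrakk> \<Longrightarrow> f \<otimes>\<^sub>a g = (inv_arr (braiding C (tgt f) (tgt g)) \<cdot> ((ident C (tgt g) \<otimes>\<^sub>a f)
     \<cdot> braiding C (src f) (tgt g))) \<cdot> (ident C (src f) \<otimes>\<^sub>a g)"
  using braiding_nat[of f "ident C (tgt g)", symmetric] by (simp add: interchange)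

text \<open>The braiding of the two middle factors \<open>Y\<close> and \<open>X'\<close>. An
  isomorphism of objects is enough, since the class it is applied to is closed under
  isomorphism.\<close>

lemma iso_obj_tensor_exchange:
  assumes [simp]: "X \<in> Obj C" "Y \<in> Obj C" "X' \<in> Obj C" "Y' \<in> Obj C"
  shows "iso_obj ((X \<otimes>\<^sub>o Y) \<otimes>\<^sub>o (X' \<otimes>\<^sub>o Y')) ((X \<otimes>\<^sub>o X') \<otimes>\<^sub>o (Y \<otimes>\<^sub>o Y'))"
proof -
  have a: "iso_obj ((A \<otimes>\<^sub>o B) \<otimes>\<^sub>o D) (A \<otimes>\<^sub>o (B \<otimes>\<^sub>o D))"
    if "A \<in> Obj C" "B \<in> Obj C" "D \<in> Obj C" for A B D
    unfolding iso_obj_def by (rule exI[of _ "associator C A B D"]) (use that in simp)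
  have c: "iso_obj (Y \<otimes>\<^sub>o X') (X' \<otimes>\<^sub>o Y)"
    unfolding iso_obj_def by (rule exI[of _ "braiding C Y X'"]) simp
  have "iso_obj ((X \<otimes>\<^sub>o Y) \<otimes>\<^sub>o (X' \<otimes>\<^sub>o Y')) (X \<otimes>\<^sub>o (Y \<otimes>\<^sub>o (X' \<otimes>\<^sub>o Y')))"
    by (rule a) simp_all
  also have "iso_obj \<dots> (X \<otimes>\<^sub>o ((Y \<otimes>\<^sub>o X') \<otimes>\<^sub>o Y'))"
    by (intro iso_obj_tensor iso_obj_refl iso_obj_sym[OF a]) simp_all
  also have "iso_obj \<dots> (X \<otimes>\<^sub>o ((X' \<otimes>\<^sub>o Y) \<otimes>\<^sub>o Y'))"
    by (intro iso_obj_tensor iso_obj_refl c) simp_all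
  also have "iso_obj \<dots> (X \<otimes>\<^sub>o (X' \<otimes>\<^sub>o (Y \<otimes>\<^sub>o Y')))"
    by (intro iso_obj_tensor iso_obj_refl a) simp_all
  also have "iso_obj \<dots> ((X \<otimes>\<^sub>o X') \<otimes>\<^sub>o (Y \<otimes>\<^sub>o Y'))"
    by (rule iso_obj_sym[OF a]) simp_all
  finally show ?thesis .
qed

end

text \<open>A symmetric relation, as \<open>X\<close> is a right dual of its left dual. With a
  braiding, either kind of dual gives an adjunction of the same form, and by symmetry also the one
  with \<open>X\<close> and \<open>V\<close> exchanged.\<close>

definition dual_objects where
  "dual_objects C X V \<longleftrightarrow> is_left_dual C X V \<or> is_right_dual C X V"

lemma dual_objects_sym: "dual_objects C X V \<Longrightarrow> dual_objects C V X"
  by (auto simp: dual_objects_def is_right_dual_def)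

section \<open>Exactness in both factors, and duals of quotients and subobjects\<close>

context braided_finite_tensor_category
begin

lemma dual_objects_exist:
  assumes "X \<in> Obj C"
  obtains V where "is_left_dual C X V" "dual_objects C X V"
  using left_dual_exists[OF assms] by (auto simp: dual_objects_def)

lemma dual_adjunction:
  assumes "dual_objects C X V"
  obtains \<phi> where "adjunction X V \<phi>"
  using assms adjunction_of_left_dual adjunction_of_right_dual
  unfolding dual_objects_def is_right_dual_def by blast

lemma dual_objects_Obj:
  "dual_objects C X V \<Longrightarrow> X \<in> Obj C" "dual_objects C X V \<Longrightarrow> V \<in> Obj C"
  by (auto simp: dual_objects_def is_right_dual_def is_left_dual_def)

lemma mono_ident_tensor:
  assumes "X \<in> Obj C" "mono m"
  shows "mono (ident C X \<otimes>\<^sub>a m)"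
proof -
  obtain V where "dual_objects C X V"
    using assms(1) by (rule dual_objects_exist)
  from dual_adjunction[OF dual_objects_sym[OF this]] obtain \<phi> where "adjunction V X \<phi>" .
  then show ?thesis
    using assms(2) by (rule adjunction_mono)
qed

lemma epi_ident_tensor:
  assumes "X \<in> Obj C" "epi e"
  shows "epi (ident C X \<otimes>\<^sub>a e)"
proof -
  obtain V where "dual_objects C X V"
    using assms(1) by (rule dual_objects_exist)
  from dual_adjunction[OF this] obtain \<phi> where "adjunction X V \<phi>" .
  then show ?thesis
    using assms(2) by (rule adjunction_epi)
qed

lemma mono_tensor:
  assumes "mono f" "mono g"
  shows "mono (f \<otimes>\<^sub>a g)"
proof -
  have [simp]: "arr f" "arr g"
    using assms mono_arr by blast+
  show ?thesis
    unfolding tensor_factor[OF \<open>arr f\<close> \<open>arr g\<close>]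
    by (rule mono_cmp[OF mono_cmp[OF iso_mono mono_cmp[OF mono_ident_tensor iso_mono]]
          mono_ident_tensor]) (simp_all add: assms)
qed

lemma epi_tensor:
  assumes "epi f" "epi g"
  shows "epi (f \<otimes>\<^sub>a g)"
proof -
  have [simp]: "arr f" "arr g"
    using assms epi_arr by blast+
  show ?thesis
    unfolding tensor_factor[OF \<open>arr f\<close> \<open>arr g\<close>]
    by (rule epi_cmp[OF epi_cmp[OF iso_epi epi_cmp[OF epi_ident_tensor iso_epi]]
          epi_ident_tensor]) (simp_all add: assms)
qed

lemma tensor_zr [simp]:
  assumes "arr f" "X \<in> Obj C" "Y \<in> Obj C"
  shows "f \<otimes>\<^sub>a zr X Y = zr (src f \<otimes>\<^sub>o X) (tgt f \<otimes>\<^sub>o Y)"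
proof -
  have "f \<otimes>\<^sub>a add (zr X Y) (zr X Y) = add (f \<otimes>\<^sub>a zr X Y) (f \<otimes>\<^sub>a zr X Y)"
    using tensor_add_right[of "src f" "tgt f" X Y f "zr X Y" "zr X Y"] assms
    by (simp add: add_def del: add_zr)
  then have "add (f \<otimes>\<^sub>a zr X Y) (f \<otimes>\<^sub>a zr X Y) = f \<otimes>\<^sub>a zr X Y"
    using assms by simp
  from add_eq_right[OF this] show ?thesis
    using assms by simp
qed

text \<open>\<open>X \<otimes> _\<close> is right adjoint to \<open>V \<otimes> _\<close>, and right
  adjoints preserve kernels: the arrow \<open>g\<close> is transposed, factored through
  \<open>m\<close>, and transposed back.\<close>

lemma kernel_ident_tensor:
  assumes X: "X \<in> Obj C" and K: "kernel c m"
  shows "kernel (ident C X \<otimes>\<^sub>a c) (ident C X \<otimes>\<^sub>a m)"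
  unfolding kernel_def
proof (intro conjI allI impI)
  note k = kernelD[OF K]
  note [simp] = X k(2-4)
  obtain V where "dual_objects C X V"
    using X by (rule dual_objects_exist)
  from dual_adjunction[OF dual_objects_sym[OF this]] obtain \<phi> where "adjunction V X \<phi>" .
  note \<phi> = adjunctionD[OF this]
  note [simp] = \<phi>(1)
  show "mono (ident C X \<otimes>\<^sub>a m)"
    using X k(1) by (rule mono_ident_tensor)
  show "(ident C X \<otimes>\<^sub>a c) \<cdot> (ident C X \<otimes>\<^sub>a m)
    = zr (src (ident C X \<otimes>\<^sub>a m)) (tgt (ident C X \<otimes>\<^sub>a c))"
    by (simp add: interchange k(5))
  fix g
  assume g: "arr g" "tgt g = src (ident C X \<otimes>\<^sub>a c)"
    "(ident C X \<otimes>\<^sub>a c) \<cdot> g = zr (src g) (tgt (ident C X \<otimes>\<^sub>a c))"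
  obtain g' where g': "arr g'" "src g' = V \<otimes>\<^sub>o src g" "tgt g' = src c" "\<phi> (src g) g' = g"
    using \<phi>(5)[of g "src c"] g by auto
  \<comment> \<open>The bijections are not assumed to be additive; that they preserve zero follows
    from naturality along a zero arrow.\<close>
  have z: "\<phi> (src g) (zr (V \<otimes>\<^sub>o src g) (tgt c)) = zr (src g) (X \<otimes>\<^sub>o tgt c)"
    using \<phi>(6)[of "zr (V \<otimes>\<^sub>o src g) (tgt c)" "zr (tgt c) (tgt c)" "src g"]
      \<phi>(3)[of "zr (V \<otimes>\<^sub>o src g) (tgt c)" "src g"] g(1) by simp
  have "c \<cdot> g' = zr (V \<otimes>\<^sub>o src g) (tgt c)"
    by (rule \<phi>(4)[of "src g"]) (use \<phi>(6)[of g' c "src g"] g g' z in simp_all)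
  then obtain u where u: "arr u" "src u = src g'" "tgt u = src m" "m \<cdot> u = g'"
    using k(6)[of g'] g' by auto
  have "(ident C X \<otimes>\<^sub>a m) \<cdot> \<phi> (src g) u = g"
    using \<phi>(6)[of u m "src g"] u g' g(1) by simp
  then show "\<exists>u. arr u \<and> src u = src g \<and> tgt u = src (ident C X \<otimes>\<^sub>a m)
      \<and> (ident C X \<otimes>\<^sub>a m) \<cdot> u = g"
    using \<phi>(3)[of u "src g"] u g' g(1) by (intro exI[of _ "\<phi> (src g) u"]) simp
qed (use X kernelD(2-4)[OF K] in simp_all)

text \<open>With \<open>Z = tgt e\<close> and \<open>W = src e\<close>, an arrow
  \<open>B \<rightarrow> V \<otimes> 1\<close> is the same as an arrow
  \<open>Z \<otimes> B \<rightarrow> 1\<close>; composing with \<open>e \<otimes> B\<close> and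
  transposing gives \<open>B \<rightarrow> W' \<otimes> 1\<close>. The passage is natural in
  \<open>B\<close>, and injective because \<open>e \<otimes> B\<close> is an epimorphism, so Yoneda
  applies. The unit object appears as the second argument of the adjunctions.\<close>

lemma epi_between_duals:
  assumes e: "epi e" and dW: "dual_objects C (src e) W'" and dZ: "dual_objects C (tgt e) V"
  shows "\<exists>u. mono u \<and> src u = V \<otimes>\<^sub>o \<one>\<^sub>o \<and> tgt u = W' \<otimes>\<^sub>o \<one>\<^sub>o"
proof -
  have [simp]: "arr e" "V \<in> Obj C" "W' \<in> Obj C"
    using epi_arr[OF e] dual_objects_Obj(2)[OF dW] dual_objects_Obj(2)[OF dZ] by simp_all
  obtain \<phi> where "adjunction (src e) W' \<phi>"
    using dual_adjunction[OF dW] .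
  note \<phi> = adjunctionD[OF this]
  obtain \<psi> where \<psi>: "adjunction (tgt e) V \<psi>"
    using dual_adjunction[OF dZ] .
  obtain \<chi> where
    \<chi>: "\<And>A h. \<lbrakk>arr h; tgt h = V \<otimes>\<^sub>o A; A \<in> Obj C\<rbrakk> \<Longrightarrow> arr (\<chi> A h)
      \<and> src (\<chi> A h) = tgt e \<otimes>\<^sub>o src h \<and> tgt (\<chi> A h) = A \<and> \<psi> (src h) (\<chi> A h) = h"
    and \<chi>_nat: "\<And>a h. \<lbrakk>arr h; arr a; tgt h = V \<otimes>\<^sub>o src a\<rbrakk>
      \<Longrightarrow> \<chi> (tgt a) ((ident C V \<otimes>\<^sub>a a) \<cdot> h) = a \<cdot> \<chi> (src a) h"
    and \<chi>_nat_src: "\<And>A b h. \<lbrakk>arr h; arr b; tgt h = V \<otimes>\<^sub>o A; A \<in> Obj C; tgt b = src h\<rbrakk>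
      \<Longrightarrow> \<chi> A (h \<cdot> b) = \<chi> A h \<cdot> (ident C (tgt e) \<otimes>\<^sub>a b)"
    by (fact adjunction_inverse[OF \<psi>])
  have et: "epi (e \<otimes>\<^sub>a ident C B)" if "B \<in> Obj C" for B
    using that by (intro epi_tensor[OF e iso_epi]) simp_all
  show ?thesis
  proof (rule mono_of_natural_injection[where \<theta> = "\<lambda>f. \<phi> (src f) (\<chi> \<one>\<^sub>o f \<cdot> (e \<otimes>\<^sub>a ident C (src f)))"])
    fix f assume f: "arr f" "tgt f = V \<otimes>\<^sub>o \<one>\<^sub>o"
    then show "arr (\<phi> (src f) (\<chi> \<one>\<^sub>o f \<cdot> (e \<otimes>\<^sub>a ident C (src f))))
      \<and> src (\<phi> (src f) (\<chi> \<one>\<^sub>o f \<cdot> (e \<otimes>\<^sub>a ident C (src f)))) = src f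
      \<and> tgt (\<phi> (src f) (\<chi> \<one>\<^sub>o f \<cdot> (e \<otimes>\<^sub>a ident C (src f)))) = W' \<otimes>\<^sub>o \<one>\<^sub>o"
      using \<chi>[of f "\<one>\<^sub>o"] \<phi>(3)[of "\<chi> \<one>\<^sub>o f \<cdot> (e \<otimes>\<^sub>a ident C (src f))" "src f"] by simp
    fix b assume b: "arr b" "tgt b = src f"
    have "\<chi> \<one>\<^sub>o (f \<cdot> b) \<cdot> (e \<otimes>\<^sub>a ident C (src b))
      = (\<chi> \<one>\<^sub>o f \<cdot> (e \<otimes>\<^sub>a ident C (src f))) \<cdot> (ident C (src e) \<otimes>\<^sub>a b)"
      using \<chi>[of f "\<one>\<^sub>o"] f b by (simp add: \<chi>_nat_src interchange)
    then show "\<phi> (src (f \<cdot> b)) (\<chi> \<one>\<^sub>o (f \<cdot> b) \<cdot> (e \<otimes>\<^sub>a ident C (src (f \<cdot> b))))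
      = \<phi> (src f) (\<chi> \<one>\<^sub>o f \<cdot> (e \<otimes>\<^sub>a ident C (src f))) \<cdot> b"
      using \<chi>[of f "\<one>\<^sub>o"] f b \<phi>(7)[of "\<chi> \<one>\<^sub>o f \<cdot> (e \<otimes>\<^sub>a ident C (src f))" b] by simp
  next
    fix f g
    assume fg: "arr f" "arr g" "tgt f = V \<otimes>\<^sub>o \<one>\<^sub>o" "tgt g = V \<otimes>\<^sub>o \<one>\<^sub>o" "src f = src g"
      and eq: "\<phi> (src f) (\<chi> \<one>\<^sub>o f \<cdot> (e \<otimes>\<^sub>a ident C (src f)))
        = \<phi> (src g) (\<chi> \<one>\<^sub>o g \<cdot> (e \<otimes>\<^sub>a ident C (src g)))"
    have "\<chi> \<one>\<^sub>o f \<cdot> (e \<otimes>\<^sub>a ident C (src g)) = \<chi> \<one>\<^sub>o g \<cdot> (e \<otimes>\<^sub>a ident C (src g))"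
      by (rule \<phi>(4)[OF eq[unfolded fg(5)]]) (use \<chi>[of f "\<one>\<^sub>o"] \<chi>[of g "\<one>\<^sub>o"] fg in simp_all)
    then have "\<chi> \<one>\<^sub>o f = \<chi> \<one>\<^sub>o g"
      by (rule epi_cancel[OF et, rotated]) (use \<chi>[of f "\<one>\<^sub>o"] \<chi>[of g "\<one>\<^sub>o"] fg in simp_all)
    then show "f = g"
      using \<chi>[of f "\<one>\<^sub>o"] \<chi>[of g "\<one>\<^sub>o"] fg by (metis unit_obj_closed)
  qed simp_all
qed

text \<open>An arrow \<open>W' \<otimes> 1 \<rightarrow> A\<close> becomes in turn
  \<open>1 \<rightarrow> W \<otimes> A\<close>, by composition with \<open>w\<close> an arrow
  \<open>1 \<rightarrow> X \<otimes> (Y \<otimes> A)\<close>, then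
  \<open>X' \<otimes> 1 \<rightarrow> Y \<otimes> A\<close>, and finally
  \<open>Y' \<otimes> (X' \<otimes> 1) \<rightarrow> A\<close>; here \<open>W = src w\<close>, and
  \<open>\<beta>\<close> and \<open>\<gamma>\<close> are the two middle stages. All is natural in
  \<open>A\<close>, and injective because \<open>w \<otimes> A\<close> is a monomorphism. Treating
  the factors one by one avoids a choice of dual for \<open>X \<otimes> Y\<close>.\<close>

lemma mono_between_duals:
  assumes w: "mono w" "tgt w = X \<otimes>\<^sub>o Y" and dW: "dual_objects C (src w) W'"
    and dX: "dual_objects C X X'" and dY: "dual_objects C Y Y'"
  shows "\<exists>u. epi u \<and> src u = Y' \<otimes>\<^sub>o (X' \<otimes>\<^sub>o \<one>\<^sub>o) \<and> tgt u = W' \<otimes>\<^sub>o \<one>\<^sub>o"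
proof -
  have [simp]: "arr w" "tgt w = X \<otimes>\<^sub>o Y" "W' \<in> Obj C" "X \<in> Obj C" "X' \<in> Obj C" "Y \<in> Obj C" "Y' \<in> Obj C"
    using mono_arr[OF w(1)] w(2) dual_objects_Obj[OF dW] dual_objects_Obj[OF dX]
      dual_objects_Obj[OF dY] by simp_all
  obtain \<phi> where "adjunction W' (src w) \<phi>"
    using dual_adjunction[OF dual_objects_sym[OF dW]] .
  note \<phi> = adjunctionD[OF this]
  obtain \<psi> where \<psi>: "adjunction X' X \<psi>"
    using dual_adjunction[OF dual_objects_sym[OF dX]] .
  obtain \<chi> where
    \<chi>: "\<And>A h. \<lbrakk>arr h; tgt h = X \<otimes>\<^sub>o A; A \<in> Obj C\<rbrakk> \<Longrightarrow> arr (\<chi> A h)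
      \<and> src (\<chi> A h) = X' \<otimes>\<^sub>o src h \<and> tgt (\<chi> A h) = A \<and> \<psi> (src h) (\<chi> A h) = h"
    and \<chi>_nat: "\<And>a h. \<lbrakk>arr h; arr a; tgt h = X \<otimes>\<^sub>o src a\<rbrakk>
      \<Longrightarrow> \<chi> (tgt a) ((ident C X \<otimes>\<^sub>a a) \<cdot> h) = a \<cdot> \<chi> (src a) h"
    and \<chi>_nat_src: "\<And>A b h. \<lbrakk>arr h; arr b; tgt h = X \<otimes>\<^sub>o A; A \<in> Obj C; tgt b = src h\<rbrakk>
      \<Longrightarrow> \<chi> A (h \<cdot> b) = \<chi> A h \<cdot> (ident C (X') \<otimes>\<^sub>a b)"
    by (fact adjunction_inverse[OF \<psi>])
  obtain \<psi>' where \<psi>': "adjunction Y' Y \<psi>'"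
    using dual_adjunction[OF dual_objects_sym[OF dY]] .
  obtain \<chi>' where
    \<chi>': "\<And>A h. \<lbrakk>arr h; tgt h = Y \<otimes>\<^sub>o A; A \<in> Obj C\<rbrakk> \<Longrightarrow> arr (\<chi>' A h)
      \<and> src (\<chi>' A h) = Y' \<otimes>\<^sub>o src h \<and> tgt (\<chi>' A h) = A \<and> \<psi>' (src h) (\<chi>' A h) = h"
    and \<chi>'_nat: "\<And>a h. \<lbrakk>arr h; arr a; tgt h = Y \<otimes>\<^sub>o src a\<rbrakk>
      \<Longrightarrow> \<chi>' (tgt a) ((ident C Y \<otimes>\<^sub>a a) \<cdot> h) = a \<cdot> \<chi>' (src a) h"
    and \<chi>'_nat_src: "\<And>A b h. \<lbrakk>arr h; arr b; tgt h = Y \<otimes>\<^sub>o A; A \<in> Obj C; tgt b = src h\<rbrakk>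
      \<Longrightarrow> \<chi>' A (h \<cdot> b) = \<chi>' A h \<cdot> (ident C (Y') \<otimes>\<^sub>a b)"
    by (fact adjunction_inverse[OF \<psi>'])
  define \<beta> where "\<beta> f = associator C X Y (tgt f) \<cdot> ((w \<otimes>\<^sub>a ident C (tgt f)) \<cdot> \<phi> \<one>\<^sub>o f)" for f
  have \<beta>: "arr (\<beta> f) \<and> src (\<beta> f) = \<one>\<^sub>o \<and> tgt (\<beta> f) = X \<otimes>\<^sub>o (Y \<otimes>\<^sub>o tgt f)"
    if "arr f" "src f = W' \<otimes>\<^sub>o \<one>\<^sub>o" for f
    using \<phi>(3)[of f "\<one>\<^sub>o"] that by (simp add: \<beta>_def)
  define \<gamma> where "\<gamma> f = \<chi> (Y \<otimes>\<^sub>o tgt f) (\<beta> f)" for f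
  have \<gamma>: "arr (\<gamma> f) \<and> src (\<gamma> f) = X' \<otimes>\<^sub>o \<one>\<^sub>o \<and> tgt (\<gamma> f) = Y \<otimes>\<^sub>o tgt f"
    if "arr f" "src f = W' \<otimes>\<^sub>o \<one>\<^sub>o" for f
    using \<chi>[of "\<beta> f" "Y \<otimes>\<^sub>o tgt f"] \<beta>[OF that] that by (simp add: \<gamma>_def)
  show ?thesis
  proof (rule epi_of_natural_injection[where \<theta> = "\<lambda>f. \<chi>' (tgt f) (\<gamma> f)"])
    fix f assume f: "arr f" "src f = W' \<otimes>\<^sub>o \<one>\<^sub>o"
    then show "arr (\<chi>' (tgt f) (\<gamma> f)) \<and> src (\<chi>' (tgt f) (\<gamma> f)) = Y' \<otimes>\<^sub>o (X' \<otimes>\<^sub>o \<one>\<^sub>o)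
      \<and> tgt (\<chi>' (tgt f) (\<gamma> f)) = tgt f"
      using \<chi>'[of "\<gamma> f" "tgt f"] \<gamma>[OF f] by simp
    fix a assume a: "arr a" "src a = tgt f"
    have "\<beta> (a \<cdot> f) = associator C X Y (tgt a) \<cdot> ((((ident C X \<otimes>\<^sub>a ident C Y) \<otimes>\<^sub>a a)
        \<cdot> (w \<otimes>\<^sub>a ident C (tgt f))) \<cdot> \<phi> \<one>\<^sub>o f)"
      using \<phi>(3)[of f "\<one>\<^sub>o"] \<phi>(6)[of f a "\<one>\<^sub>o"] f a
      by (simp add: \<beta>_def interchange interchange_reassoc)
    also have "\<dots> = (ident C X \<otimes>\<^sub>a (ident C Y \<otimes>\<^sub>a a)) \<cdot> \<beta> f"
      using \<phi>(3)[of f "\<one>\<^sub>o"] f a cmp_reassoc[OF associator_nat[of "ident C X" "ident C Y" a],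
          of "(w \<otimes>\<^sub>a ident C (tgt f)) \<cdot> \<phi> \<one>\<^sub>o f"]
      by (simp add: \<beta>_def)
    finally have "\<gamma> (a \<cdot> f) = (ident C Y \<otimes>\<^sub>a a) \<cdot> \<gamma> f"
      using \<chi>_nat[of "\<beta> f" "ident C Y \<otimes>\<^sub>a a"] \<beta>[OF f] f a by (simp add: \<gamma>_def)
    then show "\<chi>' (tgt (a \<cdot> f)) (\<gamma> (a \<cdot> f)) = a \<cdot> \<chi>' (tgt f) (\<gamma> f)"
      using \<chi>'_nat[of "\<gamma> f" a] \<gamma>[OF f] f a by simp
  next
    fix f g
    assume fg: "arr f" "arr g" "src f = W' \<otimes>\<^sub>o \<one>\<^sub>o" "src g = W' \<otimes>\<^sub>o \<one>\<^sub>o" "tgt f = tgt g"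
      and eq: "\<chi>' (tgt f) (\<gamma> f) = \<chi>' (tgt g) (\<gamma> g)"
    have \<phi>fg: "arr (\<phi> \<one>\<^sub>o h) \<and> src (\<phi> \<one>\<^sub>o h) = \<one>\<^sub>o \<and> tgt (\<phi> \<one>\<^sub>o h) = src w \<otimes>\<^sub>o tgt g"
      if "h = f \<or> h = g" for h
      using \<phi>(3)[of h "\<one>\<^sub>o"] fg that by auto
    have "\<gamma> f = \<psi>' (src (\<gamma> f)) (\<chi>' (tgt f) (\<gamma> f))"
      using \<chi>'[of "\<gamma> f" "tgt f"] \<gamma>[of f] fg by simp
    also have "\<dots> = \<psi>' (src (\<gamma> g)) (\<chi>' (tgt g) (\<gamma> g))"
      using eq \<gamma>[of f] \<gamma>[of g] fg by simp
    also have "\<dots> = \<gamma> g"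
      using \<chi>'[of "\<gamma> g" "tgt g"] \<gamma>[of g] fg by simp
    finally have \<gamma>eq: "\<gamma> f = \<gamma> g" .
    have "\<beta> f = \<psi> \<one>\<^sub>o (\<gamma> f)"
      using \<chi>[of "\<beta> f" "Y \<otimes>\<^sub>o tgt f"] \<beta>[of f] fg by (simp add: \<gamma>_def)
    also have "\<dots> = \<beta> g"
      using \<chi>[of "\<beta> g" "Y \<otimes>\<^sub>o tgt g"] \<beta>[of g] fg \<gamma>eq by (simp add: \<gamma>_def)
    finally have "associator C X Y (tgt g) \<cdot> ((w \<otimes>\<^sub>a ident C (tgt g)) \<cdot> \<phi> \<one>\<^sub>o f)
      = associator C X Y (tgt g) \<cdot> ((w \<otimes>\<^sub>a ident C (tgt g)) \<cdot> \<phi> \<one>\<^sub>o g)"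
      using fg by (simp add: \<beta>_def)
    then have "(w \<otimes>\<^sub>a ident C (tgt g)) \<cdot> \<phi> \<one>\<^sub>o f = (w \<otimes>\<^sub>a ident C (tgt g)) \<cdot> \<phi> \<one>\<^sub>o g"
      by (rule mono_cancel[OF iso_mono, rotated]) (use \<phi>fg[of f] \<phi>fg[of g] fg in simp_all)
    then have "\<phi> \<one>\<^sub>o f = \<phi> \<one>\<^sub>o g"
      by (rule mono_cancel[OF mono_tensor[OF w(1) iso_mono], rotated])
        (use \<phi>fg[of f] \<phi>fg[of g] fg in simp_all)
    then show "f = g"
      by (rule \<phi>(4)) (use fg in simp_all)
  qed simp_all
qed

end

section \<open>The join of two tensor subcategories\<close>

context braided_finite_tensor_category
begin

lemma subcategory_Obj: "\<lbrakk>tensor_subcategory C D; X \<in> D\<rbrakk> \<Longrightarrow> X \<in> Obj C"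
  using tensor_subcategory.subset by blast

lemma subcategory_mono: "\<lbrakk>tensor_subcategory C D; mono m; tgt m \<in> D\<rbrakk> \<Longrightarrow> src m \<in> D"
  by (rule tensor_subcategory.subobject_mem[of C D "tgt m" "src m" m])
    (simp_all add: is_mono_iff mono_arr)

lemma subcategory_epi: "\<lbrakk>tensor_subcategory C D; epi e; src e \<in> D\<rbrakk> \<Longrightarrow> tgt e \<in> D"
  by (rule tensor_subcategory.quotient_mem[of C D "src e" "tgt e" e])
    (simp_all add: is_epi_iff epi_arr)

lemma subcategory_dual: "\<lbrakk>tensor_subcategory C D; dual_objects C X V; X \<in> D\<rbrakk> \<Longrightarrow> V \<in> D"
  unfolding dual_objects_def
  using tensor_subcategory.left_dual_mem tensor_subcategory.right_dual_mem by metis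

text \<open>After a braiding, a lifting problem for \<open>P \<otimes> Q\<close> along
  \<open>a\<close> transposes to one for \<open>P\<close> along
  \<open>ident C U \<otimes>\<^sub>a a\<close>. The latter is again an epimorphism between objects
  of \<open>D\<close>, because the dual \<open>U\<close> of \<open>Q\<close> lies in
  \<open>D\<close>.\<close>

lemma rel_projective_tensor:
  assumes D: "tensor_subcategory C D" and P: "rel_projective D P" and Q: "Q \<in> D"
  shows "rel_projective D (P \<otimes>\<^sub>o Q)"
  unfolding rel_projective_def
proof (intro conjI allI impI)
  have PD: "P \<in> D"
    using P by (simp add: rel_projective_def)
  then show "P \<otimes>\<^sub>o Q \<in> D"
    using D Q tensor_subcategory.tensor_mem by metis
  have [simp]: "P \<in> Obj C" "Q \<in> Obj C"
    using D PD Q subcategory_Obj by blast+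
  obtain U where U: "dual_objects C Q U"
    using dual_objects_exist[of Q] by auto
  obtain \<phi> where "adjunction Q U \<phi>"
    using dual_adjunction[OF U] .
  note \<phi> = adjunctionD[OF this]
  note [simp] = \<phi>(2)
  have UD: "U \<in> D"
    using D U Q by (rule subcategory_dual)
  fix a f
  assume a: "epi a" "src a \<in> D" "tgt a \<in> D"
    and f: "arr f" "src f = P \<otimes>\<^sub>o Q" "tgt f = tgt a"
  have [simp]: "arr a"
    using a epi_arr by blast
  let ?f = "f \<cdot> braiding C Q P"
  have f': "arr ?f" "src ?f = Q \<otimes>\<^sub>o P" "tgt ?f = tgt a"
    using f by simp_all
  have "\<exists>g. arr g \<and> src g = P \<and> tgt g = src (ident C U \<otimes>\<^sub>a a) \<and> (ident C U \<otimes>\<^sub>a a) \<cdot> g = \<phi> P ?f"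
  proof (rule rel_projectiveD[OF P])
    show "epi (ident C U \<otimes>\<^sub>a a)"
      using a by (intro epi_ident_tensor) simp_all
  qed (use a UD D f' \<phi>(3)[of ?f P] in \<open>simp_all add: tensor_subcategory.tensor_mem\<close>)
  then obtain g where g: "arr g" "src g = P" "tgt g = U \<otimes>\<^sub>o src a" "(ident C U \<otimes>\<^sub>a a) \<cdot> g = \<phi> P ?f"
    by auto
  obtain g' where g': "arr g'" "src g' = Q \<otimes>\<^sub>o P" "tgt g' = src a" "\<phi> P g' = g"
    using \<phi>(5)[of g "src a"] g by auto
  have "\<phi> P (a \<cdot> g') = \<phi> P ?f"
    using \<phi>(6)[of g' a P] g g' by simp
  then have "a \<cdot> g' = ?f"
    by (rule \<phi>(4)) (use f' g' in simp_all)
  then have "a \<cdot> (g' \<cdot> inv_arr (braiding C Q P)) = f"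
    using f g' cmp_reassoc[of a g' ?f "inv_arr (braiding C Q P)"] by simp
  then show "\<exists>g. arr g \<and> src g = P \<otimes>\<^sub>o Q \<and> tgt g = src a \<and> a \<cdot> g = f"
    using g' by (intro exI[of _ "g' \<cdot> inv_arr (braiding C Q P)"]) simp
qed

text \<open>Relatively projective objects are relatively injective. Tensoring the cokernel of \<open>m\<close> with
  \<open>P\<close> makes it projective, hence makes \<open>m\<close> split; and \<open>P\<close> is a natural retract of
  \<open>P \<otimes> (V \<otimes> P)\<close> for the dual \<open>V\<close> of \<open>P\<close>.\<close>

lemma rel_projective_mono_splits:
  assumes D: "tensor_subcategory C D" and P: "rel_projective D (src m)" and m: "mono m"
    and T: "tgt m \<in> D"
  obtains r where "arr r" "src r = tgt m" "tgt r = src m" "r \<cdot> m = ident C (src m)"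
proof -
  define P where "P = src m"
  have PD: "P \<in> D"
    using assms(2) by (simp add: rel_projective_def P_def)
  have [simp]: "arr m" "src m = P" "P \<in> Obj C"
    using mono_arr[OF m] by (simp_all add: P_def)
  obtain V where V: "dual_objects C P V"
    using dual_objects_exist[of P] by auto
  have VD: "V \<in> D"
    using D V PD by (rule subcategory_dual)
  have [simp]: "V \<in> Obj C"
    using V by (rule dual_objects_Obj)
  obtain \<phi> where \<phi>: "adjunction V P \<phi>"
    using dual_adjunction[OF dual_objects_sym[OF V]] .
  note \<phi>' = adjunctionD[OF \<phi>]
  obtain c where c: "cokernel m c"
    using ex_cokernel[of m] by auto
  have K: "kernel c m"
    using m c by (rule mono_kernel_of_cokernel)
  note c = cokernelD[OF c]
  note [simp] = c(2,4)
  have RD: "tgt c \<in> D"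
    using subcategory_epi[OF D c(1)] T by simp
  define F where "F f = ident C P \<otimes>\<^sub>a (ident C V \<otimes>\<^sub>a f)" for f
  have F [simp]: "arr (F f)" "src (F f) = P \<otimes>\<^sub>o (V \<otimes>\<^sub>o src f)" "tgt (F f) = P \<otimes>\<^sub>o (V \<otimes>\<^sub>o tgt f)"
    if "arr f" for f
    using that by (simp_all add: F_def)
  have "kernel (F c) (F m)"
    unfolding F_def by (intro kernel_ident_tensor K) simp_all
  note FK = kernelD[OF this]
  have "epi (F c)"
    unfolding F_def using c(1) by (intro epi_ident_tensor) simp_all
  moreover have "rel_projective D (P \<otimes>\<^sub>o (V \<otimes>\<^sub>o tgt c))"
    using assms(2) D VD RD
    by (intro rel_projective_tensor[OF D]) (simp_all add: tensor_subcategory.tensor_mem)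
  moreover have "P \<otimes>\<^sub>o (V \<otimes>\<^sub>o A) \<in> D" if "A \<in> D" for A
    using that PD VD by (intro tensor_subcategory.tensor_mem[OF D])
  ultimately have "\<exists>s. arr s \<and> src s = P \<otimes>\<^sub>o (V \<otimes>\<^sub>o tgt c) \<and> tgt s = src (F c)
      \<and> F c \<cdot> s = ident C (P \<otimes>\<^sub>o (V \<otimes>\<^sub>o tgt c))"
    using T RD by (intro rel_projectiveD) simp_all
  then obtain s where s: "arr s" "src s = P \<otimes>\<^sub>o (V \<otimes>\<^sub>o tgt c)" "tgt s = P \<otimes>\<^sub>o (V \<otimes>\<^sub>o tgt m)"
      "F c \<cdot> s = ident C (P \<otimes>\<^sub>o (V \<otimes>\<^sub>o tgt c))"
    by auto
  note [simp] = s(1-3)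
  \<comment> \<open>The section \<open>s\<close> of \<open>F c\<close> yields a retraction of
    \<open>F m\<close>: the identity minus \<open>s \<cdot> F c\<close> is killed by
    \<open>F c\<close>, so it factors through the kernel \<open>F m\<close>.\<close>
  let ?I = "ident C (P \<otimes>\<^sub>o (V \<otimes>\<^sub>o tgt m))"
  obtain d where d: "arr d" "src d = P \<otimes>\<^sub>o (V \<otimes>\<^sub>o tgt m)" "tgt d = P \<otimes>\<^sub>o (V \<otimes>\<^sub>o tgt m)"
      "add d (s \<cdot> F c) = ?I"
    using difference_exists[of ?I "s \<cdot> F c"] by auto
  note [simp] = d(1-3)
  have "add (F c \<cdot> d) (F c) = F c \<cdot> add d (s \<cdot> F c)"
    using cmp_reassoc[OF s(4), of "F c"] by simp
  also have "\<dots> = F c"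
    unfolding d(4) by simp
  finally have "F c \<cdot> d = zr (src d) (tgt (F c))"
    using add_eq_right[of "F c \<cdot> d" "F c"] by simp
  then obtain r where r: "arr r" "src r = src d" "tgt r = src (F m)" "F m \<cdot> r = d"
    using FK(6)[of d] by auto
  have "F m \<cdot> (r \<cdot> F m) = d \<cdot> F m"
    using cmp_reassoc[OF r(4), of "F m"] r(1-3) by simp
  also have "\<dots> = add (d \<cdot> F m) ((s \<cdot> F c) \<cdot> F m)"
    by (simp add: FK(5))
  also have "\<dots> = add d (s \<cdot> F c) \<cdot> F m"
    by simp
  also have "\<dots> = F m \<cdot> ident C (src (F m))"
    unfolding d(4) by simp
  finally have rF: "r \<cdot> F m = ident C (src (F m))"
    by (rule mono_cancel[OF FK(1)]) (use r in simp_all)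
  define \<eta> where "\<eta> B = \<phi> B (ident C (V \<otimes>\<^sub>o B))" for B
  have \<eta> [simp]: "arr (\<eta> B)" "src (\<eta> B) = B" "tgt (\<eta> B) = P \<otimes>\<^sub>o (V \<otimes>\<^sub>o B)" if "B \<in> Obj C" for B
    using \<phi>'(3)[of "ident C (V \<otimes>\<^sub>o B)" B] that by (simp_all add: \<eta>_def)
  have \<eta>m: "\<eta> (tgt m) \<cdot> m = F m \<cdot> \<eta> P"
    using \<phi>'(7)[of "ident C (V \<otimes>\<^sub>o tgt m)" m] \<phi>'(6)[of "ident C (V \<otimes>\<^sub>o P)" "ident C V \<otimes>\<^sub>a m" P]
    by (simp add: \<eta>_def F_def)
  \<comment> \<open>The evaluation of \<open>V\<close>, recovered as the arrow with transpose
    \<open>inv_arr (right_unitor C P)\<close>. Naturality then makes \<open>?q\<close> a retraction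
    of the unit \<open>\<eta> P\<close>.\<close>
  obtain \<epsilon> where \<epsilon>: "arr \<epsilon>" "src \<epsilon> = V \<otimes>\<^sub>o P" "tgt \<epsilon> = \<one>\<^sub>o" "\<phi> P \<epsilon> = inv_arr (right_unitor C P)"
    using \<phi>'(5)[of "inv_arr (right_unitor C P)" "\<one>\<^sub>o"] by auto
  let ?q = "right_unitor C P \<cdot> (ident C P \<otimes>\<^sub>a \<epsilon>)"
  have "(ident C P \<otimes>\<^sub>a \<epsilon>) \<cdot> \<eta> P = inv_arr (right_unitor C P)"
    using \<phi>'(6)[of "ident C (V \<otimes>\<^sub>o P)" \<epsilon> P] \<epsilon> by (simp add: \<eta>_def)
  then have q\<eta>: "?q \<cdot> \<eta> P = ident C P"
    using \<epsilon>(1-3) by simp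
  have "(?q \<cdot> (r \<cdot> \<eta> (tgt m))) \<cdot> m = ?q \<cdot> ((r \<cdot> F m) \<cdot> \<eta> P)"
    using \<epsilon>(1-3) r \<eta>m by simp
  also have "\<dots> = ident C P"
    unfolding rF using q\<eta> \<epsilon>(1-3) by simp
  finally show thesis
    using that[of "?q \<cdot> (r \<cdot> \<eta> (tgt m))"] r \<epsilon>(1-3) by simp
qed

section \<open>Direct sums of epimorphisms and of monomorphisms\<close>

lemma direct_sum_epi:
  assumes S: "is_direct_sum C (src e) (src e') U" "is_direct_sum C (tgt e) (tgt e') S"
    and e: "epi e" "epi e'"
  shows "\<exists>g. epi g \<and> src g = U \<and> tgt g = S"
proof -
  have [simp]: "arr e" "arr e'"
    using e epi_arr by blast+
  obtain i j p q where ij [simp]: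
    "arr i" "src i = src e" "tgt i = U" "arr j" "src j = src e'" "tgt j = U"
    "arr p" "src p = U" "tgt p = src e" "arr q" "src q = U" "tgt q = src e'"
    and eqs: "p \<cdot> i = ident C (src e)" "q \<cdot> j = ident C (src e')" "p \<cdot> j = zr (src e') (src e)"
      "q \<cdot> i = zr (src e) (src e')" "add (i \<cdot> p) (j \<cdot> q) = ident C U"
    by (rule direct_sumE[OF S(1)]) simp_all
  obtain i' j' p' q' where ij' [simp]:
    "arr i'" "src i' = tgt e" "tgt i' = S" "arr j'" "src j' = tgt e'" "tgt j' = S"
    "arr p'" "src p' = S" "tgt p' = tgt e" "arr q'" "src q' = S" "tgt q' = tgt e'"
    and eqs': "p' \<cdot> i' = ident C (tgt e)" "q' \<cdot> j' = ident C (tgt e')" "p' \<cdot> j' = zr (tgt e') (tgt e)"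
      "q' \<cdot> i' = zr (tgt e) (tgt e')" "add (i' \<cdot> p') (j' \<cdot> q') = ident C S"
    by (rule direct_sumE[OF S(2)]) simp_all
  let ?g = "add (i' \<cdot> (e \<cdot> p)) (j' \<cdot> (e' \<cdot> q))"
  have [simp]: "U \<in> Obj C" "S \<in> Obj C"
    using ij ij' by (metis tgt_Obj)+
  have "epi ?g"
  proof (rule epiI_zr)
    fix h
    assume h: "arr h" "src h = tgt ?g" "h \<cdot> ?g = zr (src ?g) (tgt h)"
    then have [simp]: "src h = S"
      by simp
    have "?g \<cdot> i = i' \<cdot> e" "?g \<cdot> j = j' \<cdot> e'"
      by (simp_all add: eqs)
    moreover have "h \<cdot> (?g \<cdot> i) = zr (src e) (tgt h)" "h \<cdot> (?g \<cdot> j) = zr (src e') (tgt h)"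
      using cmp_reassoc[OF h(3), of i] cmp_reassoc[OF h(3), of j] h(1) by simp_all
    ultimately have "(h \<cdot> i') \<cdot> e = zr (src e) (tgt h)" "(h \<cdot> j') \<cdot> e' = zr (src e') (tgt h)"
      using h(1) by simp_all
    then have "h \<cdot> i' = zr (tgt e) (tgt h)" "h \<cdot> j' = zr (tgt e') (tgt h)"
      using epi_zrD[OF e(1), of "h \<cdot> i'"] epi_zrD[OF e(2), of "h \<cdot> j'"] h(1) by simp_all
    then have "h \<cdot> add (i' \<cdot> p') (j' \<cdot> q') = zr S (tgt h)"
      using h(1) cmp_reassoc[of h i' _ p'] cmp_reassoc[of h j' _ q'] by simp
    then show "h = zr (tgt ?g) (tgt h)"
      unfolding eqs' using h(1) by simp
  qed simp
  then show ?thesis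
    by (intro exI[of _ ?g]) simp
qed

text \<open>\<open>B\<close> only has to contain the two targets as mutually orthogonal retracts. It
  need not be their direct sum, just as \<open>(X \<oplus> X') \<otimes> (Y \<oplus> Y')\<close> is
  larger than the sum of \<open>X \<otimes> Y\<close> and \<open>X' \<otimes> Y'\<close>.\<close>

lemma direct_sum_mono:
  assumes S: "is_direct_sum C (src w) (src w') U" and w: "mono w" "mono w'"
    and ab: "arr a" "src a = tgt w" "tgt a = B" "arr b" "src b = tgt w'" "tgt b = B"
      "arr a'" "src a' = B" "tgt a' = tgt w" "arr b'" "src b' = B" "tgt b' = tgt w'"
    and abeq: "a' \<cdot> a = ident C (tgt w)" "b' \<cdot> b = ident C (tgt w')"
      "a' \<cdot> b = zr (tgt w') (tgt w)" "b' \<cdot> a = zr (tgt w) (tgt w')"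
  shows "\<exists>v. mono v \<and> src v = U \<and> tgt v = B"
proof -
  note [simp] = ab
  have [simp]: "arr w" "arr w'"
    using w mono_arr by blast+
  obtain i j p q where ij [simp]:
    "arr i" "src i = src w" "tgt i = U" "arr j" "src j = src w'" "tgt j = U"
    "arr p" "src p = U" "tgt p = src w" "arr q" "src q = U" "tgt q = src w'"
    and eqs: "p \<cdot> i = ident C (src w)" "q \<cdot> j = ident C (src w')" "p \<cdot> j = zr (src w') (src w)"
      "q \<cdot> i = zr (src w) (src w')" "add (i \<cdot> p) (j \<cdot> q) = ident C U"
    by (rule direct_sumE[OF S]) simp_all
  have [simp]: "U \<in> Obj C"
    using ij by (metis tgt_Obj)
  let ?v = "add (a \<cdot> (w \<cdot> p)) (b \<cdot> (w' \<cdot> q))"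
  have "mono ?v"
  proof (rule monoI_zr)
    fix h
    assume h: "arr h" "tgt h = src ?v" "?v \<cdot> h = zr (src h) (tgt ?v)"
    then have [simp]: "tgt h = U"
      by simp
    have "a' \<cdot> ?v = w \<cdot> p" "b' \<cdot> ?v = w' \<cdot> q"
      using cmp_reassoc[OF abeq(1), of "w \<cdot> p"] cmp_reassoc[OF abeq(2), of "w' \<cdot> q"]
        cmp_reassoc[OF abeq(3), of "w' \<cdot> q"] cmp_reassoc[OF abeq(4), of "w \<cdot> p"] by simp_all
    moreover have "a' \<cdot> (?v \<cdot> h) = zr (src h) (tgt w)" "b' \<cdot> (?v \<cdot> h) = zr (src h) (tgt w')"
      unfolding h(3) using h(1) by simp_all
    moreover have "(a' \<cdot> ?v) \<cdot> h = a' \<cdot> (?v \<cdot> h)" "(b' \<cdot> ?v) \<cdot> h = b' \<cdot> (?v \<cdot> h)"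
      by (rule assoc; simp add: h(1))+
    ultimately have "w \<cdot> (p \<cdot> h) = zr (src h) (tgt w)" "w' \<cdot> (q \<cdot> h) = zr (src h) (tgt w')"
      using h(1) by (simp_all del: add_cmp cmp_add)
    then have "p \<cdot> h = zr (src h) (src w)" "q \<cdot> h = zr (src h) (src w')"
      using mono_zrD[OF w(1), of "p \<cdot> h"] mono_zrD[OF w(2), of "q \<cdot> h"] h(1) by simp_all
    then have "add (i \<cdot> p) (j \<cdot> q) \<cdot> h = zr (src h) U"
      using h(1) by simp
    then show "h = zr (src h) (src ?v)"
      unfolding eqs using h(1) by simp
  qed simp
  then show ?thesis
    by (intro exI[of _ ?v]) simp
qed

section \<open>Subquotients of the products of two classes of objects\<close>

definition subquotients where
  "subquotients D E = {Z. \<exists>X\<in>D. \<exists>Y\<in>E. \<exists>w e. mono w \<and> epi e \<and> tgt w = X \<otimes>\<^sub>o Y \<and> src e = src w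
     \<and> tgt e = Z}"

lemma subquotientsI:
  "\<lbrakk>X \<in> D; Y \<in> E; mono w; epi e; tgt w = X \<otimes>\<^sub>o Y; src e = src w\<rbrakk> \<Longrightarrow> tgt e \<in> subquotients D E"
  unfolding subquotients_def by blast

lemma subquotientsE:
  assumes "Z \<in> subquotients D E"
  obtains X Y w e where "X \<in> D" "Y \<in> E" "mono w" "epi e" "tgt w = X \<otimes>\<^sub>o Y" "src e = src w" "tgt e = Z"
  using assms unfolding subquotients_def by blast

lemma subquotients_epi:
  assumes "epi p" "src p \<in> subquotients D E"
  shows "tgt p \<in> subquotients D E"
proof -
  obtain X Y w e where h: "X \<in> D" "Y \<in> E" "mono w" "epi e" "tgt w = X \<otimes>\<^sub>o Y" "src e = src w"
    "tgt e = src p"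
    using assms(2) by (rule subquotientsE)
  have [simp]: "arr e" "arr p"
    using h assms epi_arr by blast+
  have "tgt (p \<cdot> e) \<in> subquotients D E"
    using h by (intro subquotientsI[OF h(1-3)] epi_cmp[OF assms(1) h(4)]) simp_all
  then show ?thesis
    using h by simp
qed

text \<open>A subobject of a quotient of \<open>src w\<close> is a quotient of its preimage there,
  and the preimage is again a subobject of \<open>X \<otimes> Y\<close>.\<close>

lemma subquotients_mono:
  assumes "mono m" "tgt m \<in> subquotients D E"
  shows "src m \<in> subquotients D E"
proof -
  obtain X Y w e where h: "X \<in> D" "Y \<in> E" "mono w" "epi e" "tgt w = X \<otimes>\<^sub>o Y" "src e = src w"
    "tgt e = tgt m"
    using assms(2) by (rule subquotientsE)
  obtain w' e' where h': "mono w'" "epi e'" "tgt w' = src e" "src w' = src e'" "tgt e' = src m"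
    using epi_pullback_mono[OF h(4) assms(1)] h(7) by metis
  have [simp]: "arr w" "arr w'"
    using h h' mono_arr by blast+
  have "tgt e' \<in> subquotients D E"
    by (rule subquotientsI[OF h(1,2) mono_cmp[OF h(3) h'(1)] h'(2)]) (use h h' in simp_all)
  then show ?thesis
    using h' by simp
qed

lemma subquotients_iso: "\<lbrakk>iso_obj X Y; X \<in> subquotients D E\<rbrakk> \<Longrightarrow> Y \<in> subquotients D E"
  unfolding iso_obj_def using subquotients_epi iso_epi by blast

lemma tensor_in_subquotients:
  assumes "X \<in> D" "Y \<in> E" "X \<in> Obj C" "Y \<in> Obj C"
  shows "X \<otimes>\<^sub>o Y \<in> subquotients D E"
  using subquotientsI[of X D Y E "ident C (X \<otimes>\<^sub>o Y)" "ident C (X \<otimes>\<^sub>o Y)"] assms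
  by (simp add: iso_mono iso_epi)

lemma unitor_iso_obj: "X \<in> Obj C \<Longrightarrow> iso_obj (X \<otimes>\<^sub>o \<one>\<^sub>o) X" "X \<in> Obj C \<Longrightarrow> iso_obj (\<one>\<^sub>o \<otimes>\<^sub>o X) X"
  unfolding iso_obj_def by (rule exI[of _ "right_unitor C X"]; simp)
    (rule exI[of _ "left_unitor C X"]; simp)

section \<open>The subquotients form a tensor subcategory\<close>

context
  fixes D E
  assumes D: "tensor_subcategory C D" and E: "tensor_subcategory C E"
begin

lemma subset_subquotients: "D \<subseteq> subquotients D E" "E \<subseteq> subquotients D E"
proof -
  have "X \<in> subquotients D E" if "X \<in> D" for X
    using subquotients_iso[OF unitor_iso_obj(1) tensor_in_subquotients[of X D "\<one>\<^sub>o" E]] that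
      subcategory_Obj[OF D that] tensor_subcategory.unit_mem[OF E] by simp
  then show "D \<subseteq> subquotients D E"
    by blast
  have "X \<in> subquotients D E" if "X \<in> E" for X
    using subquotients_iso[OF unitor_iso_obj(2) tensor_in_subquotients[of "\<one>\<^sub>o" D X E]] that
      subcategory_Obj[OF E that] tensor_subcategory.unit_mem[OF D] by simp
  then show "E \<subseteq> subquotients D E"
    by blast
qed

lemma subquotients_tensor:
  assumes Z: "Z \<in> subquotients D E" and Z': "Z' \<in> subquotients D E"
  shows "Z \<otimes>\<^sub>o Z' \<in> subquotients D E"
proof -
  obtain X Y w e where h: "X \<in> D" "Y \<in> E" "mono w" "epi e" "tgt w = X \<otimes>\<^sub>o Y" "src e = src w"
    "tgt e = Z"
    using Z by (rule subquotientsE)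
  obtain X' Y' w' e' where h': "X' \<in> D" "Y' \<in> E" "mono w'" "epi e'" "tgt w' = X' \<otimes>\<^sub>o Y'"
    "src e' = src w'" "tgt e' = Z'"
    using Z' by (rule subquotientsE)
  have [simp]: "X \<in> Obj C" "X' \<in> Obj C" "Y \<in> Obj C" "Y' \<in> Obj C"
    using h h' D E subcategory_Obj by blast+
  have [simp]: "arr w" "arr w'" "arr e" "arr e'"
    using h h' mono_arr epi_arr by blast+
  have "(X \<otimes>\<^sub>o X') \<otimes>\<^sub>o (Y \<otimes>\<^sub>o Y') \<in> subquotients D E"
    using h h' D E by (intro tensor_in_subquotients) (simp_all add: tensor_subcategory.tensor_mem)
  then have "(X \<otimes>\<^sub>o Y) \<otimes>\<^sub>o (X' \<otimes>\<^sub>o Y') \<in> subquotients D E"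
    by (rule subquotients_iso[OF iso_obj_sym[OF iso_obj_tensor_exchange], rotated 4]) simp_all
  then have "src (w \<otimes>\<^sub>a w') \<in> subquotients D E"
    using h h' by (intro subquotients_mono mono_tensor) simp_all
  then have "tgt (e \<otimes>\<^sub>a e') \<in> subquotients D E"
    using h h' by (intro subquotients_epi epi_tensor) simp_all
  then show ?thesis
    using h h' by simp
qed

text \<open>The sum of \<open>X \<otimes> Y\<close> and \<open>X' \<otimes> Y'\<close> need not
  itself be a product of the required form, but it embeds into \<open>A \<otimes> B\<close> with
  \<open>A\<close> the sum of \<open>X\<close> and \<open>X'\<close>, and \<open>B\<close> the sum
  of \<open>Y\<close> and \<open>Y'\<close>.\<close>

lemma subquotients_direct_sum:
  assumes Z: "Z \<in> subquotients D E" and Z': "Z' \<in> subquotients D E"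
    and S: "is_direct_sum C Z Z' S"
  shows "S \<in> subquotients D E"
proof -
  obtain X Y w e where h: "X \<in> D" "Y \<in> E" "mono w" "epi e" "tgt w = X \<otimes>\<^sub>o Y" "src e = src w"
    "tgt e = Z"
    using Z by (rule subquotientsE)
  obtain X' Y' w' e' where h': "X' \<in> D" "Y' \<in> E" "mono w'" "epi e'" "tgt w' = X' \<otimes>\<^sub>o Y'"
    "src e' = src w'" "tgt e' = Z'"
    using Z' by (rule subquotientsE)
  have [simp]: "X \<in> Obj C" "X' \<in> Obj C" "Y \<in> Obj C" "Y' \<in> Obj C"
    using h h' D E subcategory_Obj by blast+
  have [simp]: "arr w" "arr w'"
    using h h' mono_arr by blast+
  obtain U where U: "is_direct_sum C (src w) (src w') U"
    using direct_sum_exists[of "src w" "src w'"] by auto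
  obtain A where A: "is_direct_sum C X X' A"
    using direct_sum_exists[of X X'] by auto
  obtain B where B: "is_direct_sum C Y Y' B"
    using direct_sum_exists[of Y Y'] by auto
  obtain i j p q where ij [simp]:
    "arr i" "src i = X" "tgt i = A" "arr j" "src j = X'" "tgt j = A"
    "arr p" "src p = A" "tgt p = X" "arr q" "src q = A" "tgt q = X'"
    and eqs: "p \<cdot> i = ident C X" "q \<cdot> j = ident C X'"
    by (rule direct_sumE[OF A]) simp_all
  obtain i' j' p' q' where ij' [simp]:
    "arr i'" "src i' = Y" "tgt i' = B" "arr j'" "src j' = Y'" "tgt j' = B"
    "arr p'" "src p' = B" "tgt p' = Y" "arr q'" "src q' = B" "tgt q' = Y'"
    and eqs': "p' \<cdot> i' = ident C Y" "q' \<cdot> j' = ident C Y'" "p' \<cdot> j' = zr Y' Y" "q' \<cdot> i' = zr Y Y'"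
    by (rule direct_sumE[OF B]) simp_all
  have "\<exists>v. mono v \<and> src v = U \<and> tgt v = A \<otimes>\<^sub>o B"
    by (rule direct_sum_mono[OF U h(3) h'(3), of "i \<otimes>\<^sub>a i'" _ "j \<otimes>\<^sub>a j'" "p \<otimes>\<^sub>a p'" "q \<otimes>\<^sub>a q'"])
      (simp_all add: h h' interchange eqs eqs')
  then obtain v where v: "mono v" "src v = U" "tgt v = A \<otimes>\<^sub>o B"
    by blast
  have "A \<in> D" "B \<in> E"
    using tensor_subcategory.direct_sum_mem[OF D h(1) h'(1) A]
      tensor_subcategory.direct_sum_mem[OF E h(2) h'(2) B] .
  then have "A \<otimes>\<^sub>o B \<in> subquotients D E"
    using D E by (intro tensor_in_subquotients subcategory_Obj)
  then have "U \<in> subquotients D E"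
    using subquotients_mono[OF v(1)] v by simp
  moreover have "\<exists>g. epi g \<and> src g = U \<and> tgt g = S"
    by (rule direct_sum_epi[of e e']) (use U S h h' in simp_all)
  ultimately show ?thesis
    using subquotients_epi by blast
qed

text \<open>Duality exchanges subobjects and quotients: the dual \<open>W'\<close> of the subobject
  of \<open>X \<otimes> Y\<close> is a quotient of the product of the duals, and \<open>V\<close> is
  a subobject of \<open>W'\<close>. The extra unit factors disappear up to isomorphism.\<close>

lemma subquotients_dual:
  assumes Z: "Z \<in> subquotients D E" and dZ: "dual_objects C Z V"
  shows "V \<in> subquotients D E"
proof -
  obtain X Y w e where h: "X \<in> D" "Y \<in> E" "mono w" "epi e" "tgt w = X \<otimes>\<^sub>o Y" "src e = src w"
    "tgt e = Z"
    using Z by (rule subquotientsE)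
  have XY: "X \<in> Obj C" "Y \<in> Obj C"
    using h D E subcategory_Obj by blast+
  obtain X' where X': "dual_objects C X X'"
    using XY by (blast elim: dual_objects_exist)
  obtain Y' where Y': "dual_objects C Y Y'"
    using XY by (blast elim: dual_objects_exist)
  obtain W' where W': "dual_objects C (src w) W'"
    using dual_objects_exist[of "src w"] mono_arr[OF h(3)] by auto
  have XYD: "X' \<in> D" "Y' \<in> E"
    using subcategory_dual[OF D X' h(1)] subcategory_dual[OF E Y' h(2)] .
  have "Y' \<in> subquotients D E" "X' \<in> subquotients D E" "\<one>\<^sub>o \<in> subquotients D E"
    using XYD subset_subquotients tensor_subcategory.unit_mem[OF D] by blast+
  then have "Y' \<otimes>\<^sub>o (X' \<otimes>\<^sub>o \<one>\<^sub>o) \<in> subquotients D E"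
    by (intro subquotients_tensor)
  moreover obtain u where "epi u" "src u = Y' \<otimes>\<^sub>o (X' \<otimes>\<^sub>o \<one>\<^sub>o)" "tgt u = W' \<otimes>\<^sub>o \<one>\<^sub>o"
    using mono_between_duals[OF h(3,5) W' X' Y'] by blast
  ultimately have "W' \<otimes>\<^sub>o \<one>\<^sub>o \<in> subquotients D E"
    using subquotients_epi by metis
  moreover obtain u where "mono u" "src u = V \<otimes>\<^sub>o \<one>\<^sub>o" "tgt u = W' \<otimes>\<^sub>o \<one>\<^sub>o"
    using epi_between_duals[OF h(4), of W' V] W' dZ h(6,7) by auto
  ultimately have "V \<otimes>\<^sub>o \<one>\<^sub>o \<in> subquotients D E"
    using subquotients_mono by metis
  then show ?thesis
    using subquotients_iso unitor_iso_obj(1) dual_objects_Obj(2)[OF dZ] by blast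
qed

lemma tensor_subcategory_subquotients: "tensor_subcategory C (subquotients D E)"
proof
  show S: "subquotients D E \<subseteq> Obj C"
    by (auto elim!: subquotientsE dest: epi_arr)
  show "\<one>\<^sub>o \<in> subquotients D E"
    using subset_subquotients tensor_subcategory.unit_mem[OF D] by blast
  show "X \<in> subquotients D E" if "Y \<in> subquotients D E" "X \<in> Obj C" "is_mono C X Y i" for X Y i
    using that S subquotients_mono[of i D E] is_mono_iff[of X Y i] by auto
  show "Y \<in> subquotients D E" if "X \<in> subquotients D E" "Y \<in> Obj C" "is_epi C X Y p" for X Y p
    using that S subquotients_epi[of p D E] is_epi_iff[of X Y p] by auto
  show "Z \<in> subquotients D E" if "is_zero_object C Z" for Z
    using that subset_subquotients tensor_subcategory.zero_mem[OF D] by blast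
  show "V \<in> subquotients D E" if "X \<in> subquotients D E" "is_left_dual C X V" for X V
    using that subquotients_dual by (simp add: dual_objects_def)
  show "V \<in> subquotients D E" if "X \<in> subquotients D E" "is_right_dual C X V" for X V
    using that subquotients_dual by (simp add: dual_objects_def)
qed (rule subquotients_direct_sum subquotients_tensor; assumption)+

lemma subquotients_are_quotients:
  assumes "Z \<in> subquotients D E"
  obtains X Y e where "X \<in> D" "Y \<in> E" "epi e" "src e = X \<otimes>\<^sub>o Y" "tgt e = Z"
proof -
  note S = tensor_subcategory_subquotients
  obtain \<pi> where \<pi>: "epi \<pi>" "tgt \<pi> = Z" "rel_projective (subquotients D E) (src \<pi>)"
    using enough_rel_projectives[of "subquotients D E" Z] tensor_subcategory.subset[OF S]
      subquotients_mono subquotients_direct_sum assms by metis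
  then have Q: "src \<pi> \<in> subquotients D E"
    by (simp add: rel_projective_def)
  then obtain X Y w e where h: "X \<in> D" "Y \<in> E" "mono w" "epi e" "tgt w = X \<otimes>\<^sub>o Y" "src e = src w"
    "tgt e = src \<pi>"
    by (rule subquotientsE)
  have XY: "X \<otimes>\<^sub>o Y \<in> subquotients D E"
    using h D E by (intro tensor_in_subquotients subcategory_Obj)
  have [simp]: "arr e" "arr w" "arr \<pi>"
    using h \<pi> mono_arr epi_arr by blast+
  have "src w \<in> subquotients D E"
    using subquotients_mono[OF h(3)] h(5) XY by simp
  then obtain s where s: "arr s" "src s = src \<pi>" "tgt s = src e" "e \<cdot> s = ident C (src \<pi>)"
    using rel_projectiveD[OF \<pi>(3) h(4), of "ident C (src \<pi>)"] h Q by auto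
  have "mono s"
    using monoI_left_inverse(1)[of s e] s h by simp
  then have ws: "mono (w \<cdot> s)"
    using h s by (intro mono_cmp[OF h(3)]) simp_all
  obtain r where r: "arr r" "src r = tgt (w \<cdot> s)" "tgt r = src (w \<cdot> s)"
      "r \<cdot> (w \<cdot> s) = ident C (src (w \<cdot> s))"
    by (rule rel_projective_mono_splits[OF S _ ws]) (use \<pi> h s XY in simp_all)
  have "epi r"
    using monoI_left_inverse(2)[of "w \<cdot> s" r] r s h by simp
  then have "epi (\<pi> \<cdot> r)"
    using r s h by (intro epi_cmp[OF \<pi>(1)]) simp_all
  then show thesis
    using that[OF h(1,2), of "\<pi> \<cdot> r"] r s h \<pi> by simp
qed

text \<open>By adjunction an epimorphism \<open>X \<otimes> Y \<rightarrow> Z\<close> corresponds to an arrow \<open>Y \<rightarrow> V \<otimes> Z\<close>, with \<open>V\<close> the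
  dual of \<open>X\<close>; the image \<open>I\<close> of the latter lies in both \<open>E\<close> and \<open>G\<close>, and \<open>X \<otimes> Y \<rightarrow> Z\<close> factors
  through \<open>X \<otimes> I\<close>.\<close>

lemma subquotients_Int:
  assumes G: "tensor_subcategory C G" and DG: "D \<subseteq> G" and F: "tensor_subcategory C F"
    and DF: "D \<subseteq> F" and EF: "E \<inter> G \<subseteq> F"
  shows "subquotients D E \<inter> G \<subseteq> F"
proof
  fix Z
  assume Z: "Z \<in> subquotients D E \<inter> G"
  then obtain X Y e where e: "X \<in> D" "Y \<in> E" "epi e" "src e = X \<otimes>\<^sub>o Y" "tgt e = Z"
    by (blast elim: subquotients_are_quotients)
  have [simp]: "arr e" "X \<in> Obj C" "Y \<in> Obj C" "Z \<in> Obj C"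
    using e Z D E G epi_arr subcategory_Obj by blast+
  obtain V where V: "dual_objects C X V"
    using dual_objects_exist[of X] by auto
  have "V \<otimes>\<^sub>o Z \<in> G"
    using subcategory_dual[OF D V e(1)] DG Z tensor_subcategory.tensor_mem[OF G] by blast
  obtain \<phi> where "adjunction X V \<phi>"
    using dual_adjunction[OF V] .
  note \<phi> = adjunctionD[OF this]
  have \<phi>e: "arr (\<phi> Y e)" "src (\<phi> Y e) = Y" "tgt (\<phi> Y e) = V \<otimes>\<^sub>o Z"
    using \<phi>(3)[of e Y] e by simp_all
  obtain m e0 where m: "mono m" "epi e0" "src m = tgt e0" "tgt m = V \<otimes>\<^sub>o Z" "src e0 = Y"
    "m \<cdot> e0 = \<phi> Y e"
    using image_factorization[OF \<phi>e(1)] \<phi>e by metis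
  have [simp]: "arr m" "arr e0"
    using m mono_arr epi_arr by blast+
  have "src m \<in> G"
    using subcategory_mono[OF G m(1)] m(4) \<open>V \<otimes>\<^sub>o Z \<in> G\<close> by simp
  moreover have "src m \<in> E"
    using subcategory_epi[OF E m(2)] m e(2) by simp
  ultimately have I: "src m \<in> F"
    using EF by blast
  obtain f where f: "arr f" "src f = X \<otimes>\<^sub>o src m" "tgt f = Z" "\<phi> (src m) f = m"
    using \<phi>(5)[of m Z] m by auto
  have "\<phi> Y (f \<cdot> (ident C X \<otimes>\<^sub>a e0)) = \<phi> Y e"
    using \<phi>(7)[of f e0] f m by simp
  then have fe: "f \<cdot> (ident C X \<otimes>\<^sub>a e0) = e"
    by (rule \<phi>(4)) (use f m e in simp_all)
  have "epi f"
    by (rule epi_of_epi_cmp[of f "ident C X \<otimes>\<^sub>a e0"]) (use fe e f m in simp_all)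
  moreover have "src f \<in> F"
    using tensor_subcategory.tensor_mem[OF F _ I] f DF e(1) by auto
  ultimately show "Z \<in> F"
    using subcategory_epi[OF F] f(3) by blast
qed

end

section \<open>The modular law\<close>

lemma modular_lattice_tensor_subcategories: "modular_lattice (tensor_subcategories C)"
proof (intro modular_lattice.intro lattice_tensor_subcategories modular_lattice_axioms.intro)
  let ?L = "tensor_subcategories C"
  fix x y z
  assume "x \<in> carrier ?L" "y \<in> carrier ?L" "z \<in> carrier ?L" and "x \<sqsubseteq>\<^bsub>?L\<^esub> z"
  then have x: "tensor_subcategory C x" and y: "tensor_subcategory C y"
    and z: "tensor_subcategory C z" and xz: "x \<subseteq> z"
    by (simp_all add: tensor_subcategories_def)
  have yz: "tensor_subcategory C (y \<inter> z)"
    using tensor_subcategory_Inter[of "{y, z}" C] y z by auto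
  have xy: "tensor_subcategory C (\<Inter>{F. tensor_subcategory C F \<and> x \<subseteq> F \<and> y \<subseteq> F})"
    using least_mem[OF least_tensor_subcategories[OF x y]]
    by (simp add: Upper_def tensor_subcategories_def)
  have "\<Inter>{F. tensor_subcategory C F \<and> x \<subseteq> F \<and> y \<inter> z \<subseteq> F}
      = \<Inter>{F. tensor_subcategory C F \<and> x \<subseteq> F \<and> y \<subseteq> F} \<inter> z" (is "?l = ?r")
  proof
    show "?l \<subseteq> ?r"
      using z xz by blast
    \<comment> \<open>The subquotients are one of the tensor subcategories whose intersection is the
      join; \<open>subquotients_Int\<close> is then applied to each member \<open>F\<close> of the
      intersection on the left.\<close>
    have "?r \<subseteq> subquotients x y \<inter> z"
      using tensor_subcategory_subquotients[OF x y] subset_subquotients[OF x y] by blast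
    then show "?r \<subseteq> ?l"
      using subquotients_Int[OF x y z xz] by blast
  qed
  then show "x \<squnion>\<^bsub>?L\<^esub> (y \<sqinter>\<^bsub>?L\<^esub> z) = (x \<squnion>\<^bsub>?L\<^esub> y) \<sqinter>\<^bsub>?L\<^esub> z"
    using x y z yz xy by (simp add: join_tensor_subcategories meet_tensor_subcategories)
qed

end

theorem corollary3p3:
  fixes K :: "('k, 'a) ring_scheme"
    and C :: "('o, 'm, 'k, 'b) braided_category_scheme"
  assumes "algebraically_closed K"
    and "braided_finite_tensor_category K C"
  shows "modular_lattice (tensor_subcategories C)"
  using assms(2) by (rule braided_finite_tensor_category.modular_lattice_tensor_subcategories)

end
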